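(* Let $K$ be a field, $S=K[x_1,\ldots,x_n]$ with the standard grading, $\mathfrak{m}=(x_1,\ldots,x_n)$, and $A=K[x_1,\ldots,x_n,y_1,\ldots,y_m]$ with the bigrading $\deg x_i=(1,0)$ and $\deg y_j=(p,1)$ for all $j$, where $p\ge0$ is a fixed integer. Let $M$ be a finitely generated bigraded $A$-module and let $M_k=\bigoplus_{i\in\mathbb{Z}}M_{(i,k)}$, a finitely generated graded $S$-module. Then, for every $i\ge 0$ and for $k\gg0$, the higher iterated Hilbert coefficient $e^i_j(M_k)$ is a polynomial in $k$, with $$\deg e^i_j(M_k)\le \dim M/\mathfrak{m}M+j-1\quad\text{for } j=0,\ldots,\operatorname{ldim}M+i-1,$$ and $e^i_j(M_k)=0$ for $j>\operatorname{ldim}M+i-1$.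
   Context: For a finitely generated graded $S$-module $W$ of Krull dimension $d$, put $H_0(W,k)=\dim_K W_k$ and recursively $H_i(W,k)=\sum_{j\le k}H_{i-1}(W,j)$ for $i\ge1$. For $k\gg0$ one has $H_i(W,k)=P^i_W(k)$ for a unique polynomial $P^i_W(x)\in\mathbb{Q}[x]$ of degree $d+i-1$ (the $i$th Hilbert polynomial), written $$P^i_W(x)=\sum_{j=0}^{d+i-1}(-1)^j e^i_j(W)\binom{x+d+i-j-1}{d+i-j-1}.$$ The integers $e^i_j(W)$, $0\le j\le d+i-1$, are the higher iterated Hilbert coefficients of $W$; set $e^i_j(W)=0$ for $j>d+i-1$. The zero module has dimension $-\infty$, so all of its coefficients are $0$. For a finitely generated bigraded $A$-module $M$, the Krull dimension $\dim M_k$ is constant for $k\gg0$, and $\operatorname{ldim}M:=\lim_{k\to\infty}\dim M_k$. Here $\dim M/\mathfrak{m}M$ is the Krull dimension of the $A$-module $M/\mathfrak{m}M$. Convention: the zero polynomial has degree $-1$. *)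

theory Defs
  imports
    "HOL-Library.Poly_Mapping"
    "HOL-Library.Extended_Real"
    "HOL-Computational_Algebra.Polynomial"
begin

section \<open>Polynomial rings\<close>

text \<open>
  Polynomials over \<open>'k\<close> in finitely many variables, indexed by a finite type \<open>'v\<close>;
  multiplication is the convolution product of \<open>Poly_Mapping\<close>. Thus \<open>S\<close> is \<open>('x, 'k) mpoly\<close>
  and \<open>A\<close> is \<open>('x + 'y, 'k) mpoly\<close>, with \<open>n = CARD('x)\<close> and \<open>m = CARD('y)\<close>.
\<close>

type_synonym ('v, 'k) mpoly = "('v \<Rightarrow>\<^sub>0 nat) \<Rightarrow>\<^sub>0 'k"

definition mconst :: "'k \<Rightarrow> ('v, 'k::field) mpoly" where
  "mconst c = Poly_Mapping.single 0 c"

definition mvar :: "'v \<Rightarrow> ('v, 'k::field) mpoly" where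
  "mvar v = Poly_Mapping.single (Poly_Mapping.single v 1) 1"

definition push_keys :: "('a \<Rightarrow> 'b) \<Rightarrow> ('a \<Rightarrow>\<^sub>0 'c::comm_monoid_add) \<Rightarrow> ('b \<Rightarrow>\<^sub>0 'c)" where
  "push_keys h f =
    (\<Sum>a\<in>Poly_Mapping.keys f. Poly_Mapping.single (h a) (Poly_Mapping.lookup f a))"

text \<open>The inclusion \<open>S \<subseteq> A\<close>, sending \<open>x\<^sub>i\<close> to \<open>x\<^sub>i\<close>.\<close>

definition incl :: "('x, 'k::field) mpoly \<Rightarrow> ('x + 'y, 'k) mpoly" where
  "incl = push_keys (push_keys Inl)"

definition bideg :: "nat \<Rightarrow> ('x::finite + 'y::finite \<Rightarrow>\<^sub>0 nat) \<Rightarrow> int \<times> int" where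
  "bideg p a =
    (let u = (\<Sum>i\<in>UNIV. Poly_Mapping.lookup a (Inl i));
         v = (\<Sum>j\<in>UNIV. Poly_Mapping.lookup a (Inr j))
     in (int (u + p * v), int v))"

definition bihomogeneous ::
    "nat \<Rightarrow> int \<times> int \<Rightarrow> ('x::finite + 'y::finite, 'k::field) mpoly \<Rightarrow> bool" where
  "bihomogeneous p d f \<longleftrightarrow> (\<forall>a\<in>Poly_Mapping.keys f. bideg p a = d)"


section \<open>Bigraded modules\<close>

definition internal_sum :: "('i \<Rightarrow> 'm::comm_monoid_add set) \<Rightarrow> 'm set" where
  "internal_sum G = {\<Sum>i\<in>I. w i | I w. finite I \<and> (\<forall>i\<in>I. w i \<in> G i)}"

definition independent_family :: "('i \<Rightarrow> 'm::comm_monoid_add set) \<Rightarrow> bool" where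
  "independent_family G \<longleftrightarrow>
    (\<forall>I w. finite I \<longrightarrow> (\<forall>i\<in>I. w i \<in> G i) \<longrightarrow> (\<Sum>i\<in>I. w i) = 0 \<longrightarrow> (\<forall>i\<in>I. w i = 0))"

text \<open>The \<open>A\<close>-module \<open>M\<close> is the whole type \<open>'m\<close>, and \<open>gr (i, k)\<close> is \<open>M\<^bsub>(i,k)\<^esub>\<close>.\<close>

locale bigraded_module = module scale
  for scale :: "('x::finite + 'y::finite, 'k::field) mpoly \<Rightarrow> 'm::ab_group_add \<Rightarrow> 'm" +
  fixes p :: nat and gr :: "int \<times> int \<Rightarrow> 'm set"
  assumes component: "module.subspace (\<lambda>c. scale (mconst c)) (gr d)"
    and total: "internal_sum gr = UNIV"
    and direct: "independent_family gr"
    and graded: "bihomogeneous p (a, b) f \<Longrightarrow> w \<in> gr (i, k) \<Longrightarrow> scale f w \<in> gr (a + i, b + k)"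

definition fin_gen :: "('r::comm_ring_1 \<Rightarrow> 'm::ab_group_add \<Rightarrow> 'm) \<Rightarrow> bool" where
  "fin_gen scale \<longleftrightarrow> (\<exists>B. finite B \<and> module.span scale B = UNIV)"

text \<open>The graded \<open>S\<close>-module \<open>M\<^sub>k\<close>: its components, as a family indexed by \<open>i\<close>.
  Its underlying set is \<open>internal_sum (row gr k)\<close>.\<close>

definition row :: "(int \<times> int \<Rightarrow> 'm set) \<Rightarrow> int \<Rightarrow> int \<Rightarrow> 'm set" where
  "row gr k = (\<lambda>i. gr (i, k))"

definition restrict_S ::
    "(('x + 'y, 'k::field) mpoly \<Rightarrow> 'm \<Rightarrow> 'm) \<Rightarrow> ('x, 'k) mpoly \<Rightarrow> 'm \<Rightarrow> 'm" where
  "restrict_S scale = (\<lambda>f. scale (incl f))"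


section \<open>Krull dimension\<close>

text \<open>A subset of a commutative ring is an ideal iff it is a submodule of the regular module.\<close>

definition prime_ideal :: "'r::comm_ring_1 set \<Rightarrow> bool" where
  "prime_ideal P \<longleftrightarrow>
    module.subspace (*) P \<and> P \<noteq> UNIV \<and> (\<forall>a b. a * b \<in> P \<longrightarrow> a \<in> P \<or> b \<in> P)"

text \<open>\<open>dim R/I\<close>, through the primes containing \<open>I\<close>; it is \<open>-\<infinity>\<close> when \<open>I\<close> is the whole ring.\<close>

definition krull_dim_quot :: "'r::comm_ring_1 set \<Rightarrow> ereal" where
  "krull_dim_quot I =
    Sup {ereal (real n) | n.
      \<exists>P. (\<forall>i\<le>n. prime_ideal (P i) \<and> I \<subseteq> P i) \<and> (\<forall>i<n. P i \<subset> P (Suc i))}"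

text \<open>The annihilator of the module \<open>W/N\<close>, for submodules \<open>N \<subseteq> W\<close> of the ambient module:
  \<open>a\<close> kills every coset \<open>w + N\<close> iff \<open>a w \<in> N\<close> for all \<open>w \<in> W\<close>.\<close>

definition annihilator ::
    "('r::comm_ring_1 \<Rightarrow> 'm::ab_group_add \<Rightarrow> 'm) \<Rightarrow> 'm set \<Rightarrow> 'm set \<Rightarrow> 'r set" where
  "annihilator scale W N = {a. \<forall>w\<in>W. scale a w \<in> N}"

text \<open>The Krull dimension of \<open>W/N\<close>, i.e. of the ring modulo the annihilator of \<open>W/N\<close>;
  the dimension of the zero module is \<open>-\<infinity>\<close>.\<close>

definition krull_dim ::
    "('r::comm_ring_1 \<Rightarrow> 'm::ab_group_add \<Rightarrow> 'm) \<Rightarrow> 'm set \<Rightarrow> 'm set \<Rightarrow> ereal" where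
  "krull_dim scale W N = krull_dim_quot (annihilator scale W N)"

definition irrelevant_ideal :: "('x, 'k::field) mpoly set" where
  "irrelevant_ideal = module.span (*) (range mvar)"

definition ideal_times ::
    "('r::comm_ring_1 \<Rightarrow> 'm::ab_group_add \<Rightarrow> 'm) \<Rightarrow> 'r set \<Rightarrow> 'm set \<Rightarrow> 'm set" where
  "ideal_times scale I W = module.span scale {scale a w | a w. a \<in> I \<and> w \<in> W}"

text \<open>\<open>dim M/\<mm>M\<close>, where \<open>M/\<mm>M\<close> is regarded as an \<open>A\<close>-module.\<close>

definition fibre_dim ::
    "(('x + 'y, 'k::field) mpoly \<Rightarrow> 'm::ab_group_add \<Rightarrow> 'm) \<Rightarrow> ereal" where
  "fibre_dim scale =
    krull_dim scale UNIV (ideal_times (restrict_S scale) irrelevant_ideal UNIV)"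

definition row_dim ::
    "(('x + 'y, 'k::field) mpoly \<Rightarrow> 'm::ab_group_add \<Rightarrow> 'm) \<Rightarrow> (int \<times> int \<Rightarrow> 'm set)
      \<Rightarrow> int \<Rightarrow> ereal" where
  "row_dim scale gr k = krull_dim (restrict_S scale) (internal_sum (row gr k)) {0}"

definition ldim ::
    "(('x + 'y, 'k::field) mpoly \<Rightarrow> 'm::ab_group_add \<Rightarrow> 'm) \<Rightarrow> (int \<times> int \<Rightarrow> 'm set)
      \<Rightarrow> ereal" where
  "ldim scale gr = Lim at_top (row_dim scale gr)"


section \<open>Higher iterated Hilbert coefficients\<close>

text \<open>
  In this section \<open>G\<close> is the family of components of a graded \<open>S\<close>-module
  \<open>W = internal_sum G\<close>. The sum over all \<open>j \<le> k\<close> has only finitely many nonzero terms when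
  \<open>W\<close> is finitely generated, and is taken over these.
\<close>

primrec iter_hilbert ::
    "(('x, 'k::field) mpoly \<Rightarrow> 'm::ab_group_add \<Rightarrow> 'm) \<Rightarrow> (int \<Rightarrow> 'm set)
      \<Rightarrow> nat \<Rightarrow> int \<Rightarrow> nat" where
  "iter_hilbert scale G 0 = (\<lambda>k. vector_space.dim (\<lambda>c. scale (mconst c)) (G k))"
| "iter_hilbert scale G (Suc i) =
    (\<lambda>k. \<Sum>j | j \<le> k \<and> iter_hilbert scale G i j \<noteq> 0. iter_hilbert scale G i j)"

definition hilbert_poly ::
    "(('x, 'k::field) mpoly \<Rightarrow> 'm::ab_group_add \<Rightarrow> 'm) \<Rightarrow> (int \<Rightarrow> 'm set)
      \<Rightarrow> nat \<Rightarrow> rat poly" where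
  "hilbert_poly scale G i =
    (THE P. eventually (\<lambda>k. of_nat (iter_hilbert scale G i k) = poly P (of_int k)) at_top)"

text \<open>
  \<open>is_hilbert_coeffs scale G i e\<close> says that \<open>e j\<close> is \<open>e\<^sup>i\<^sub>j(W)\<close> for all \<open>j\<close>. With \<open>d = dim W\<close>, the
  range \<open>0 \<le> j \<le> d + i - 1\<close> is \<open>j < d + i\<close>, and there the truncated subtraction
  \<open>d + i - j - 1\<close> is the integer one.
\<close>

definition is_hilbert_coeffs ::
    "(('x, 'k::field) mpoly \<Rightarrow> 'm::ab_group_add \<Rightarrow> 'm) \<Rightarrow> (int \<Rightarrow> 'm set)
      \<Rightarrow> nat \<Rightarrow> (nat \<Rightarrow> int) \<Rightarrow> bool" where
  "is_hilbert_coeffs scale G i e \<longleftrightarrow>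
    (krull_dim scale (internal_sum G) {0} = -\<infinity> \<longrightarrow> (\<forall>j. e j = 0)) \<and>
    (\<forall>d::nat. krull_dim scale (internal_sum G) {0} = ereal (real d) \<longrightarrow>
      (\<forall>j\<ge>d + i. e j = 0) \<and>
      (\<forall>x::rat. poly (hilbert_poly scale G i) x =
        (\<Sum>j<d + i. (- 1) ^ j * of_int (e j) *
          ((x + of_nat (d + i - j - 1)) gchoose (d + i - j - 1)))))"

definition hilbert_coeff ::
    "(('x, 'k::field) mpoly \<Rightarrow> 'm::ab_group_add \<Rightarrow> 'm) \<Rightarrow> (int \<Rightarrow> 'm set)
      \<Rightarrow> nat \<Rightarrow> nat \<Rightarrow> int" where
  "hilbert_coeff scale G i = (THE e. is_hilbert_coeffs scale G i e)"

definition row_coeff ::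
    "(('x + 'y, 'k::field) mpoly \<Rightarrow> 'm::ab_group_add \<Rightarrow> 'm) \<Rightarrow> (int \<times> int \<Rightarrow> 'm set)
      \<Rightarrow> nat \<Rightarrow> nat \<Rightarrow> int \<Rightarrow> int" where
  "row_coeff scale gr i j k = hilbert_coeff (restrict_S scale) (row gr k) i j"

text \<open>The degree of a polynomial, with the convention that the zero polynomial has degree \<open>-1\<close>
  (the library's \<open>Polynomial.degree\<close> gives it degree \<open>0\<close>).\<close>

definition deg :: "rat poly \<Rightarrow> ereal" where
  "deg q = (if q = 0 then -1 else ereal (real (Polynomial.degree q)))"

end

theory Submission
  imports Defs "HOL-Library.FuncSet" "HOL-Library.Countable" "HOL-Library.Cardinality"
    "HOL-Library.Product_Plus"
begin

text \<open>
  Put \<open>hf u k = dim M\<^bsub>(u + p k, k)\<^esub>\<close>. In this shifted grading every \<open>x\<^sub>i\<close> has degree \<open>(1, 0)\<close> and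
  every \<open>y\<^sub>j\<close> has degree \<open>(0, 1)\<close>, and the Hilbert function of \<open>M\<^sub>k\<close> is \<open>i \<mapsto> hf (i - p k) k\<close>.

  For a monomial order, the standard monomials (those that are not combinations of smaller ones
  of the same degree) form order ideals, one for each homogeneous generator of \<open>M\<close>, and they are a
  basis of \<open>M\<close>. By Dickson's lemma the counting function of an order ideal is a finite sum
  of products \<open>\<phi>(u) \<psi>(k)\<close> in which \<open>\<phi>\<close> and \<open>\<psi>\<close> are eventually polynomial (\<open>bisep_mcount\<close>,
  \<open>bisep_hf\<close>). Hence \<open>hf u k = \<Sum>\<^sub>r \<Phi>\<^sub>r(u) k\<^sup>r\<close> for all \<open>u\<close> as soon as \<open>k\<close> is large.

  Let \<open>l = dim M/\<mm>M\<close>. The part of \<open>M\<close> of a fixed \<open>x\<close>-degree \<open>u\<close> is exhausted by finitely many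
  steps \<open>\<mm>\<^sup>sM/\<mm>\<^bsup>s+1\<^esup>M\<close>, each no larger than finitely many copies of \<open>M/\<mm>M\<close>, so \<open>k \<mapsto> hf u k\<close> is a polynomial of
  degree less than \<open>l\<close> (\<open>fibre_growth\<close>). This forces \<open>\<Phi>\<^sub>r = 0\<close> for \<open>r \<ge> l\<close>
  (\<open>hf_polynomial_in_k\<close>) and takes the place of a Noether normalization of the fibre, which over a
  finite field would need an extension of \<open>K\<close>. Summing \<open>i\<close> times, the \<open>i\<close>th Hilbert polynomial of
  \<open>M\<^sub>k\<close> is \<open>\<Sum>\<^bsub>r<l\<^esub> k\<^sup>r G\<^sub>r(x - p k)\<close> with polynomials \<open>G\<^sub>r\<close> independent of \<open>k\<close>.

  Write \<open>\<nabla>P(x) = P(x) - P(x - 1)\<close>, and let \<open>D = d + i\<close> with \<open>d = ldim M\<close>. Newton's expansion in the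
  basis \<open>binom(x + s, s)\<close> gives
  \<open>e\<^sub>j = (-1)\<^sup>j (\<nabla>\<^bsup>D-1-j\<^esup>P)(-1) = (-1)\<^sup>j \<Sum>\<^bsub>r<l\<^esub> k\<^sup>r (\<nabla>\<^bsup>D-1-j\<^esup>G\<^sub>r)(-1 - p k)\<close>, and since \<open>G\<^sub>r\<close> has degree less than
  \<open>D\<close>, this is a polynomial in \<open>k\<close> of degree at most \<open>l - 1 + j\<close> (\<open>row_coeff_polynomial\<close>).

  What remains is to compare growth with Krull dimension. A chain of primes of length \<open>r\<close> yields
  \<open>r\<close> algebraically independent elements, so the dimension of a polynomial ring is at most the
  number of variables (\<open>prime_chain_length\<close>). Conversely, if \<open>d\<close> variables are independent modulo a
  homogeneous ideal, then there is a chain of length \<open>d\<close> above it: pass to a homogeneous prime and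
  add a variable, which lowers the growth by at most one degree (\<open>prime_chain_of_alg_indep\<close>); and
  if no \<open>d + 1\<close> variables are independent, the standard monomials grow at most like \<open>t\<^sup>d\<close>. Finally,
  the annihilators of the \<open>M\<^sub>k\<close> increase for large \<open>k\<close>, so their dimensions decrease and
  become constant (\<open>row_dim_eventually_ldim\<close>).
\<close>

section \<open>Backward differences of rational polynomials\<close>

definition nabla :: "rat poly \<Rightarrow> rat poly" where
  "nabla P = P - pcompose P [:-1, 1:]"

lemma poly_nabla [simp]: "poly (nabla P) x = poly P x - poly P (x - 1)"
  by (simp add: nabla_def poly_pcompose)

lemma nabla_linear:
  "nabla 0 = 0" "nabla (P + Q) = nabla P + nabla Q" "nabla (P - Q) = nabla P - nabla Q"
  "nabla (smult c P) = smult c (nabla P)"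
  by (auto intro!: poly_eq_poly_eq_iff[THEN iffD1] simp: algebra_simps)

lemma nabla_const: "nabla [:c:] = 0" "nabla 1 = 0"
  by (auto intro!: poly_eq_poly_eq_iff[THEN iffD1])

lemma nabla_sum: "nabla (\<Sum>a\<in>A. f a) = (\<Sum>a\<in>A. nabla (f a))"
  by (induct A rule: infinite_finite_induct) (auto simp: nabla_linear)

lemma nabla_shift: "nabla (pcompose P [:c, 1:]) = pcompose (nabla P) [:c, 1:]"
  by (auto intro!: poly_eq_poly_eq_iff[THEN iffD1] simp: poly_pcompose algebra_simps)

lemma nabla_pow_linear:
  "(nabla ^^ n) 0 = 0" "(nabla ^^ n) (P + Q) = (nabla ^^ n) P + (nabla ^^ n) Q"
  "(nabla ^^ n) (smult c P) = smult c ((nabla ^^ n) P)"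
  by (induct n) (auto simp: nabla_linear)

lemma nabla_pow_sum: "(nabla ^^ n) (\<Sum>a\<in>A. f a) = (\<Sum>a\<in>A. (nabla ^^ n) (f a))"
  by (induct n) (auto simp: nabla_sum)

lemma nabla_pow_shift: "(nabla ^^ n) (pcompose P [:c, 1:]) = pcompose ((nabla ^^ n) P) [:c, 1:]"
  by (induct n) (auto simp: nabla_shift)

lemma nabla_eq_0D:
  assumes "nabla P = 0"
  shows "P = [:poly P (-1):]"
proof -
  have step: "poly P x = poly P (x - 1)" for x
    using assms poly_nabla[of P x] by simp
  have "poly P (- 1 - of_nat n) = poly P (-1)" for n :: nat
  proof (induct n)
    case (Suc n)
    then show ?case using step[of "- 1 - of_nat n"] by (simp add: algebra_simps)
  qed simp
  then have "range (\<lambda>n::nat. - 1 - of_nat n) \<subseteq> {x. poly (P - [:poly P (-1):]) x = 0}"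
    by auto
  moreover have "infinite (range (\<lambda>n::nat. - 1 - of_nat n :: rat))"
    by (intro range_inj_infinite) (auto simp: inj_on_def)
  ultimately have "P - [:poly P (-1):] = 0"
    using poly_roots_finite finite_subset by blast
  then show ?thesis by simp
qed

text \<open>The polynomial \<open>binom(x + s, s)\<close>. These polynomials are the basis in which Hilbert
  coefficients are read off, and backward differences shift them down.\<close>

definition binp :: "nat \<Rightarrow> rat poly" where
  "binp s = smult (1 / fact s) (\<Prod>i<s. [:of_nat s - of_nat i, 1:])"

lemma poly_binp: "poly (binp s) x = (x + of_nat s) gchoose s"
  by (simp add: binp_def gbinomial_prod_rev poly_prod atLeast0LessThan algebra_simps)

lemma degree_binp: "degree (binp s) \<le> s"
proof -
  have "degree (\<Prod>i<s. [:of_nat s - of_nat i, 1::rat:]) \<le> (\<Sum>i<s. degree [:of_nat s - of_nat i, 1::rat:])"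
    by (rule order.trans[OF degree_prod_sum_le]) auto
  then show ?thesis
    by (auto simp: binp_def)
qed

lemma nabla_binp_Suc: "nabla (binp (Suc s)) = binp s"
proof (rule poly_eq_poly_eq_iff[THEN iffD1], rule ext)
  fix x
  show "poly (nabla (binp (Suc s))) x = poly (binp s) x"
    using gbinomial_Suc_Suc[of "x + of_nat s" s]
    by (simp add: poly_binp algebra_simps)
qed

lemma binp_0 [simp]: "binp 0 = 1"
  by (simp add: binp_def)

lemma nabla_pow_binp: "(nabla ^^ s) (binp t) = (if s \<le> t then binp (t - s) else 0)"
proof (induct s)
  case (Suc s)
  show ?case
    using Suc nabla_binp_Suc[of "t - Suc s"]
    by (auto simp: nabla_linear nabla_const Suc_diff_Suc not_less_eq_eq)
qed simp

lemma binp_at_minus_1: "poly (binp s) (-1) = (if s = 0 then 1 else 0)"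
proof (cases s)
  case (Suc n)
  have "(-1 + of_nat (Suc n) :: rat) = of_nat n" by simp
  then show ?thesis
    using Suc by (simp add: poly_binp flip: binomial_gbinomial)
qed simp

text \<open>Newton's expansion: the coordinate of \<open>P\<close> along \<open>binp s\<close> is \<open>(\<nabla>\<^sup>s P)(-1)\<close>, because
  \<open>\<nabla>\<close> lowers the index of \<open>binp\<close> and only \<open>binp 0\<close> is nonzero at \<open>-1\<close>.\<close>

lemma newton_expansion:
  "(nabla ^^ N) P = 0 \<Longrightarrow> P = (\<Sum>s<N. smult (poly ((nabla ^^ s) P) (-1)) (binp s))"
proof (induct N arbitrary: P)
  case (Suc N)
  define Q where "Q = (\<Sum>s<Suc N. smult (poly ((nabla ^^ s) P) (-1)) (binp s))"
  have "(nabla ^^ N) (nabla P) = 0"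
    using Suc.prems by (simp add: funpow_swap1)
  then have "nabla P = (\<Sum>s<N. smult (poly ((nabla ^^ s) (nabla P)) (-1)) (binp s))"
    by (rule Suc.hyps)
  also have "\<dots> = (\<Sum>s<N. smult (poly ((nabla ^^ Suc s) P) (-1)) (nabla (binp (Suc s))))"
    by (simp add: nabla_binp_Suc funpow_swap1)
  also have "\<dots> = nabla Q"
    unfolding Q_def sum.lessThan_Suc_shift
    using nabla_pow_binp[of 1 0] nabla_const by (simp add: nabla_linear nabla_sum)
  finally have "nabla (P - Q) = 0"
    by (simp add: nabla_linear)
  then have "P - Q = [:poly (P - Q) (-1):]"
    by (rule nabla_eq_0D)
  moreover have "poly Q (-1) = poly P (-1)"
    unfolding Q_def sum.lessThan_Suc_shift by (simp add: poly_sum binp_at_minus_1)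
  ultimately have "P = Q" by simp
  then show ?case unfolding Q_def .
qed simp

lemma degree_le_of_nabla:
  assumes "(nabla ^^ Suc n) P = 0"
  shows "degree P \<le> n"
proof -
  have "degree (\<Sum>s<Suc n. smult (poly ((nabla ^^ s) P) (-1)) (binp s)) \<le> n"
    by (intro degree_sum_le) (auto intro: order.trans[OF degree_smult_le] order.trans[OF degree_binp])
  then show ?thesis
    using newton_expansion[OF assms] by simp
qed

lemma nabla_pow_eq_0:
  "degree P < n \<Longrightarrow> (nabla ^^ n) P = 0"
proof (induct n arbitrary: P)
  case (Suc n)
  have shift_degree: "degree (pcompose P [:-1, 1:]) = degree P" for P :: "rat poly"
    by (simp add: degree_pcompose)
  have *: "degree (nabla P) < degree P \<or> degree P = 0"
  proof (rule disjCI)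
    assume nz: "degree P \<noteq> 0"
    have "coeff (nabla P) (degree P) = 0"
      using lead_coeff_comp[of "[:-1, 1:]" P] shift_degree[of P]
      by (simp add: nabla_def)
    moreover have "degree (nabla P) \<le> degree P"
      unfolding nabla_def by (intro degree_diff_le) (auto simp: shift_degree)
    ultimately show "degree (nabla P) < degree P"
      using nz by (metis degree_0 eq_zero_or_degree_less gr0I)
  qed
  show ?case
  proof (cases "degree P = 0")
    case True
    then obtain c where "P = [:c:]" by (rule degree_eq_zeroE)
    then have "nabla P = 0" by (simp add: nabla_const)
    then show ?thesis by (simp add: funpow_swap1 nabla_pow_linear)
  next
    case False
    then have "degree (nabla P) < n" using * Suc.prems by simp
    then have "(nabla ^^ n) (nabla P) = 0" by (rule Suc.hyps)
    then show ?thesis by (simp add: funpow_swap1)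
  qed
qed simp

lemma poly_eq_of_eventually:
  fixes P Q :: "rat poly"
  assumes "eventually (\<lambda>k::int. poly P (of_int k) = poly Q (of_int k)) at_top"
  shows "P = Q"
proof (rule ccontr)
  assume "P \<noteq> Q"
  then have fin: "finite {x. poly (P - Q) x = 0}"
    by (intro poly_roots_finite) simp
  obtain k0 where k0: "\<And>k. k \<ge> k0 \<Longrightarrow> poly P (of_int k) = poly Q (of_int k)"
    using assms unfolding eventually_at_top_linorder by blast
  have "of_int ` {k0..} \<subseteq> {x. poly (P - Q) x = 0}"
    using k0 by auto
  moreover have "infinite ((of_int :: int \<Rightarrow> rat) ` {k0..})"
    by (subst finite_image_iff) (auto simp: inj_on_def infinite_Ici)
  ultimately show False
    using fin finite_subset by blast
qed

text \<open>Induction on the degree: the difference is integer-valued everywhere, so integrality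
  propagates from large arguments downwards.\<close>

lemma integer_valued_everywhere:
  assumes "(nabla ^^ N) P = 0"
    and "eventually (\<lambda>k::int. poly P (of_int k) \<in> \<int>) at_top"
  shows "poly P (of_int k) \<in> \<int>"
  using assms
proof (induct N arbitrary: P k)
  case (Suc N)
  obtain k0 where k0: "\<And>k. k \<ge> k0 \<Longrightarrow> poly P (of_int k) \<in> \<int>"
    using Suc.prems(2) unfolding eventually_at_top_linorder by blast
  have "poly (nabla P) (of_int k) \<in> \<int>" if "k \<ge> k0 + 1" for k
    using k0[of k] k0[of "k - 1"] that by auto
  then have "eventually (\<lambda>k::int. poly (nabla P) (of_int k) \<in> \<int>) at_top"
    unfolding eventually_at_top_linorder by blast
  moreover have "(nabla ^^ N) (nabla P) = 0"
    using Suc.prems(1) by (simp add: funpow_swap1)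
  ultimately have D: "poly (nabla P) (of_int k) \<in> \<int>" for k
    using Suc.hyps by blast
  have "poly P (of_int k) \<in> \<int>" if "k \<le> k0" for k
    using that
  proof (induct k rule: int_le_induct)
    case base
    show ?case using k0 by simp
  next
    case (step i)
    have "poly P (of_int (i - 1)) = poly P (of_int i) - poly (nabla P) (of_int i)"
      by simp
    then show ?case using step D by (metis Ints_diff)
  qed
  then show ?case
    using k0 by (cases "k \<le> k0") auto
qed simp

lemma nabla_pow_in_Ints:
  assumes "\<And>k::int. poly P (of_int k) \<in> \<int>"
  shows "poly ((nabla ^^ s) P) (of_int k) \<in> \<int>"
proof (induct s arbitrary: k)
  case (Suc s)
  have "poly ((nabla ^^ s) P) (of_int k - 1) \<in> \<int>"
    using Suc[of "k - 1"] by simp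
  then show ?case using Suc[of k] by simp
qed (use assms in simp)

lemma binp_coordinates_unique:
  assumes "P = (\<Sum>j<N. smult (c j) (binp (N - 1 - j)))" and "j < N"
  shows "c j = poly ((nabla ^^ (N - 1 - j)) P) (-1)"
proof -
  have value_at: "poly ((nabla ^^ s) (smult a (binp t))) (-1) = (if s = t then a else 0)" for s t a
    by (simp add: nabla_pow_linear nabla_pow_binp binp_at_minus_1)
  have "poly ((nabla ^^ (N - 1 - j)) P) (-1) =
      (\<Sum>i<N. if N - 1 - j = N - 1 - i then c i else 0)"
    unfolding assms(1) nabla_pow_sum poly_sum value_at ..
  also have "\<dots> = (\<Sum>i<N. if i = j then c i else 0)"
    using assms(2) by (intro sum.cong) auto
  also have "\<dots> = c j"
    using assms(2) by simp
  finally show ?thesis by simp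
qed

section \<open>Growth and degree\<close>

lemma eventually_poly_ge_lead_coeff:
  fixes P :: "'a::linordered_field poly"
  assumes "lead_coeff P > 0"
  shows "\<exists>n. \<forall>x\<ge>n. poly P x \<ge> lead_coeff P"
  using assms
proof (induct P)
  case (pCons a p)
  show ?case
  proof (cases "p = 0")
    case False
    then have pos: "lead_coeff p > 0" using pCons.prems by simp
    then obtain n where n: "\<And>x. x \<ge> n \<Longrightarrow> poly p x \<ge> lead_coeff p"
      using pCons.hyps by blast
    have "poly (pCons a p) x \<ge> lead_coeff p"
      if x: "x \<ge> max n (1 + \<bar>a\<bar> / lead_coeff p)" for x
    proof -
      have "lead_coeff p + \<bar>a\<bar> = (1 + \<bar>a\<bar> / lead_coeff p) * lead_coeff p"
        using pos by (subst distrib_right) (simp del: leading_coeff_0_iff)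
      also have "\<dots> \<le> x * poly p x"
      proof (rule mult_mono)
        have "0 \<le> 1 + \<bar>a\<bar> / lead_coeff p" using pos by simp
        then show "0 \<le> x" using x by linarith
      qed (use x n[of x] pos in simp_all)
      finally show ?thesis by simp
    qed
    then show ?thesis using False by (metis lead_coeff_pCons(1))
  qed (use pCons.prems in auto)
qed (auto)

text \<open>If the degree were larger, subtracting the bound would not change the leading term, and \<open>P\<close> or
  its difference to the bound would eventually have the wrong sign.\<close>

lemma degree_le_of_growth:
  fixes P :: "rat poly"
  assumes bound: "eventually (\<lambda>x::int. 0 \<le> poly P (of_int x) \<and>
      poly P (of_int x) \<le> C * (of_int x + c) ^ d) at_top"
  shows "degree P \<le> d"
proof (rule ccontr)
  assume "\<not> degree P \<le> d"
  then have deg: "degree P > d" by simp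
  define R where "R = smult C ([:c, 1:] ^ d)"
  have R: "poly R x = C * (x + c) ^ d" for x
    by (simp add: R_def add.commute)
  have "degree R \<le> d"
    unfolding R_def by (intro order.trans[OF degree_smult_le]) (simp add: degree_power_eq)
  then have degR: "degree R < degree P" using deg by simp
  obtain x0 where x0: "\<And>x::int. x \<ge> x0 \<Longrightarrow> 0 \<le> poly P (of_int x) \<and> poly P (of_int x) \<le> poly R (of_int x)"
    using bound unfolding eventually_at_top_linorder R by blast
  have contra: False if Q: "lead_coeff Q > 0" "\<And>x::int. x \<ge> x0 \<Longrightarrow> poly Q (of_int x) \<le> 0" for Q :: "rat poly"
  proof -
    obtain n where n: "\<And>x. x \<ge> n \<Longrightarrow> poly Q x \<ge> lead_coeff Q"
      using eventually_poly_ge_lead_coeff[OF Q(1)] by blast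
    define x where "x = max x0 \<lceil>n\<rceil>"
    have "of_int x \<ge> n" unfolding x_def by (simp add: ceiling_le_iff[symmetric])
    then show False
      using n[of "of_int x"] Q(2)[of x] Q(1) by (auto simp: x_def)
  qed
  have "lead_coeff P \<noteq> 0" using deg by auto
  then consider "lead_coeff P > 0" | "lead_coeff P < 0" by linarith
  then show False
  proof cases
    case 1
    have "lead_coeff (P - R) = lead_coeff P"
      using degR by (metis diff_conv_add_uminus degree_minus lead_coeff_add_le add.commute)
    then show False
      using contra[of "P - R"] 1 x0 by simp
  next
    case 2
    then show False
      using contra[of "- P"] x0 by simp
  qed
qed

section \<open>Summation of eventually polynomial functions\<close>

text \<open>The shape of the Hilbert function of a finitely generated graded module; it is preserved by
  the cumulative sums \<open>csum\<close>, which turn \<open>H\<^sub>i\<close> into \<open>H\<^bsub>i+1\<^esub>\<close>.\<close>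

definition ev_poly :: "(int \<Rightarrow> rat) \<Rightarrow> bool" where
  "ev_poly f \<longleftrightarrow> (\<exists>lo. \<forall>x<lo. f x = 0) \<and> (\<exists>P. eventually (\<lambda>x. f x = poly P (of_int x)) at_top)"

definition csum :: "(int \<Rightarrow> 'a::comm_monoid_add) \<Rightarrow> int \<Rightarrow> 'a" where
  "csum f = (\<lambda>x. \<Sum>y | y \<le> x \<and> f y \<noteq> 0. f y)"

lemma csum_eq_interval:
  assumes "\<And>x. x < lo \<Longrightarrow> f x = 0"
  shows "csum f x = (\<Sum>y\<in>{lo..x}. f y)"
  unfolding csum_def
  using assms by (intro sum.mono_neutral_left) (auto simp: not_less[symmetric])

lemma csum_eq_0: "(\<And>y. y < lo \<Longrightarrow> f y = 0) \<Longrightarrow> x < lo \<Longrightarrow> csum f x = 0"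
  by (simp add: csum_eq_interval[of lo])

lemma csum_step:
  fixes f :: "int \<Rightarrow> 'a::ab_group_add"
  assumes lo: "\<And>y. y < lo \<Longrightarrow> f y = 0"
  shows "csum f x - csum f (x - 1) = f x"
proof (cases "x < lo")
  case False
  then have "{lo..x} = insert x {lo..x - 1}" by auto
  then show ?thesis
    by (simp add: csum_eq_interval[of lo f, OF lo])
qed (use lo in \<open>simp add: csum_eq_interval[of lo f, OF lo]\<close>)

lemma ev_poly_csum:
  assumes "ev_poly f"
  shows "ev_poly (csum f)"
proof -
  obtain lo P where lo: "\<And>x. x < lo \<Longrightarrow> f x = 0"
    and P: "eventually (\<lambda>x. f x = poly P (of_int x)) at_top"
    using assms unfolding ev_poly_def by blast
  (* raising every index in the expansion of P yields an antidifference of P *)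
  define Q where "Q = (\<Sum>s<Suc (degree P). smult (poly ((nabla ^^ s) P) (-1)) (binp (Suc s)))"
  have Q: "nabla Q = P"
    unfolding Q_def
    using newton_expansion[OF nabla_pow_eq_0[OF lessI[of "degree P"]], symmetric]
    by (simp add: nabla_sum nabla_linear nabla_binp_Suc del: sum.lessThan_Suc)
  obtain x0 where x0: "\<And>x. x \<ge> x0 \<Longrightarrow> f x = poly P (of_int x)"
    using P unfolding eventually_at_top_linorder by blast
  have "csum f x = poly (Q + [:csum f x0 - poly Q (of_int x0):]) (of_int x)" if "x \<ge> x0" for x
    using that
  proof (induct x rule: int_ge_induct)
    case (step i)
    have "csum f (i + 1) = csum f i + f (i + 1)"
      using csum_step[of lo f "i + 1", OF lo] by (simp add: algebra_simps)
    also have "f (i + 1) = poly (nabla Q) (of_int (i + 1))"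
      using x0[of "i + 1"] step Q by simp
    finally show ?case using step by simp
  qed simp
  then have "eventually (\<lambda>x. csum f x = poly (Q + [:csum f x0 - poly Q (of_int x0):]) (of_int x)) at_top"
    unfolding eventually_at_top_linorder by blast
  then show ?thesis
    unfolding ev_poly_def using csum_eq_0[of lo f, OF lo] by blast
qed

lemma ev_poly_delta: "ev_poly (\<lambda>x. if x = a then c else 0)"
proof -
  have "eventually (\<lambda>x. (if x = a then c else 0) = poly 0 (rat_of_int x)) at_top"
    using eventually_gt_at_top[of a] by eventually_elim auto
  then show ?thesis
    unfolding ev_poly_def by (intro conjI exI[of _ a] exI[of _ 0]) auto
qed

lemma ev_poly_shift:
  assumes "ev_poly f"
  shows "ev_poly (\<lambda>x. f (x - a))"
proof -
  obtain lo P where lo: "\<And>x. x < lo \<Longrightarrow> f x = 0"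
    and P: "eventually (\<lambda>x. f x = poly P (of_int x)) at_top"
    using assms unfolding ev_poly_def by blast
  obtain x0 where x0: "\<And>x. x \<ge> x0 \<Longrightarrow> f x = poly P (of_int x)"
    using P unfolding eventually_at_top_linorder by blast
  have "\<forall>x\<ge>x0 + a. f (x - a) = poly (pcompose P [:- of_int a, 1:]) (of_int x)"
    using x0 by (simp add: poly_pcompose)
  then have "eventually (\<lambda>x. f (x - a) = poly (pcompose P [:- of_int a, 1:]) (of_int x)) at_top"
    unfolding eventually_at_top_linorder by blast
  moreover have "\<forall>x<lo + a. f (x - a) = 0" using lo by simp
  ultimately show ?thesis unfolding ev_poly_def by blast
qed

lemma ev_poly_add:
  assumes "ev_poly f" "ev_poly g"
  shows "ev_poly (\<lambda>x. f x + g x)"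
proof -
  obtain lo P lo' P' where lo: "\<forall>x<lo. f x = 0" "\<forall>x<lo'. g x = 0"
    and P: "eventually (\<lambda>x. f x = poly P (of_int x)) at_top"
      "eventually (\<lambda>x. g x = poly P' (of_int x)) at_top"
    using assms unfolding ev_poly_def by blast
  have "eventually (\<lambda>x. f x + g x = poly (P + P') (of_int x)) at_top"
    using P by eventually_elim simp
  moreover have "\<forall>x<min lo lo'. f x + g x = 0" using lo by simp
  ultimately show ?thesis unfolding ev_poly_def by blast
qed

lemma ev_poly_cmult:
  assumes "ev_poly f"
  shows "ev_poly (\<lambda>x. c * f x)"
proof -
  obtain lo P where lo: "\<forall>x<lo. f x = 0"
    and P: "eventually (\<lambda>x. f x = poly P (of_int x)) at_top"
    using assms unfolding ev_poly_def by blast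
  have "eventually (\<lambda>x. c * f x = poly (smult c P) (of_int x)) at_top"
    using P by eventually_elim simp
  then show ?thesis unfolding ev_poly_def using lo by (metis mult_zero_right)
qed

lemma ev_poly_csum_pow: "ev_poly f \<Longrightarrow> ev_poly ((csum ^^ i) f)"
  by (induct i) (auto intro: ev_poly_csum)

lemma csum_nonneg: "(\<And>x. f x \<ge> 0) \<Longrightarrow> csum f x \<ge> (0 :: rat)"
  unfolding csum_def by (rule sum_nonneg) simp

lemma nabla_of_csum:
  assumes lo: "\<And>x. x < lo \<Longrightarrow> f x = 0"
    and Q: "eventually (\<lambda>x. csum f x = poly Q (of_int x)) at_top"
    and P: "eventually (\<lambda>x. f x = poly P (of_int x)) at_top"
  shows "nabla Q = P"
proof (rule poly_eq_of_eventually)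
  obtain x0 where x0: "\<And>x. x \<ge> x0 \<Longrightarrow> csum f x = poly Q (of_int x)"
    using Q unfolding eventually_at_top_linorder by blast
  obtain x1 where x1: "\<And>x. x \<ge> x1 \<Longrightarrow> f x = poly P (of_int x)"
    using P unfolding eventually_at_top_linorder by blast
  have "poly (nabla Q) (of_int x) = poly P (of_int x)" if "x \<ge> max (x0 + 1) x1" for x
    using x0[of x] x0[of "x - 1"] x1[of x] csum_step[of lo f x, OF lo] that by simp
  then show "eventually (\<lambda>x. poly (nabla Q) (of_int x) = poly P (of_int x)) at_top"
    unfolding eventually_at_top_linorder by blast
qed

text \<open>The sums are eventually a polynomial of degree at most \<open>d\<close>, whose difference is \<open>P\<close>. The
  conclusion \<open>\<nabla>\<^sup>d P = 0\<close> means that \<open>P\<close> has degree less than \<open>d\<close>, and \<open>P = 0\<close> if \<open>d = 0\<close>.\<close>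

lemma nabla_zero_of_bounded_csum:
  assumes lo: "\<And>x. x < lo \<Longrightarrow> f x = 0" and nonneg: "\<And>x. f x \<ge> 0"
    and P: "eventually (\<lambda>x. f x = poly P (of_int x)) at_top"
    and bound: "eventually (\<lambda>x. csum f x \<le> C * (of_int x + c) ^ d) at_top"
  shows "(nabla ^^ d) P = 0"
proof -
  have "ev_poly f" unfolding ev_poly_def using lo P by blast
  from ev_poly_csum[OF this] obtain Q where
    Q: "eventually (\<lambda>x. csum f x = poly Q (of_int x)) at_top"
    unfolding ev_poly_def by blast
  have "eventually (\<lambda>x::int. 0 \<le> poly Q (of_int x) \<and> poly Q (of_int x) \<le> C * (of_int x + c) ^ d) at_top"
    using Q bound
  proof eventually_elim
    case (elim x)
    then show ?case using csum_nonneg[of f x, OF nonneg] by simp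
  qed
  then have "degree Q \<le> d" by (rule degree_le_of_growth)
  then have "(nabla ^^ Suc d) Q = 0" by (intro nabla_pow_eq_0) simp
  then show ?thesis using nabla_of_csum[of lo f Q P, OF lo Q P] by (simp add: funpow_swap1)
qed

lemma ev_poly_common_bound:
  assumes "\<And>r. ev_poly (f r)"
  shows "\<exists>lo. \<forall>r<(l::nat). \<forall>x<lo. f r x = 0"
proof (induct l)
  case (Suc l)
  then obtain lo where lo: "\<forall>r<l. \<forall>x<lo. f r x = 0" by blast
  obtain lo' where lo': "\<forall>x<lo'. f l x = 0" using assms[of l] unfolding ev_poly_def by blast
  have "\<forall>r<Suc l. \<forall>x<min lo lo'. f r x = 0" using lo lo' by (simp add: less_Suc_eq)
  then show ?case by blast
qed simp

lemma csum_combination: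
  assumes "\<And>r. ev_poly (f r)"
  shows "csum (\<lambda>x. \<Sum>r<(l::nat). c r * f r (x - a)) = (\<lambda>x. \<Sum>r<l. c r * csum (f r) (x - a))"
proof
  fix x
  obtain lo where lo: "\<forall>r<l. \<forall>x<lo. f r x = 0" using ev_poly_common_bound[of f l, OF assms] by blast
  have "csum (\<lambda>x. \<Sum>r<l. c r * f r (x - a)) x = (\<Sum>y\<in>{lo + a..x}. \<Sum>r<l. c r * f r (y - a))"
    by (rule csum_eq_interval) (use lo in \<open>simp\<close>)
  also have "\<dots> = (\<Sum>r<l. c r * (\<Sum>y\<in>{lo + a..x}. f r (y - a)))"
    unfolding sum_distrib_left by (rule sum.swap)
  also have "\<dots> = (\<Sum>r<l. c r * csum (f r) (x - a))"
  proof (intro sum.cong refl arg_cong2[where f = "(*)"])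
    fix r assume "r \<in> {..<l}"
    then have "csum (f r) (x - a) = (\<Sum>y\<in>{lo..x - a}. f r y)"
      by (intro csum_eq_interval) (use lo in simp)
    also have "\<dots> = (\<Sum>y\<in>{lo + a..x}. f r (y - a))"
      by (rule sum.reindex_bij_witness[of _ "\<lambda>y. y - a" "\<lambda>y. y + a"]) auto
    finally show "(\<Sum>y\<in>{lo + a..x}. f r (y - a)) = csum (f r) (x - a)" by simp
  qed
  finally show "csum (\<lambda>x. \<Sum>r<l. c r * f r (x - a)) x = (\<Sum>r<l. c r * csum (f r) (x - a))" .
qed

lemma csum_pow_combination:
  assumes "\<And>r. ev_poly (f r)"
  shows "(csum ^^ i) (\<lambda>x. \<Sum>r<(l::nat). c r * f r (x - a)) = (\<lambda>x. \<Sum>r<l. c r * (csum ^^ i) (f r) (x - a))"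
proof (induct i)
  case (Suc i)
  have "(csum ^^ Suc i) (\<lambda>x. \<Sum>r<l. c r * f r (x - a)) =
      csum (\<lambda>x. \<Sum>r<l. c r * (csum ^^ i) (f r) (x - a))"
    using Suc by simp
  also have "\<dots> = (\<lambda>x. \<Sum>r<l. c r * csum ((csum ^^ i) (f r)) (x - a))"
    by (rule csum_combination) (rule ev_poly_csum_pow[OF assms])
  finally show ?case by simp
qed simp

section \<open>Functions of two integers that separate into Hilbert-like factors\<close>

text \<open>The algebraic tensor product of two copies of the space of functions \<open>ev_poly\<close>. It contains
  the Hilbert function of every finitely generated bigraded module.\<close>

inductive bisep :: "(int \<Rightarrow> int \<Rightarrow> rat) \<Rightarrow> bool" where
  bisep_prod: "ev_poly \<phi> \<Longrightarrow> ev_poly \<psi> \<Longrightarrow> bisep (\<lambda>u k. \<phi> u * \<psi> k)"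
| bisep_add: "bisep f \<Longrightarrow> bisep g \<Longrightarrow> bisep (\<lambda>u k. f u k + g u k)"

lemma bisep_0: "bisep (\<lambda>u k. 0)"
proof -
  have "ev_poly (\<lambda>x. 0)" using ev_poly_delta[of 0 0] by simp
  from bisep_prod[OF this this] show ?thesis by simp
qed

lemma bisep_sum: "(\<And>a. a \<in> A \<Longrightarrow> bisep (f a)) \<Longrightarrow> bisep (\<lambda>u k. \<Sum>a\<in>A. f a u k)"
  by (induct A rule: infinite_finite_induct) (auto intro: bisep_0 bisep_add)

lemma bisep_swap: "bisep f \<Longrightarrow> bisep (\<lambda>u k. f k u)"
proof (induct rule: bisep.induct)
  case (bisep_prod \<phi> \<psi>)
  then show ?case using bisep.bisep_prod[of \<psi> \<phi>] by (simp add: mult.commute)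
qed (rule bisep.bisep_add)

lemma bisep_shift_left: "bisep f \<Longrightarrow> bisep (\<lambda>u k. f (u - a) k)"
proof (induct rule: bisep.induct)
  case (bisep_prod \<phi> \<psi>)
  then show ?case using bisep.bisep_prod[OF ev_poly_shift[of \<phi>], of \<psi>] by simp
qed (rule bisep.bisep_add)

lemma bisep_shift: "bisep f \<Longrightarrow> bisep (\<lambda>u k. f (u - a) (k - b))"
  by (drule bisep_shift_left[of _ a], drule bisep_swap, drule bisep_shift_left[of _ b], drule bisep_swap)

lemma bisep_lower_bound: "bisep f \<Longrightarrow> \<exists>lo. \<forall>u<lo. \<forall>k. f u k = 0"
proof (induct rule: bisep.induct)
  case (bisep_prod \<phi> \<psi>)
  then obtain lo where "\<forall>u<lo. \<phi> u = 0" unfolding ev_poly_def by blast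
  then show ?case by (intro exI[of _ lo]) simp
next
  case (bisep_add f g)
  obtain lo lo' where "\<forall>u<lo. \<forall>k. f u k = 0" "\<forall>u<lo'. \<forall>k. g u k = 0"
    using bisep_add(2,4) by blast
  then show ?case by (intro exI[of _ "min lo lo'"]) simp
qed

lemma bisep_csum: "bisep f \<Longrightarrow> bisep (\<lambda>u k. csum (\<lambda>x. f x k) u)"
proof (induct rule: bisep.induct)
  case (bisep_prod \<phi> \<psi>)
  then obtain lo where lo: "\<forall>u<lo. \<phi> u = 0" unfolding ev_poly_def by blast
  have "csum (\<lambda>x. \<phi> x * \<psi> k) u = csum \<phi> u * \<psi> k" for u k
  proof -
    have "csum (\<lambda>x. \<phi> x * \<psi> k) u = (\<Sum>y\<in>{lo..u}. \<phi> y * \<psi> k)"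
      by (rule csum_eq_interval) (use lo in simp)
    moreover have "csum \<phi> u = (\<Sum>y\<in>{lo..u}. \<phi> y)"
      by (rule csum_eq_interval) (use lo in simp)
    ultimately show ?thesis by (simp only: sum_distrib_right)
  qed
  then have "(\<lambda>u k. csum (\<lambda>x. \<phi> x * \<psi> k) u) = (\<lambda>u k. csum \<phi> u * \<psi> k)" by (intro ext)
  moreover have "bisep (\<lambda>u k. csum \<phi> u * \<psi> k)"
    by (rule bisep.bisep_prod[OF ev_poly_csum[OF bisep_prod(1)] bisep_prod(2)])
  ultimately show ?case by simp
next
  case (bisep_add f g)
  obtain lo lo' where lo: "\<forall>u<lo. \<forall>k. f u k = 0" "\<forall>u<lo'. \<forall>k. g u k = 0"
    using bisep_lower_bound[OF bisep_add(1)] bisep_lower_bound[OF bisep_add(3)] by blast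
  have "csum (\<lambda>x. f x k + g x k) u = csum (\<lambda>x. f x k) u + csum (\<lambda>x. g x k) u" for u k
  proof -
    let ?I = "{min lo lo'..u}"
    have "csum (\<lambda>x. f x k + g x k) u = (\<Sum>y\<in>?I. f y k + g y k)"
      by (rule csum_eq_interval) (use lo in simp)
    moreover have "csum (\<lambda>x. f x k) u = (\<Sum>y\<in>?I. f y k)"
      by (rule csum_eq_interval) (use lo in simp)
    moreover have "csum (\<lambda>x. g x k) u = (\<Sum>y\<in>?I. g y k)"
      by (rule csum_eq_interval) (use lo in simp)
    ultimately show ?thesis by (simp only: sum.distrib)
  qed
  then have "(\<lambda>u k. csum (\<lambda>x. f x k + g x k) u) = (\<lambda>u k. csum (\<lambda>x. f x k) u + csum (\<lambda>x. g x k) u)"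
    by (intro ext)
  moreover have "bisep (\<lambda>u k. csum (\<lambda>x. f x k) u + csum (\<lambda>x. g x k) u)"
    by (rule bisep.bisep_add[OF bisep_add(2,4)])
  ultimately show ?case by simp
qed

lemma bisep_polynomial_in_second:
  assumes "bisep f"
  shows "\<exists>k1 m \<Phi>. (\<forall>r. ev_poly (\<Phi> r)) \<and> (\<forall>k\<ge>k1. \<forall>u. f u k = (\<Sum>r<(m::nat). \<Phi> r u * of_int k ^ r))"
  using assms
proof (induct rule: bisep.induct)
  case (bisep_prod \<phi> \<psi>)
  then obtain \<Psi> k1 where \<Psi>: "\<forall>k\<ge>k1. \<psi> k = poly \<Psi> (of_int k)"
    unfolding ev_poly_def eventually_at_top_linorder by blast
  have "\<phi> u * \<psi> k = (\<Sum>r<Suc (degree \<Psi>). (coeff \<Psi> r * \<phi> u) * of_int k ^ r)" if "k \<ge> k1" for u k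
    using \<Psi> that by (simp add: poly_altdef lessThan_Suc_atMost sum_distrib_left mult_ac)
  moreover have "\<forall>r. ev_poly (\<lambda>u. coeff \<Psi> r * \<phi> u)"
    using bisep_prod ev_poly_cmult by blast
  ultimately show ?case
    by (intro exI[of _ k1] exI[of _ "Suc (degree \<Psi>)"] exI[of _ "\<lambda>r u. coeff \<Psi> r * \<phi> u"]) blast
next
  case (bisep_add f g)
  obtain k1 m \<Phi> where
    f: "\<forall>r. ev_poly (\<Phi> r)" "\<forall>k\<ge>k1. \<forall>u. f u k = (\<Sum>r<(m::nat). \<Phi> r u * of_int k ^ r)"
    using bisep_add(2) by (elim exE conjE)
  obtain k1' m' \<Phi>' where
    g: "\<forall>r. ev_poly (\<Phi>' r)" "\<forall>k\<ge>k1'. \<forall>u. g u k = (\<Sum>r<(m'::nat). \<Phi>' r u * of_int k ^ r)"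
    using bisep_add(4) by (elim exE conjE)
  have ext: "(\<Sum>r<n. h r) = (\<Sum>r<max m m'. if r < n then h r else 0)"
    if "n = m \<or> n = m'" for n and h :: "nat \<Rightarrow> rat"
    using that by (intro sum.mono_neutral_cong_left) auto
  define \<Theta> where "\<Theta> r u = (if r < m then \<Phi> r u else 0) + (if r < m' then \<Phi>' r u else 0)" for r u
  have "f u k + g u k = (\<Sum>r<max m m'. \<Theta> r u * of_int k ^ r)" if "k \<ge> max k1 k1'" for u k
  proof -
    have "f u k = (\<Sum>r<max m m'. if r < m then \<Phi> r u * of_int k ^ r else 0)"
      using f(2) that ext[of m "\<lambda>r. \<Phi> r u * of_int k ^ r"] by simp
    moreover have "g u k = (\<Sum>r<max m m'. if r < m' then \<Phi>' r u * of_int k ^ r else 0)"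
      using g(2) that ext[of m' "\<lambda>r. \<Phi>' r u * of_int k ^ r"] by simp
    ultimately show ?thesis
      unfolding \<Theta>_def by (simp only: sum.distrib[symmetric]) (rule sum.cong, simp_all add: algebra_simps)
  qed
  moreover have "ev_poly (\<Theta> r)" for r
  proof -
    have "ev_poly (\<lambda>u. (if r < m then 1 else 0) * \<Phi> r u + (if r < m' then 1 else 0) * \<Phi>' r u)"
      using f(1) g(1) by (intro ev_poly_add ev_poly_cmult) auto
    moreover have "\<Theta> r = (\<lambda>u. (if r < m then 1 else 0) * \<Phi> r u + (if r < m' then 1 else 0) * \<Phi>' r u)"
      by (auto simp: \<Theta>_def)
    ultimately show ?thesis by simp
  qed
  ultimately show ?case
    by (intro exI[of _ "max k1 k1'"] exI[of _ "max m m'"] exI[of _ \<Theta>]) simp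
qed

section \<open>Counting the elements of order ideals of monomials\<close>

abbreviation expo :: "('v \<Rightarrow>\<^sub>0 nat) \<Rightarrow> 'v \<Rightarrow> nat" where
  "expo \<equiv> Poly_Mapping.lookup"

abbreviation supp :: "('v \<Rightarrow>\<^sub>0 'c::zero) \<Rightarrow> 'v set" where
  "supp \<equiv> Poly_Mapping.keys"

definition tdeg :: "('v::finite \<Rightarrow>\<^sub>0 nat) \<Rightarrow> nat" where
  "tdeg a = (\<Sum>v\<in>UNIV. expo a v)"

definition qdeg :: "('v::finite \<Rightarrow> bool) \<Rightarrow> ('v \<Rightarrow>\<^sub>0 nat) \<Rightarrow> nat" where
  "qdeg q a = (\<Sum>v | q v. expo a v)"

definition order_ideal :: "('v \<Rightarrow>\<^sub>0 nat) set \<Rightarrow> bool" where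
  "order_ideal D \<longleftrightarrow> (\<forall>a\<in>D. \<forall>b. (\<forall>v. expo b v \<le> expo a v) \<longrightarrow> b \<in> D)"

lemma order_idealD: "order_ideal D \<Longrightarrow> a \<in> D \<Longrightarrow> (\<And>v. expo b v \<le> expo a v) \<Longrightarrow> b \<in> D"
  unfolding order_ideal_def by blast

lemma tdeg_add [simp]: "tdeg (a + b) = tdeg a + tdeg b"
  by (simp add: tdeg_def lookup_add sum.distrib)

lemma tdeg_0 [simp]: "tdeg 0 = 0"
  by (simp add: tdeg_def)

lemma tdeg_single [simp]: "tdeg (Poly_Mapping.single v n) = n"
  by (simp add: tdeg_def lookup_single when_def)

lemma qdeg_add [simp]: "qdeg q (a + b) = qdeg q a + qdeg q b"
  by (simp add: qdeg_def lookup_add sum.distrib)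

lemma qdeg_single [simp]: "qdeg q (Poly_Mapping.single v n) = (if q v then n else 0)"
  by (simp add: qdeg_def lookup_single when_def)

lemma tdeg_split: "tdeg a = qdeg q a + qdeg (\<lambda>v. \<not> q v) a"
  unfolding tdeg_def qdeg_def
  by (subst sum.union_disjoint[symmetric]) (auto intro: arg_cong[where f = "sum _"])

lemma expo_le_tdeg: "expo a v \<le> tdeg a"
  unfolding tdeg_def by (rule member_le_sum) auto

lemma inj_lookup: "inj Poly_Mapping.lookup"
  by (simp add: inj_def poly_mapping.lookup_inject)

lemma finite_tdeg_le: "finite {a :: 'v::finite \<Rightarrow>\<^sub>0 nat. tdeg a \<le> t}"
proof (rule finite_imageD[of Poly_Mapping.lookup])
  show "finite (Poly_Mapping.lookup ` {a :: 'v \<Rightarrow>\<^sub>0 nat. tdeg a \<le> t})"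
  proof (rule finite_subset)
    show "Poly_Mapping.lookup ` {a :: 'v \<Rightarrow>\<^sub>0 nat. tdeg a \<le> t} \<subseteq> (\<Pi>\<^sub>E v\<in>UNIV. {..t})"
    proof (rule image_subsetI)
      fix a :: "'v \<Rightarrow>\<^sub>0 nat" assume "a \<in> {a. tdeg a \<le> t}"
      then have "expo a v \<le> t" for v using expo_le_tdeg[of a v] by simp
      then show "expo a \<in> (\<Pi>\<^sub>E v\<in>UNIV. {..t})" by (simp add: PiE_def Pi_def extensional_def)
    qed
  qed (simp add: finite_PiE)
qed (rule inj_on_subset[OF inj_lookup], simp)

lemma mono_subsequence_nat:
  fixes s :: "nat \<Rightarrow> nat"
  obtains r :: "nat \<Rightarrow> nat" where "strict_mono r" "mono (\<lambda>n. s (r n))"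
proof -
  obtain r where r: "strict_mono r" "monoseq (\<lambda>n. s (r n))"
    using seq_monosub by blast
  show ?thesis
  proof (cases "incseq (\<lambda>n. s (r n))")
    case False
    then have dec: "decseq (\<lambda>n. s (r n))" using r(2) monoseq_iff by blast
    define m where "m = (LEAST x. x \<in> range (\<lambda>n. s (r n)))"
    have "m \<in> range (\<lambda>n. s (r n))" unfolding m_def by (rule LeastI_ex) auto
    then obtain N where N: "s (r N) = m" by auto
    have "s (r (n + N)) = m" for n
    proof (rule antisym)
      show "s (r (n + N)) \<le> m" using decseqD[OF dec, of N "n + N"] N by simp
      show "m \<le> s (r (n + N))" unfolding m_def by (rule Least_le) auto
    qed
    then show ?thesis
      using that[of "\<lambda>n. r (n + N)"] r(1) by (simp add: strict_mono_def mono_def)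
  qed (use that[of r] r in \<open>simp\<close>)
qed

text \<open>Dickson's lemma: pass to a subsequence on which one exponent after the other is monotone.\<close>

lemma dickson:
  fixes f :: "nat \<Rightarrow> ('v::finite \<Rightarrow>\<^sub>0 nat)"
  shows "\<exists>i j. i < j \<and> (\<forall>v. expo (f i) v \<le> expo (f j) v)"
proof -
  have "\<exists>r::nat \<Rightarrow> nat. strict_mono r \<and> (\<forall>v\<in>S. mono (\<lambda>n. expo (f (r n)) v))" if "finite S" for S :: "'v set"
    using that
  proof induct
    case empty
    show ?case by (intro exI[of _ "\<lambda>n. n"]) (simp add: strict_mono_def)
  next
    case (insert w S)
    then obtain r :: "nat \<Rightarrow> nat" where r: "strict_mono r" "\<forall>v\<in>S. mono (\<lambda>n::nat. expo (f (r n)) v)" by blast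
    obtain t :: "nat \<Rightarrow> nat" where t: "strict_mono t" "mono (\<lambda>n. expo (f (r (t n))) w)"
      using mono_subsequence_nat[of "\<lambda>n. expo (f (r n)) w"] by blast
    have "strict_mono (\<lambda>n. r (t n))" using r(1) t(1) by (simp add: strict_mono_def)
    moreover have "\<forall>v\<in>S. mono (\<lambda>n. expo (f (r (t n))) v)"
      using r(2) strict_mono_mono[OF t(1)] by (simp add: mono_def)
    ultimately show ?case using t(2) by (intro exI[of _ "\<lambda>n. r (t n)"]) auto
  qed
  from this[of UNIV] obtain r :: "nat \<Rightarrow> nat" where r: "strict_mono r" "\<forall>v. mono (\<lambda>n. expo (f (r n)) v)" by auto
  have "r 0 < r 1" using r(1) by (simp add: strict_mono_def)
  moreover have "\<forall>v. expo (f (r 0)) v \<le> expo (f (r 1)) v" using r(2) by (simp add: mono_def)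
  ultimately show ?thesis by blast
qed

lemma order_ideals_stabilize:
  fixes D :: "nat \<Rightarrow> ('v::finite \<Rightarrow>\<^sub>0 nat) set"
  assumes dec: "\<And>i j. i \<le> j \<Longrightarrow> D j \<subseteq> D i" and ideal: "\<And>j. order_ideal (D j)"
  shows "\<exists>J. \<forall>j\<ge>J. D j = D J"
proof (rule ccontr)
  assume "\<not> (\<exists>J. \<forall>j\<ge>J. D j = D J)"
  then have "\<forall>J. \<exists>p. fst p \<ge> J \<and> snd p \<in> D J - D (fst p)" using dec by fastforce
  from choice[OF this] obtain g where g: "\<forall>J. fst (g J) \<ge> J \<and> snd (g J) \<in> D J - D (fst (g J))"
    by blast
  define nx pt where "nx J = fst (g J)" and "pt J = snd (g J)" for J
  have nx: "nx J \<ge> J" "pt J \<in> D J - D (nx J)" for J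
    using g by (auto simp: nx_def pt_def)
  define s where "s n = (nx ^^ n) 0" for n
  have s: "s (Suc n) = nx (s n)" for n by (simp add: s_def)
  have mono: "i \<le> j \<Longrightarrow> s i \<le> s j" for i j
    using lift_Suc_mono_le[of s i j] nx(1) by (simp add: s)
  obtain i j where ij: "i < j" "\<forall>v. expo (pt (s i)) v \<le> expo (pt (s j)) v"
    using dickson[of "\<lambda>n. pt (s n)"] by blast
  have "pt (s j) \<in> D (s j)" using nx(2) by simp
  then have "pt (s i) \<in> D (s j)" using ij(2) ideal[of "s j"] unfolding order_ideal_def by blast
  moreover have "D (s j) \<subseteq> D (nx (s i))" using dec[OF mono[of "Suc i" j]] ij(1) by (simp add: s)
  ultimately show False using nx(2)[of "s i"] by auto
qed

definition mcount :: "('v::finite \<Rightarrow> bool) \<Rightarrow> ('v \<Rightarrow>\<^sub>0 nat) set \<Rightarrow> int \<Rightarrow> int \<Rightarrow> nat" where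
  "mcount q D u k = card {a \<in> D. int (qdeg q a) = u \<and> int (qdeg (\<lambda>v. \<not> q v) a) = k}"

lemma mcount_swap: "mcount (\<lambda>v. \<not> q v) D k u = mcount q D u k"
  by (simp add: mcount_def conj_commute)

lemma finite_mcount: "finite {a \<in> D. int (qdeg q a) = u \<and> int (qdeg (\<lambda>v. \<not> q v) a) = k}"
  by (rule finite_subset[OF _ finite_tdeg_le[of "nat (u + k)"]]) (auto simp: tdeg_split[of _ q])

lemma mcount_neg: "u < 0 \<Longrightarrow> mcount q D u k = 0"
  by (auto simp: mcount_def)

text \<open>Sort the elements of an order ideal by the exponent \<open>j\<close> of one variable. The slices form a
  descending chain of order ideals in the remaining variables, hence are constant from some \<open>J\<close> on,
  so that the count is a finite sum of shifted counts plus one cumulative sum.\<close>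

lemma bisep_mcount_step:
  fixes D :: "('v::finite \<Rightarrow>\<^sub>0 nat) set"
  assumes "q v" and "v \<notin> F" and D: "\<And>a. a \<in> D \<Longrightarrow> supp a \<subseteq> insert v F" "order_ideal D"
    and IH: "\<And>E. (\<And>a. a \<in> E \<Longrightarrow> supp a \<subseteq> F) \<Longrightarrow> order_ideal E \<Longrightarrow> bisep (\<lambda>u k. of_nat (mcount q E u k))"
  shows "bisep (\<lambda>u k. of_nat (mcount q D u k))"
proof -
  let ?x = "\<lambda>j::nat. Poly_Mapping.single v j"
  define E where "E j = {a. supp a \<subseteq> F \<and> a + ?x j \<in> D}" for j
  have E_ideal: "order_ideal (E j)" for j
    unfolding order_ideal_def
  proof (intro ballI allI impI)
    fix a b assume a: "a \<in> E j" and b: "\<forall>w. expo b w \<le> expo a w"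
    have "b + ?x j \<in> D"
      by (rule order_idealD[OF D(2), where a = "a + ?x j"]) (use a b in \<open>auto simp: E_def lookup_add\<close>)
    moreover have "supp b \<subseteq> supp a"
    proof
      fix w assume "w \<in> supp b"
      then show "w \<in> supp a" using spec[OF b, of w] by (simp add: in_keys_iff)
    qed
    ultimately show "b \<in> E j" using a by (auto simp: E_def)
  qed
  have E_dec: "E j \<subseteq> E i" if "i \<le> j" for i j
  proof
    fix a assume a: "a \<in> E j"
    have "a + ?x i \<in> D"
    proof (rule order_idealD[OF D(2)])
      show "a + ?x j \<in> D" using a by (simp add: E_def)
      show "expo (a + ?x i) w \<le> expo (a + ?x j) w" for w
        using that by (simp add: lookup_add lookup_single when_def)
    qed
    then show "a \<in> E i" using a by (simp add: E_def)
  qed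
  have "\<exists>J. \<forall>j\<ge>J. E j = E J"
    by (rule order_ideals_stabilize) (fact E_dec, fact E_ideal)
  then obtain J where J: "\<forall>j\<ge>J. E j = E J" by blast
  define c where "c j u k = (of_nat (mcount q (E j) u k) :: rat)" for j u k
  have c_bisep: "bisep (c j)" for j
  proof -
    have "bisep (\<lambda>u k. of_nat (mcount q (E j) u k))"
      by (rule IH[OF _ E_ideal]) (simp add: E_def)
    moreover have "c j = (\<lambda>u k. of_nat (mcount q (E j) u k))"
      by (intro ext) (simp add: c_def)
    ultimately show ?thesis by simp
  qed
  define lvl where "lvl A u k = {a \<in> A. int (qdeg q a) = u \<and> int (qdeg (\<lambda>v. \<not> q v) a) = k}" for A u k
  have slices: "of_nat (mcount q D u k) = (\<Sum>j<N. c j (u - int j) k)" if N: "int N > u" for u k N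
  proof -
    have "lvl D u k = (\<Union>j<N. (\<lambda>a. a + ?x j) ` lvl (E j) (u - int j) k)"
    proof (intro equalityI subsetI)
      fix a assume a: "a \<in> lvl D u k"
      define j where "j = expo a v"
      define b where "b = a - ?x j"
      have ab: "a = b + ?x j"
        by (rule poly_mapping_eqI) (simp add: b_def j_def lookup_add lookup_minus lookup_single when_def)
      have "expo b v = 0" by (simp add: b_def j_def lookup_minus)
      moreover have "supp b \<subseteq> supp a" using ab by (auto simp: in_keys_iff lookup_add)
      ultimately have "supp b \<subseteq> F" using D(1)[of a] a by (auto simp: lvl_def in_keys_iff)
      then have "b \<in> E j" using a ab by (simp add: E_def lvl_def)
      moreover have "int (qdeg q b) + int j = u" "int (qdeg (\<lambda>v. \<not> q v) b) = k"
        using a ab \<open>q v\<close> by (auto simp: lvl_def)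
      ultimately have "b \<in> lvl (E j) (u - int j) k" and "j < N"
        using N by (auto simp: lvl_def)
      then show "a \<in> (\<Union>j<N. (\<lambda>a. a + ?x j) ` lvl (E j) (u - int j) k)"
        using ab by blast
    qed (use \<open>q v\<close> in \<open>auto simp: lvl_def E_def\<close>)
    moreover have "card (\<Union>j<N. (\<lambda>a. a + ?x j) ` lvl (E j) (u - int j) k) =
        (\<Sum>j<N. card ((\<lambda>a. a + ?x j) ` lvl (E j) (u - int j) k))"
    proof (intro card_UN_disjoint ballI impI)
      fix i j :: nat assume "i \<noteq> j"
      have "i' = j'" if "a + ?x i' = b + ?x j'" "supp a \<subseteq> F" "supp b \<subseteq> F" for a b i' j'
      proof -
        have "expo a v = 0" "expo b v = 0" using that \<open>v \<notin> F\<close> by (auto simp: in_keys_iff)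
        then show ?thesis
          using arg_cong[OF that(1), of "\<lambda>a. expo a v"] by (simp add: lookup_add)
      qed
      then show "(\<lambda>a. a + ?x i) ` lvl (E i) (u - int i) k \<inter> (\<lambda>a. a + ?x j) ` lvl (E j) (u - int j) k = {}"
        using \<open>i \<noteq> j\<close> by (force simp: lvl_def E_def)
    qed (auto simp: lvl_def finite_mcount)
    moreover have "card ((\<lambda>a. a + ?x j) ` lvl (E j) (u - int j) k) = mcount q (E j) (u - int j) k" for j
      by (subst card_image) (auto simp: lvl_def mcount_def)
    ultimately show ?thesis by (simp add: mcount_def c_def flip: lvl_def)
  qed
  have "of_nat (mcount q D u k) = (\<Sum>j<J. c j (u - int j) k) + csum (\<lambda>x. c J x k) (u - int J)" for u k
  proof -
    have EJ: "E (J + i) = E J" for i using spec[OF J, of "J + i"] by simp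
    define N where "N = nat (u - int J + 1)"
    have "(\<Sum>j<J + N. c j (u - int j) k) = (\<Sum>j<J. c j (u - int j) k) + (\<Sum>i<N. c (J + i) (u - int (J + i)) k)"
      by (induct N) (simp_all add: add.assoc)
    also have "(\<Sum>i<N. c (J + i) (u - int (J + i)) k) = (\<Sum>y\<in>{0..u - int J}. c J y k)"
      using EJ unfolding N_def
      by (intro sum.reindex_bij_witness[of _ "\<lambda>y. nat (u - int J - y)" "\<lambda>i. u - int J - int i"])
        (auto simp: c_def algebra_simps)
    also have "\<dots> = csum (\<lambda>x. c J x k) (u - int J)"
      by (rule csum_eq_interval[symmetric]) (simp add: c_def mcount_neg)
    finally show ?thesis
      using slices[of u "J + N" k] by (simp add: N_def)
  qed
  then show ?thesis
    using bisep_add[OF bisep_sum[of "{..<J}" "\<lambda>j u k. c j (u - int j) k"]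
        bisep_shift_left[OF bisep_csum[OF c_bisep[of J]], of "int J"]]
      bisep_shift_left[OF c_bisep] by simp
qed

text \<open>Induction on the set of variables that occur; for a variable that does not satisfy \<open>q\<close>
  exchange the two degrees.\<close>

lemma bisep_mcount:
  assumes "order_ideal D"
  shows "bisep (\<lambda>u k. of_nat (mcount q D u k))"
proof -
  have "bisep (\<lambda>u k. of_nat (mcount q D u k))"
    if "finite F" "\<And>a. a \<in> D \<Longrightarrow> supp a \<subseteq> F" "order_ideal D" for F D
    using that
  proof (induct F arbitrary: D)
    case empty
    then have D: "D \<subseteq> {0}" by (fastforce simp: in_keys_iff intro: poly_mapping_eqI)
    have "rat_of_nat (mcount q D u k) = (if u = 0 then 1 else 0) * (if k = 0 then of_nat (card D) else 0)"
      for u k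
    proof -
      have "D = {} \<or> D = {0}" using D by blast
      then show ?thesis by (auto simp: mcount_def qdeg_def Collect_conv_if)
    qed
    then show ?case
      using bisep_prod[OF ev_poly_delta[of 0 1] ev_poly_delta[of 0 "of_nat (card D)"]]
      by presburger
  next
    case (insert v F)
    show ?case
    proof (cases "q v")
      case True
      then show ?thesis using bisep_mcount_step[of q v F D] insert by blast
    next
      case False
      have "bisep (\<lambda>u k. of_nat (mcount (\<lambda>v. \<not> q v) D u k))"
      proof (rule bisep_mcount_step[of _ v F])
        fix E assume "\<And>a. a \<in> E \<Longrightarrow> supp a \<subseteq> F" "order_ideal E"
        then have "bisep (\<lambda>u k. of_nat (mcount q E u k))" using insert.hyps(3) by blast
        then show "bisep (\<lambda>u k. of_nat (mcount (\<lambda>v. \<not> q v) E u k))"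
          by (subst mcount_swap) (rule bisep_swap)
      qed (use insert False in auto)
      then show ?thesis
        by (subst (asm) mcount_swap) (drule bisep_swap, simp)
    qed
  qed
  from this[of UNIV] show ?thesis using assms by simp
qed

section \<open>Monomials and homogeneous parts of polynomials\<close>

definition mon :: "('v \<Rightarrow>\<^sub>0 nat) \<Rightarrow> ('v, 'k::field) mpoly" where
  "mon a = Poly_Mapping.single a 1"

abbreviation coef :: "('v, 'k::field) mpoly \<Rightarrow> ('v \<Rightarrow>\<^sub>0 nat) \<Rightarrow> 'k" where
  "coef \<equiv> Poly_Mapping.lookup"

lemma mon_mult: "mon a * mon b = mon (a + b)"
  by (simp add: mon_def mult_single)

lemma mon_0: "mon 0 = 1"
  by (simp add: mon_def)

lemma mvar_eq_mon: "mvar v = mon (Poly_Mapping.single v 1)"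
  by (simp add: mvar_def mon_def)

lemma mconst_mult_mon: "mconst c * mon a = Poly_Mapping.single a c"
  by (simp add: mon_def mconst_def mult_single)

lemma mconst_hom:
  "mconst (c + d) = mconst c + mconst d" "mconst (c * d) = mconst c * mconst d"
  "mconst 0 = 0" "mconst 1 = 1" "mconst (- c) = - mconst c"
  by (simp_all add: mconst_def mult_single single_add single_uminus)

lemma sum_single_expand:
  fixes f :: "'a \<Rightarrow>\<^sub>0 'c::comm_monoid_add"
  shows "f = (\<Sum>a\<in>supp f. Poly_Mapping.single a (Poly_Mapping.lookup f a))"
proof (rule poly_mapping_eqI)
  fix k
  have "(\<Sum>a\<in>supp f. Poly_Mapping.lookup (Poly_Mapping.single a (Poly_Mapping.lookup f a)) k) =
      (\<Sum>a\<in>supp f. if a = k then Poly_Mapping.lookup f k else 0)"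
    by (intro sum.cong refl) (simp add: lookup_single when_def)
  also have "\<dots> = Poly_Mapping.lookup f k"
    by (simp add: in_keys_iff)
  finally show "Poly_Mapping.lookup f k =
      Poly_Mapping.lookup (\<Sum>a\<in>supp f. Poly_Mapping.single a (Poly_Mapping.lookup f a)) k"
    by (simp add: lookup_sum)
qed

lemma mpoly_expand: "f = (\<Sum>a\<in>supp f. mconst (coef f a) * mon a)"
  by (simp only: mconst_mult_mon) (rule sum_single_expand)

definition part :: "('a \<Rightarrow> bool) \<Rightarrow> ('a \<Rightarrow>\<^sub>0 'c::comm_monoid_add) \<Rightarrow> ('a \<Rightarrow>\<^sub>0 'c)" where
  "part P f = (\<Sum>a | a \<in> supp f \<and> P a. Poly_Mapping.single a (Poly_Mapping.lookup f a))"

lemma lookup_part: "Poly_Mapping.lookup (part P f) k = (if P k then Poly_Mapping.lookup f k else 0)"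
proof -
  have "Poly_Mapping.lookup (part P f) k =
      (\<Sum>a | a \<in> supp f \<and> P a. if a = k then Poly_Mapping.lookup f k else 0)"
    unfolding part_def lookup_sum by (intro sum.cong refl) (simp add: lookup_single when_def)
  also have "\<dots> = (if P k then Poly_Mapping.lookup f k else 0)"
    by (simp add: in_keys_iff)
  finally show ?thesis .
qed

lemma part_add: "part P (f + g) = part P f + part P g"
  by (rule poly_mapping_eqI) (simp add: lookup_part lookup_add)

lemma part_0 [simp]: "part P 0 = 0"
  by (rule poly_mapping_eqI) (simp add: lookup_part)

lemma part_sum: "part P (\<Sum>a\<in>A. f a) = (\<Sum>a\<in>A. part P (f a))"
  by (induct A rule: infinite_finite_induct) (auto simp: part_add)

lemma part_single: "part P (Poly_Mapping.single a c) = (if P a then Poly_Mapping.single a c else 0)"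
  by (rule poly_mapping_eqI) (simp add: lookup_part lookup_single when_def)

lemma part_eq_self: "(\<And>a. a \<in> supp f \<Longrightarrow> P a) \<Longrightarrow> part P f = f"
  by (rule poly_mapping_eqI) (simp add: lookup_part in_keys_iff, metis)

lemma supp_part: "supp (part P f) = {a \<in> supp f. P a}"
  by (auto simp: in_keys_iff lookup_part split: if_splits)

lemma part_expand: "part P f = (\<Sum>a\<in>supp f. if P a then Poly_Mapping.single a (Poly_Mapping.lookup f a) else 0)"
  unfolding part_def by (rule sum.mono_neutral_cong_left) auto

lemma part_disjoint_sum:
  assumes "finite T"
  shows "part (\<lambda>a. \<delta> a \<in> T) f = (\<Sum>t\<in>T. part (\<lambda>a. \<delta> a = t) f)"
proof (rule poly_mapping_eqI)
  fix k
  have "(\<Sum>t\<in>T. Poly_Mapping.lookup (part (\<lambda>a. \<delta> a = t) f) k) =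
      (\<Sum>t\<in>T. if t = \<delta> k then Poly_Mapping.lookup f k else 0)"
    by (intro sum.cong refl) (auto simp: lookup_part)
  then show "Poly_Mapping.lookup (part (\<lambda>a. \<delta> a \<in> T) f) k =
      Poly_Mapping.lookup (\<Sum>t\<in>T. part (\<lambda>a. \<delta> a = t) f) k"
    using assms by (simp add: lookup_sum lookup_part)
qed

lemma part_single_mult:
  "part P (Poly_Mapping.single c k * f) = Poly_Mapping.single c k * part (\<lambda>a. P (c + a)) (f :: ('v, 'k::field) mpoly)"
proof -
  have "Poly_Mapping.single c k * f = (\<Sum>a\<in>supp f. Poly_Mapping.single c k * Poly_Mapping.single a (coef f a))"
    by (subst (1) sum_single_expand[of f]) (rule sum_distrib_left)
  then have "part P (Poly_Mapping.single c k * f) =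
      (\<Sum>a\<in>supp f. part P (Poly_Mapping.single (c + a) (k * coef f a)))"
    by (simp add: part_sum mult_single)
  also have "\<dots> = (\<Sum>a\<in>supp f. Poly_Mapping.single c k * (if P (c + a) then Poly_Mapping.single a (coef f a) else 0))"
    by (intro sum.cong refl) (simp add: part_single mult_single)
  finally show ?thesis
    by (simp add: part_expand[of "\<lambda>a. P (c + a)"] sum_distrib_left)
qed

text \<open>Only pairs of monomials of the two maximal degrees contribute to degree \<open>s + t\<close>.\<close>

lemma part_top_mult:
  fixes f g :: "('v, 'k::field) mpoly" and \<delta> :: "('v \<Rightarrow>\<^sub>0 nat) \<Rightarrow> 'g::linordered_ab_group_add"
  assumes add: "\<And>a b. \<delta> (a + b) = \<delta> a + \<delta> b"
    and f: "\<And>a. a \<in> supp f \<Longrightarrow> \<delta> a \<le> s" and g: "\<And>b. b \<in> supp g \<Longrightarrow> \<delta> b \<le> t"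
  shows "part (\<lambda>a. \<delta> a = s + t) (f * g) = part (\<lambda>a. \<delta> a = s) f * part (\<lambda>a. \<delta> a = t) g"
proof -
  let ?S = "\<lambda>f a. Poly_Mapping.single a (coef f a)"
  have "f * g = (\<Sum>a\<in>supp f. ?S f a) * (\<Sum>b\<in>supp g. ?S g b)"
    by (simp only: sum_single_expand[symmetric])
  also have "\<dots> = (\<Sum>a\<in>supp f. \<Sum>b\<in>supp g. Poly_Mapping.single (a + b) (coef f a * coef g b))"
    by (simp only: sum_product mult_single)
  finally have "part (\<lambda>a. \<delta> a = s + t) (f * g) =
      (\<Sum>a\<in>supp f. \<Sum>b\<in>supp g. part (\<lambda>a. \<delta> a = s + t) (Poly_Mapping.single (a + b) (coef f a * coef g b)))"
    by (simp only: part_sum)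
  also have "\<dots> = (\<Sum>a\<in>supp f. \<Sum>b\<in>supp g. (if \<delta> a = s then ?S f a else 0) * (if \<delta> b = t then ?S g b else 0))"
  proof (intro sum.cong refl)
    fix a b assume ab: "a \<in> supp f" "b \<in> supp g"
    have "\<delta> a + \<delta> b = s + t \<longleftrightarrow> \<delta> a = s \<and> \<delta> b = t"
      using add_less_le_mono[of "\<delta> a" s "\<delta> b" t] add_le_less_mono[of "\<delta> a" s "\<delta> b" t] f[OF ab(1)] g[OF ab(2)]
      by (auto simp: le_less)
    then show "part (\<lambda>a. \<delta> a = s + t) (Poly_Mapping.single (a + b) (coef f a * coef g b)) =
        (if \<delta> a = s then ?S f a else 0) * (if \<delta> b = t then ?S g b else 0)"
      by (simp add: part_single add mult_single)
  qed
  finally show ?thesis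
    by (simp only: sum_product[symmetric] part_expand[symmetric])
qed

section \<open>Homogeneous ideals\<close>

interpretation regular: module "(*) :: 'r::comm_ring_1 \<Rightarrow> 'r \<Rightarrow> 'r"
  by unfold_locales (simp_all add: algebra_simps)

(* as a rewrite rule this would undo associativity of multiplication *)
declare regular.scale_scale [simp del]

abbreviation ideal :: "'r::comm_ring_1 set \<Rightarrow> bool" where
  "ideal \<equiv> module.subspace (*)"

lemma ideal_mult: "ideal I \<Longrightarrow> f \<in> I \<Longrightarrow> g * f \<in> I"
  by (rule regular.subspace_scale)

definition homogeneous_ideal ::
    "(('v \<Rightarrow>\<^sub>0 nat) \<Rightarrow> 'g) \<Rightarrow> ('v, 'k::field) mpoly set \<Rightarrow> bool" where
  "homogeneous_ideal \<delta> I \<longleftrightarrow> ideal I \<and> (\<forall>f\<in>I. \<forall>t. part (\<lambda>a. \<delta> a = t) f \<in> I)"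

lemma homogeneous_idealD:
  assumes "homogeneous_ideal \<delta> I"
  shows "ideal I" "f \<in> I \<Longrightarrow> part (\<lambda>a. \<delta> a = t) f \<in> I"
  using assms unfolding homogeneous_ideal_def by simp_all

lemma part_via_degrees: "part (\<lambda>a. \<delta> a \<in> T) f = (\<Sum>t\<in>T \<inter> \<delta> ` supp f. part (\<lambda>a. \<delta> a = t) f)"
proof -
  have "part (\<lambda>a. \<delta> a \<in> T) f = part (\<lambda>a. \<delta> a \<in> T \<inter> \<delta> ` supp f) f"
    by (rule poly_mapping_eqI) (auto simp: lookup_part in_keys_iff)
  then show ?thesis
    by (subst part_disjoint_sum[symmetric]) auto
qed

lemma homogeneous_ideal_part:
  assumes "homogeneous_ideal \<delta> I" "f \<in> I"
  shows "part (\<lambda>a. \<delta> a \<in> T) f \<in> I"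
  unfolding part_via_degrees
  by (intro regular.subspace_sum homogeneous_idealD[OF assms(1)] assms(2))

lemma sum_of_parts: "f = (\<Sum>t\<in>\<delta> ` supp f. part (\<lambda>a. \<delta> a = t) f)"
  using part_via_degrees[of \<delta> UNIV f] by (simp add: part_eq_self)

definition homogeneous :: "(('v \<Rightarrow>\<^sub>0 nat) \<Rightarrow> 'g) \<Rightarrow> ('v, 'k::field) mpoly \<Rightarrow> bool" where
  "homogeneous \<delta> f \<longleftrightarrow> (\<exists>t. \<forall>a\<in>supp f. \<delta> a = t)"

lemma homogeneous_part: "homogeneous \<delta> (part (\<lambda>a. \<delta> a = t) f)"
  unfolding homogeneous_def supp_part by blast

text \<open>Of two polynomials outside the ideal take the highest homogeneous parts that lie outside it:
  modulo the ideal, their product is a homogeneous part of the product.\<close>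

lemma prime_on_homogeneous:
  fixes \<delta> :: "('v \<Rightarrow>\<^sub>0 nat) \<Rightarrow> 'g::linordered_ab_group_add" and P :: "('v, 'k::field) mpoly set"
  assumes add: "\<And>a b. \<delta> (a + b) = \<delta> a + \<delta> b" and P: "homogeneous_ideal \<delta> P"
    and prime: "\<And>f g. homogeneous \<delta> f \<Longrightarrow> homogeneous \<delta> g \<Longrightarrow> f * g \<in> P \<Longrightarrow> f \<in> P \<or> g \<in> P"
    and fg: "f * g \<in> P"
  shows "f \<in> P \<or> g \<in> P"
proof (rule ccontr)
  assume "\<not> (f \<in> P \<or> g \<in> P)"
  then have "f \<notin> P" "g \<notin> P" by simp_all
  note idealP = homogeneous_idealD(1)[OF P]
  have top: "\<exists>s. part (\<lambda>a. \<delta> a = s) h \<notin> P \<and> part (\<lambda>a. \<delta> a \<in> {s<..}) h \<in> P" if "h \<notin> P" for h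
  proof -
    define A where "A = {t \<in> \<delta> ` supp h. part (\<lambda>a. \<delta> a = t) h \<notin> P}"
    have "A \<noteq> {}"
    proof
      assume "A = {}"
      then have "(\<Sum>t\<in>\<delta> ` supp h. part (\<lambda>a. \<delta> a = t) h) \<in> P"
        by (intro regular.subspace_sum idealP) (auto simp: A_def)
      then show False using that sum_of_parts[of h \<delta>] by simp
    qed
    have "finite A" by (simp add: A_def)
    have "part (\<lambda>a. \<delta> a \<in> {Max A<..}) h \<in> P"
      unfolding part_via_degrees
    proof (intro regular.subspace_sum idealP)
      fix t assume t: "t \<in> {Max A<..} \<inter> \<delta> ` supp h"
      then have "t \<notin> A" using Max_ge[OF \<open>finite A\<close>, of t] by auto
      then show "part (\<lambda>a. \<delta> a = t) h \<in> P" using t by (simp add: A_def)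
    qed
    moreover have "part (\<lambda>a. \<delta> a = Max A) h \<notin> P"
      using Max_in[OF \<open>finite A\<close> \<open>A \<noteq> {}\<close>] by (simp add: A_def)
    ultimately show ?thesis by blast
  qed
  obtain s where s: "part (\<lambda>a. \<delta> a = s) f \<notin> P" "part (\<lambda>a. \<delta> a \<in> {s<..}) f \<in> P"
    using top[OF \<open>f \<notin> P\<close>] by blast
  obtain t where t: "part (\<lambda>a. \<delta> a = t) g \<notin> P" "part (\<lambda>a. \<delta> a \<in> {t<..}) g \<in> P"
    using top[OF \<open>g \<notin> P\<close>] by blast
  let ?f = "part (\<lambda>a. \<delta> a \<in> {..s}) f" and ?g = "part (\<lambda>a. \<delta> a \<in> {..t}) g"
  have split: "h = part (\<lambda>a. \<delta> a \<in> {..x}) h + part (\<lambda>a. \<delta> a \<in> {x<..}) h" for h :: "('v, 'k) mpoly" and x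
    by (rule poly_mapping_eqI) (auto simp: lookup_part lookup_add not_le)
  have expand: "f1 * g1 = (f1 + f2) * (g1 + g2) - (g1 + g2) * f2 - f1 * g2" for f1 f2 g1 g2 :: "('v, 'k) mpoly"
    by (simp add: algebra_simps)
  have "?f * ?g = f * g - g * part (\<lambda>a. \<delta> a \<in> {s<..}) f - ?f * part (\<lambda>a. \<delta> a \<in> {t<..}) g"
    using expand[of ?f ?g "part (\<lambda>a. \<delta> a \<in> {s<..}) f" "part (\<lambda>a. \<delta> a \<in> {t<..}) g"]
    by (simp only: split[symmetric])
  also have "\<dots> \<in> P"
    by (intro regular.subspace_diff[OF idealP] fg ideal_mult[OF idealP] s t)
  finally have "part (\<lambda>a. \<delta> a = s + t) (?f * ?g) \<in> P"
    by (rule homogeneous_idealD(2)[OF P])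
  moreover have "part (\<lambda>a. \<delta> a = s + t) (?f * ?g) = part (\<lambda>a. \<delta> a = s) ?f * part (\<lambda>a. \<delta> a = t) ?g"
    by (rule part_top_mult) (auto simp: add supp_part)
  moreover have "part (\<lambda>a. \<delta> a = x) (part (\<lambda>a. \<delta> a \<in> {..x}) h) = part (\<lambda>a. \<delta> a = x) h"
    for h :: "('v, 'k) mpoly" and x
    by (rule poly_mapping_eqI) (simp add: lookup_part)
  ultimately have "part (\<lambda>a. \<delta> a = s) f * part (\<lambda>a. \<delta> a = t) g \<in> P"
    by simp
  then show False
    using prime[OF homogeneous_part homogeneous_part] s(1) t(1) by blast
qed

section \<open>A monomial order\<close>

text \<open>An additive embedding of the monomials into an ordered abelian group; comparing images is a
  monomial order (lexicographic, for some enumeration of the variables).\<close>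

definition wt :: "('v::finite \<Rightarrow>\<^sub>0 nat) \<Rightarrow> int poly" where
  "wt a = (\<Sum>v\<in>UNIV. monom (int (expo a v)) (to_nat v))"

lemma wt_add: "wt (a + b) = wt a + wt b"
  by (simp add: wt_def lookup_add sum.distrib flip: add_monom)

lemma wt_inject: "wt a = wt b \<longleftrightarrow> a = b"
proof
  assume eq: "wt a = wt b"
  have c: "coeff (wt a) (to_nat v) = int (expo a v)" for a :: "'a \<Rightarrow>\<^sub>0 nat" and v
    by (simp add: wt_def coeff_sum)
  show "a = b"
  proof (rule poly_mapping_eqI)
    fix v show "expo a v = expo b v"
      using c[of a v] c[of b v] eq by simp
  qed
qed simp

text \<open>For the grading by \<open>wt\<close> the homogeneous polynomials are the terms \<open>c x\<^sup>a\<close>, so this is the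
  test \<open>prime_on_homogeneous\<close> for the zero ideal.\<close>

lemma mpoly_no_zero_divisors:
  fixes f g :: "('v::finite, 'k::field) mpoly"
  assumes "f * g = 0"
  shows "f = 0 \<or> g = 0"
proof -
  have "f \<in> {0} \<or> g \<in> {0}"
  proof (rule prime_on_homogeneous[of wt])
    show "homogeneous_ideal wt {0 :: ('v, 'k) mpoly}"
      by (simp add: homogeneous_ideal_def)
    fix f g :: "('v, 'k) mpoly"
    assume hom: "homogeneous wt f" "homogeneous wt g" and fg: "f * g \<in> {0}"
    have monomial: "\<exists>a. h = Poly_Mapping.single a (coef h a)" if "homogeneous wt h" for h :: "('v, 'k) mpoly"
    proof -
      have "\<exists>a. supp h \<subseteq> {a}"
        using that unfolding homogeneous_def by (metis singletonI subsetI wt_inject)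
      then obtain a where "supp h \<subseteq> {a}" by blast
      then have "part (\<lambda>b. b = a) h = h" by (intro part_eq_self) auto
      moreover have "part (\<lambda>b. b = a) h = Poly_Mapping.single a (coef h a)"
        by (rule poly_mapping_eqI) (simp add: lookup_part lookup_single when_def)
      ultimately show ?thesis by metis
    qed
    obtain a b where ab: "f = Poly_Mapping.single a (coef f a)" "g = Poly_Mapping.single b (coef g b)"
      using monomial[OF hom(1)] monomial[OF hom(2)] by blast
    have "f * g = Poly_Mapping.single (a + b) (coef f a * coef g b)"
      by (subst ab(1), subst ab(2)) (rule mult_single)
    then have "coef (Poly_Mapping.single (a + b) (coef f a * coef g b)) (a + b) = 0"
      using fg by simp
    then have "coef f a = 0 \<or> coef g b = 0" by simp
    then show "f \<in> {0} \<or> g \<in> {0}" using ab by (metis single_zero singletonI)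
  qed (use assms in \<open>simp_all add: wt_add\<close>)
  then show ?thesis by simp
qed

section \<open>Greedy bases\<close>

text \<open>Scan \<open>E\<close> in the order given by \<open>w\<close> and keep those vectors that are not combinations, modulo
  \<open>N\<close>, of the preceding ones.\<close>

lemma (in vector_space) greedy_spanning:
  fixes w :: "'e \<Rightarrow> 'o::linorder"
  assumes "finite E" and "e \<in> E"
  shows "v e \<in> span (N \<union> v ` {e \<in> E. v e \<notin> span (N \<union> v ` {e' \<in> E. w e' < w e})})"
    (is "_ \<in> span (N \<union> v ` ?S)")
  using assms(2)
proof (induct e rule: measure_induct_rule[of "\<lambda>e. card {e' \<in> E. w e' < w e}"])
  case (less e)
  show ?case
  proof (cases "e \<in> ?S")
    case False
    have "v e' \<in> span (N \<union> v ` ?S)" if "e' \<in> E" "w e' < w e" for e'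
    proof (rule less.hyps)
      show "card {x \<in> E. w x < w e'} < card {x \<in> E. w x < w e}"
        using that assms(1) by (intro psubset_card_mono) auto
    qed fact
    then have "N \<union> v ` {e' \<in> E. w e' < w e} \<subseteq> span (N \<union> v ` ?S)"
      using span_base by blast
    then have "span (N \<union> v ` {e' \<in> E. w e' < w e}) \<subseteq> span (N \<union> v ` ?S)"
      by (rule span_minimal) simp
    moreover have "v e \<in> span (N \<union> v ` {e' \<in> E. w e' < w e})" using False less.prems by blast
    ultimately show ?thesis by blast
  qed (auto intro: span_base)
qed

lemma (in vector_space) greedy_independent:
  fixes w :: "'e \<Rightarrow> 'o::linorder" and v :: "'e \<Rightarrow> 'b"
  assumes "finite E" and inj: "inj_on w E"
  defines "S \<equiv> {e \<in> E. v e \<notin> span (v ` {e' \<in> E. w e' < w e})}"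
  shows "inj_on v S" "independent (v ` S)"
proof -
  have "finite S" using assms(1) by (simp add: S_def)
  have "T \<subseteq> S \<longrightarrow> inj_on v T \<and> independent (v ` T)" if "finite T" for T
    using that
  proof (induct T rule: finite_ranking_induct[where f = w])
    case (insert e T)
    show ?case
    proof (cases "e \<in> T")
      case False
      show ?thesis
      proof
        assume sub: "insert e T \<subseteq> S"
        have "v ` T \<subseteq> v ` {e' \<in> E. w e' < w e}"
        proof (rule image_mono, rule subsetI)
          fix y assume y: "y \<in> T"
          then have "w y \<le> w e" "y \<noteq> e" using insert(2) False by auto
          moreover have "y \<in> E" "e \<in> E" using y sub by (auto simp: S_def)
          ultimately show "y \<in> {e' \<in> E. w e' < w e}" using inj by (auto simp: inj_on_def le_less)
        qed
        then have "span (v ` T) \<subseteq> span (v ` {e' \<in> E. w e' < w e})" by (rule span_mono)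
        then have "v e \<notin> span (v ` T)"
          using sub by (auto simp: S_def)
        then show "inj_on v (insert e T) \<and> independent (v ` insert e T)"
          using insert sub False by (auto simp: independent_insertI intro: span_base)
      qed
    qed (use insert in \<open>simp add: insert_absorb\<close>)
  qed (simp add: independent_empty)
  from this[OF \<open>finite S\<close>] show "inj_on v S" "independent (v ` S)" by simp_all
qed

section \<open>Modules over a polynomial ring as vector spaces\<close>

locale mpoly_module = module scale
  for scale :: "('v::finite, 'k::field) mpoly \<Rightarrow> 'm::ab_group_add \<Rightarrow> 'm"
begin

sublocale K: vector_space "\<lambda>c. scale (mconst c)"
  by unfold_locales (simp_all add: mconst_hom scale_right_distrib scale_left_distrib)

lemma scale_expand:
  "scale f w = (\<Sum>a\<in>supp f. scale (mconst (coef f a)) (scale (mon a) w))"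
  by (subst mpoly_expand[of f]) (simp add: scale_sum_left)

lemma subspace_imp_K: "subspace N \<Longrightarrow> K.subspace N"
  by (simp add: K.subspace_def subspace_def)

lemma scale_in_K_span: "(\<And>a. a \<in> supp f \<Longrightarrow> scale (mon a) w \<in> K.span B) \<Longrightarrow> scale f w \<in> K.span B"
  by (subst scale_expand) (intro K.span_sum K.span_scale)

lemma scale_K_span:
  assumes "w \<in> K.span B" and "\<And>b. b \<in> B \<Longrightarrow> scale f b \<in> T" and T: "K.subspace T"
  shows "scale f w \<in> T"
proof -
  have "K.span B \<subseteq> {w. scale f w \<in> T}"
  proof (rule K.span_minimal)
    show "K.subspace {w. scale f w \<in> T}"
    proof (rule K.subspaceI)
      fix c x assume "x \<in> {w. scale f w \<in> T}"
      then have "scale (mconst c) (scale f x) \<in> T" using K.subspace_scale[OF T] by blast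
      then show "scale (mconst c) x \<in> {w. scale f w \<in> T}" by (simp add: mult.commute)
    qed (use T in \<open>auto simp: scale_right_distrib K.subspace_0 K.subspace_add\<close>)
  qed (use assms in auto)
  then show ?thesis using assms by blast
qed

end

definition rank :: "('v::finite \<Rightarrow>\<^sub>0 nat) \<times> nat \<Rightarrow> int poly" where
  "rank = (\<lambda>(a, e). pCons (int e) (wt a))"

lemma rank_shift: "rank (a + c, e) = rank (a, e) + pCons 0 (wt c)"
  by (simp add: rank_def wt_add)

lemma inj_rank: "inj rank"
  by (auto simp: inj_def rank_def wt_inject)

text \<open>The standard monomials with respect to generators \<open>g\<^sub>0, \<dots>, g\<^bsub>r-1\<^esub>\<close> of a module, modulo \<open>N\<close>. The pair
  \<open>(a, e)\<close> stands for \<open>x\<^sup>a g\<^sub>e\<close>, and \<open>\<delta> a e\<close> is its degree.\<close>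

definition (in mpoly_module) std ::
    "'m set \<Rightarrow> nat \<Rightarrow> (nat \<Rightarrow> 'm) \<Rightarrow> (('v \<Rightarrow>\<^sub>0 nat) \<Rightarrow> nat \<Rightarrow> 'd) \<Rightarrow> (('v \<Rightarrow>\<^sub>0 nat) \<times> nat) set" where
  "std N r g \<delta> = {(a, e). e < r \<and> scale (mon a) (g e) \<notin> K.span (N \<union>
      (\<lambda>(a, e). scale (mon a) (g e)) ` {(a', e'). e' < r \<and> \<delta> a' e' = \<delta> a e \<and> rank (a', e') < rank (a, e)})}"

context mpoly_module
begin

text \<open>A relation that expresses \<open>x\<^sup>b g\<^sub>e\<close> by smaller terms, multiplied by a monomial, is a relation of
  the same kind for any multiple of \<open>x\<^sup>b g\<^sub>e\<close>.\<close>

lemma std_order_ideal: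
  assumes N: "\<And>c w. w \<in> N \<Longrightarrow> scale (mon c) w \<in> N"
    and \<delta>: "\<And>a e a' e' c. \<delta> a e = \<delta> a' e' \<Longrightarrow> \<delta> (a + c) e = \<delta> (a' + c) e'"
  shows "order_ideal {a. (a, e) \<in> std N r g \<delta>}"
  unfolding order_ideal_def
proof (intro ballI allI impI)
  fix a b assume "a \<in> {a. (a, e) \<in> std N r g \<delta>}" and le: "\<forall>v. expo b v \<le> expo a v"
  then have a: "(a, e) \<in> std N r g \<delta>" by simp
  let ?v = "\<lambda>(a, e). scale (mon a) (g e)"
  let ?X = "\<lambda>a. {(a', e'). e' < r \<and> \<delta> a' e' = \<delta> a e \<and> rank (a', e') < rank (a, e)}"
  define c where "c = a - b"
  have ab: "a = b + c"
    by (rule poly_mapping_eqI) (use le in \<open>simp add: c_def lookup_add lookup_minus\<close>)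
  have "scale (mon b) (g e) \<notin> K.span (N \<union> ?v ` ?X b)"
  proof
    assume "scale (mon b) (g e) \<in> K.span (N \<union> ?v ` ?X b)"
    then have "scale (mon c) (scale (mon b) (g e)) \<in> K.span (N \<union> ?v ` ?X a)"
    proof (rule scale_K_span)
      fix w assume "w \<in> N \<union> ?v ` ?X b"
      then show "scale (mon c) w \<in> K.span (N \<union> ?v ` ?X a)"
      proof
        assume "w \<in> N"
        then show ?thesis by (intro K.span_base UnI1 N)
      next
        assume "w \<in> ?v ` ?X b"
        then obtain a' e' where w: "w = scale (mon a') (g e')" "e' < r" "\<delta> a' e' = \<delta> b e"
          "rank (a', e') < rank (b, e)" by auto
        have "(a' + c, e') \<in> ?X a"
          using w \<delta>[OF w(3), of c] by (simp add: ab rank_shift)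
        moreover have "scale (mon c) w = ?v (a' + c, e')"
          using w by (simp add: mon_mult add.commute)
        ultimately show ?thesis by (intro K.span_base UnI2) (rule image_eqI)
      qed
    qed simp
    then show False using a by (simp add: std_def ab mon_mult add.commute)
  qed
  then show "b \<in> {a. (a, e) \<in> std N r g \<delta>}"
    using a by (simp add: std_def)
qed

lemma std_in_degree:
  fixes \<delta> :: "('v \<Rightarrow>\<^sub>0 nat) \<Rightarrow> nat \<Rightarrow> 'd" and d g r
  defines "E \<equiv> {(a, e). e < r \<and> \<delta> a e = d}" and "v \<equiv> \<lambda>(a, e). scale (mon a) (g e)"
  shows "{x \<in> E. v x \<notin> K.span (N \<union> v ` {x' \<in> E. rank x' < rank x})} = {(a, e) \<in> std N r g \<delta>. \<delta> a e = d}"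
proof -
  have mem: "v (a, e) \<notin> K.span (N \<union> v ` {x' \<in> E. rank x' < rank (a, e)}) \<longleftrightarrow> (a, e) \<in> std N r g \<delta>"
    if "e < r" "\<delta> a e = d" for a e
  proof -
    have "{x' \<in> E. rank x' < rank (a, e)} =
        {(a', e'). e' < r \<and> \<delta> a' e' = \<delta> a e \<and> rank (a', e') < rank (a, e)}"
      using that by (auto simp: E_def)
    then show ?thesis using that by (simp add: std_def v_def)
  qed
  have sub: "e < r" if "(a, e) \<in> std N r g \<delta>" for a e
    using that by (simp add: std_def)
  show ?thesis
  proof (rule set_eqI)
    fix x :: "('v \<Rightarrow>\<^sub>0 nat) \<times> nat"
    obtain a e where x: "x = (a, e)" by (cases x)
    show "x \<in> {x \<in> E. v x \<notin> K.span (N \<union> v ` {x' \<in> E. rank x' < rank x})} \<longleftrightarrow>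
        x \<in> {(a, e) \<in> std N r g \<delta>. \<delta> a e = d}"
    proof (cases "e < r \<and> \<delta> a e = d")
      case True
      then have "(a, e) \<in> E" by (simp add: E_def)
      with True mem[of e a] show ?thesis unfolding x by blast
    next
      case False
      then show ?thesis using sub[of a e] unfolding x by (auto simp: E_def)
    qed
  qed
qed

lemma std_spanning:
  assumes fin: "finite {(a, e). e < r \<and> \<delta> a e = d}" and "e < r" "\<delta> a e = d"
  shows "scale (mon a) (g e) \<in>
    K.span (N \<union> (\<lambda>(a, e). scale (mon a) (g e)) ` {(a, e) \<in> std N r g \<delta>. \<delta> a e = d})"
  using K.greedy_spanning[OF fin, of "(a, e)" "\<lambda>(a, e). scale (mon a) (g e)" N rank] assms(2,3)
  unfolding std_in_degree by simp

lemma std_dim: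
  assumes fin: "finite {(a, e). e < r \<and> \<delta> a e = d}"
  shows "K.dim (K.span ((\<lambda>(a, e). scale (mon a) (g e)) ` {(a, e). e < r \<and> \<delta> a e = d})) =
    card {(a, e) \<in> std {} r g \<delta>. \<delta> a e = d}"
proof -
  let ?E = "{(a, e). e < r \<and> \<delta> a e = d}" and ?v = "\<lambda>(a, e). scale (mon a) (g e)"
  let ?S = "{x \<in> ?E. ?v x \<notin> K.span (?v ` {x' \<in> ?E. rank x' < rank x})}"
  have S: "?S = {(a, e) \<in> std {} r g \<delta>. \<delta> a e = d}"
    using std_in_degree[of r \<delta> d g "{}"] by simp
  have inj: "inj_on rank ?E" using inj_rank by (rule inj_on_subset) simp
  note indep = K.greedy_independent[OF fin inj, of ?v]
  have "?v ` ?E \<subseteq> K.span (?v ` ?S)"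
    using K.greedy_spanning[OF fin, of _ ?v "{}" rank] by (intro image_subsetI) simp
  then have "K.span (?v ` ?E) = K.span (?v ` ?S)"
    by (intro antisym K.span_minimal K.subspace_span K.span_mono image_mono) auto
  then have "K.dim (K.span (?v ` ?E)) = card (?v ` ?S)"
    using K.dim_span_eq_card_independent[OF indep(2)] by simp
  also have "\<dots> = card ?S" by (rule card_image) (rule indep(1))
  finally show ?thesis unfolding S .
qed

end

section \<open>Independence modulo a subspace\<close>

lemma (in vector_space) independent_family:
  assumes J: "finite J" and ind: "\<And>c. (\<Sum>j\<in>J. scale (c j) (v j)) = 0 \<Longrightarrow> \<forall>j\<in>J. c j = 0"
  shows "inj_on v J" "independent (v ` J)"
proof -
  show inj: "inj_on v J"
  proof (rule inj_onI, rule ccontr)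
    fix i j assume ij: "i \<in> J" "j \<in> J" "v i = v j" "i \<noteq> j"
    define c where "c k = (if k = i then 1 else if k = j then - 1 else 0 :: 'a)" for k
    have "(\<Sum>k\<in>J. scale (c k) (v k)) = (\<Sum>k\<in>{i, j}. scale (c k) (v k))"
      by (rule sum.mono_neutral_right) (use ij J in \<open>auto simp: c_def\<close>)
    also have "\<dots> = 0" using ij by (simp add: c_def)
    finally have "c i = 0" using ind ij(1) by blast
    then show False by (simp add: c_def)
  qed
  show "independent (v ` J)"
  proof
    assume "dependent (v ` J)"
    then obtain u w where u: "w \<in> v ` J" "u w \<noteq> 0" "(\<Sum>w\<in>v ` J. scale (u w) w) = 0"
      using dependent_finite[of "v ` J"] J by auto
    then have "(\<Sum>j\<in>J. scale (u (v j)) (v j)) = 0"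
      using inj by (simp add: sum.reindex)
    then show False using ind[of "\<lambda>j. u (v j)"] u by auto
  qed
qed

lemma (in vector_space) card_le_of_independent_mod:
  assumes N: "subspace N" and J: "finite J"
    and ind: "\<And>c. (\<Sum>j\<in>J. scale (c j) (v j)) \<in> N \<Longrightarrow> \<forall>j\<in>J. c j = 0"
    and B: "finite B" and v: "\<And>j. j \<in> J \<Longrightarrow> v j \<in> span (B \<union> N)"
  shows "card J \<le> card B"
proof -
  have "\<forall>j\<in>J. \<exists>b. b \<in> span B \<and> v j - b \<in> N"
  proof
    fix j assume "j \<in> J"
    then obtain x y where "v j = x + y" "x \<in> span B" "y \<in> span N"
      using v span_Un[of B N] by blast
    then show "\<exists>b. b \<in> span B \<and> v j - b \<in> N"
      using N by (intro exI[of _ x]) (simp add: span_eq_iff[THEN iffD2])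
  qed
  from bchoice[OF this] obtain b where b: "\<forall>j\<in>J. b j \<in> span B \<and> v j - b j \<in> N" ..
  have "\<forall>j\<in>J. c j = 0" if "(\<Sum>j\<in>J. scale (c j) (b j)) = 0" for c
  proof (rule ind)
    have "(\<Sum>j\<in>J. scale (c j) (v j)) = (\<Sum>j\<in>J. scale (c j) (v j - b j))"
      using that by (simp add: scale_right_diff_distrib sum_subtractf)
    also have "\<dots> \<in> N" using b by (intro subspace_sum[OF N] subspace_scale[OF N]) blast
    finally show "(\<Sum>j\<in>J. scale (c j) (v j)) \<in> N" .
  qed
  note b' = independent_family[OF J this]
  have "card (b ` J) \<le> card B"
    using independent_span_bound[OF B b'(2)] b by blast
  then show ?thesis by (simp add: card_image b'(1))
qed

section \<open>The Krull dimension of a polynomial ring is at most the number of variables\<close>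

interpretation regular: mpoly_module "(*) :: ('v::finite, 'k::field) mpoly \<Rightarrow> _"
  by unfold_locales

declare regular.scale_scale [simp del] regular.K.scale_scale [simp del]

definition deg_le :: "nat \<Rightarrow> ('v::finite, 'k::field) mpoly set" where
  "deg_le t = {f. \<forall>a\<in>supp f. tdeg a \<le> t}"

lemma deg_le_mono: "s \<le> t \<Longrightarrow> deg_le s \<subseteq> deg_le t"
  by (auto simp: deg_le_def)

lemma deg_le_mult: "f \<in> deg_le s \<Longrightarrow> g \<in> deg_le t \<Longrightarrow> f * g \<in> deg_le (s + t)"
  using keys_mult[of f g] by (force simp: deg_le_def intro: add_mono)

lemma deg_le_power: "f \<in> deg_le s \<Longrightarrow> f ^ n \<in> deg_le (s * n)"
proof (induct n)
  case 0
  then show ?case by (simp add: deg_le_def flip: mon_0) (simp add: mon_def)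
next
  case (Suc n)
  then show ?case using deg_le_mult[of f s "f ^ n" "s * n"] by simp
qed

lemma deg_le_exists: "\<exists>t. f \<in> deg_le t"
  by (rule exI[of _ "Max (tdeg ` supp f)"]) (simp add: deg_le_def)

lemma deg_le_in_span:
  fixes f :: "('v::finite, 'k::field) mpoly"
  assumes "f \<in> deg_le t" and "\<And>a. tdeg a \<le> t \<Longrightarrow> mon a \<in> regular.K.span B"
  shows "f \<in> regular.K.span B"
  using regular.scale_in_K_span[of f 1 B] assms by (auto simp: deg_le_def)

lemma card_box:
  fixes h :: "'v::finite \<Rightarrow> nat"
  shows "finite {a. \<forall>v. expo a v \<le> h v}" "card {a. \<forall>v. expo a v \<le> h v} \<le> (\<Prod>v\<in>UNIV. Suc (h v))"
proof -
  let ?A = "{a. \<forall>v. expo a v \<le> h v}" and ?P = "\<Pi>\<^sub>E v\<in>UNIV. {..h v}"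
  have inj: "inj_on Poly_Mapping.lookup ?A" by (rule inj_on_subset[OF inj_lookup]) simp
  have sub: "Poly_Mapping.lookup ` ?A \<subseteq> ?P" by (auto simp: PiE_def Pi_def extensional_def)
  have fin: "finite ?P" by (simp add: finite_PiE)
  show "finite ?A" using inj sub fin by (rule inj_on_finite)
  show "card ?A \<le> (\<Prod>v\<in>UNIV. Suc (h v))"
    using card_inj_on_le[OF inj sub fin] by (simp add: card_PiE)
qed

lemma card_tdeg_le: "card {a :: 'v::finite \<Rightarrow>\<^sub>0 nat. tdeg a \<le> t} \<le> Suc t ^ CARD('v)"
proof -
  have "{a :: 'v \<Rightarrow>\<^sub>0 nat. tdeg a \<le> t} \<subseteq> {a. \<forall>v. expo a v \<le> t}"
    using expo_le_tdeg order.trans by blast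
  then have "card {a :: 'v \<Rightarrow>\<^sub>0 nat. tdeg a \<le> t} \<le> card {a :: 'v \<Rightarrow>\<^sub>0 nat. \<forall>v. expo a v \<le> t}"
    by (rule card_mono[OF card_box(1)])
  also have "\<dots> \<le> Suc t ^ CARD('v)" using card_box(2)[of "\<lambda>_. t"] by simp
  finally show ?thesis .
qed

lemma prime_idealD:
  assumes "prime_ideal P"
  shows "ideal P" "1 \<notin> P" "f * g \<in> P \<Longrightarrow> f \<in> P \<or> g \<in> P"
proof -
  show "ideal P" "f * g \<in> P \<Longrightarrow> f \<in> P \<or> g \<in> P"
    using assms by (auto simp: prime_ideal_def)
  show "1 \<notin> P"
  proof
    assume "1 \<in> P"
    then have "g * 1 \<in> P" for g using ideal_mult[OF \<open>ideal P\<close>] by blast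
    then show False using assms by (auto simp: prime_ideal_def)
  qed
qed

lemma prime_ideal_power: "prime_ideal P \<Longrightarrow> f ^ n \<in> P \<Longrightarrow> f \<in> P"
  by (induct n) (use prime_idealD in \<open>auto dest: prime_idealD(3)\<close>)

text \<open>Exponent vectors with entries at most \<open>t\<close>; they are lists because their length grows in an
  induction along a chain of primes.\<close>

definition words :: "nat \<Rightarrow> nat \<Rightarrow> nat list set" where
  "words m t = {l. set l \<subseteq> {..t} \<and> length l = m}"

lemma words_Suc: "words (Suc m) t = (\<lambda>(i, l). i # l) ` ({..t} \<times> words m t)"
  by (auto simp: words_def length_Suc_conv image_iff)

lemma finite_words: "finite (words m t)"
  using finite_lists_length_eq[of "{..t}" m] by (simp add: words_def)

lemma card_words: "card (words m t) = Suc t ^ m"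
  using card_lists_length_eq[of "{..t}" m] by (simp add: words_def)

text \<open>Let \<open>Q \<subset> P\<close> be primes and \<open>f \<in> P - Q\<close>. A family independent modulo \<open>P\<close> stays independent
  modulo \<open>Q\<close> after multiplication by distinct powers of \<open>f\<close>: in a relation, divide by the lowest
  power of \<open>f\<close> that occurs and reduce modulo \<open>P\<close>.\<close>

lemma powers_independent:
  fixes P Q :: "('v::finite, 'k::field) mpoly set"
  assumes Q: "prime_ideal Q" and P: "ideal P" and QP: "Q \<subseteq> P" and f: "f \<in> P" "f \<notin> Q"
    and J: "finite J"
    and ind: "\<And>c. (\<Sum>j\<in>J. mconst (c j) * v j) \<in> P \<Longrightarrow> \<forall>j\<in>J. c j = 0"
    and rel: "(\<Sum>(i, j)\<in>{..t::nat} \<times> J. mconst (c i j) * (f ^ i * v j)) \<in> Q"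
  shows "\<forall>i\<le>t. \<forall>j\<in>J. c i j = 0"
proof -
  define s where "s i = (\<Sum>j\<in>J. mconst (c i j) * v j)" for i
  have "(\<Sum>(i, j)\<in>{..t} \<times> J. mconst (c i j) * (f ^ i * v j)) =
      (\<Sum>i\<in>{..t}. \<Sum>j\<in>J. mconst (c i j) * (f ^ i * v j))"
    by (rule sum.cartesian_product[symmetric])
  also have "\<dots> = (\<Sum>i\<in>{..t}. f ^ i * s i)"
    unfolding s_def sum_distrib_left by (intro sum.cong refl mult.left_commute)
  finally have rel': "(\<Sum>i\<in>{..t}. f ^ i * s i) \<in> Q"
    using rel by simp
  have "i \<le> t \<longrightarrow> (\<forall>j\<in>J. c i j = 0)" for i
  proof (induct i rule: less_induct)
    case (less i)
    show ?case
    proof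
      assume it: "i \<le> t"
      have low: "s k = 0" if "k < i" for k
        using less[OF that] that it by (simp add: s_def mconst_hom)
      define h where "h = (\<Sum>k\<in>{Suc i..t}. f ^ (k - Suc i) * s k)"
      have "(\<Sum>k\<in>{..t}. f ^ k * s k) = (\<Sum>k\<in>{i..t}. f ^ k * s k)"
        using low by (intro sum.mono_neutral_right) auto
      also have "\<dots> = f ^ i * s i + (\<Sum>k\<in>{Suc i..t}. f ^ k * s k)"
        using it by (rule sum.atLeast_Suc_atMost)
      also have "(\<Sum>k\<in>{Suc i..t}. f ^ k * s k) = (\<Sum>k\<in>{Suc i..t}. f ^ i * (f * (f ^ (k - Suc i) * s k)))"
      proof (rule sum.cong[OF refl])
        fix k assume "k \<in> {Suc i..t}"
        then have "f ^ k = f ^ (i + (1 + (k - Suc i)))" by simp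
        then show "f ^ k * s k = f ^ i * (f * (f ^ (k - Suc i) * s k))"
          by (simp only: power_add power_one_right mult.assoc)
      qed
      also have "\<dots> = f ^ i * (f * h)" by (simp only: h_def sum_distrib_left)
      finally have "f ^ i * (s i + f * h) \<in> Q" using rel' by (simp add: distrib_left)
      moreover have "f ^ i \<notin> Q" using prime_ideal_power[OF Q] f(2) by blast
      ultimately have "s i + f * h \<in> P" using prime_idealD(3)[OF Q] QP by blast
      moreover have "f * h \<in> P" using ideal_mult[OF P f(1), of h] by (simp add: mult.commute)
      ultimately have "s i \<in> P" using regular.subspace_diff[OF P] by fastforce
      then show "\<forall>j\<in>J. c i j = 0" unfolding s_def by (rule ind)
    qed
  qed
  then show ?thesis by blast
qed

text \<open>The family consists of the products of powers of elements \<open>f\<^sub>i \<in> P\<^sub>i - P\<^bsub>i-1\<^esub>\<close>, with one more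
  factor for each step down the chain.\<close>

lemma chain_independent:
  fixes P :: "nat \<Rightarrow> ('v::finite, 'k::field) mpoly set"
  assumes prime: "\<And>i. i \<le> r \<Longrightarrow> prime_ideal (P i)" and chain: "\<And>i. i < r \<Longrightarrow> P i \<subset> P (Suc i)"
  shows "m \<le> r \<Longrightarrow> \<exists>D v. \<forall>t. (\<forall>l\<in>words m t. v l \<in> deg_le (D * t)) \<and>
    (\<forall>c. (\<Sum>l\<in>words m t. mconst (c l) * v l) \<in> P (r - m) \<longrightarrow> (\<forall>l\<in>words m t. c l = 0))"
proof (induct m)
  case 0
  have one: "(1 :: ('v, 'k) mpoly) \<in> deg_le s" for s
    by (simp add: deg_le_def flip: mon_0) (simp add: mon_def)
  have "c = 0" if "mconst c \<in> P r" for c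
  proof (rule ccontr)
    assume "c \<noteq> 0"
    then have "mconst (inverse c) * mconst c = (1 :: ('v, 'k) mpoly)" by (simp flip: mconst_hom(2)) (simp add: mconst_hom)
    then show False
      using ideal_mult[OF prime_idealD(1)[OF prime[of r]] that, of "mconst (inverse c)"]
        prime_idealD(2)[OF prime[of r]] by simp
  qed
  moreover have "words 0 t = {[]}" for t by (auto simp: words_def)
  ultimately show ?case
    by (intro exI[of _ 0] exI[of _ "\<lambda>_. 1"]) (simp add: one)
next
  case (Suc m)
  from Suc.hyps[OF Suc_leD[OF Suc.prems]] obtain D v where
    H: "\<forall>t. (\<forall>l\<in>words m t. v l \<in> deg_le (D * t)) \<and>
      (\<forall>c. (\<Sum>l\<in>words m t. mconst (c l) * v l) \<in> P (r - m) \<longrightarrow> (\<forall>l\<in>words m t. c l = 0))"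
    by (elim exE)
  have Dv: "v l \<in> deg_le (D * t)" if "l \<in> words m t" for t l
    using H that by simp
  have ind: "\<forall>l\<in>words m t. c l = 0" if "(\<Sum>l\<in>words m t. mconst (c l) * v l) \<in> P (r - m)" for t c
    using H that by simp
  have rm: "Suc (r - Suc m) = r - m" using Suc.prems by simp
  then obtain f where f: "f \<in> P (r - m)" "f \<notin> P (r - Suc m)" and sub: "P (r - Suc m) \<subseteq> P (r - m)"
    using chain[of "r - Suc m"] Suc.prems by fastforce
  obtain d where d: "f \<in> deg_le d" using deg_le_exists by blast
  define v' where "v' l = f ^ hd l * v (tl l)" for l
  show ?case
  proof (intro exI[of _ "d + D"] exI[of _ v'] allI conjI impI)
    fix t
    show "\<forall>l\<in>words (Suc m) t. v' l \<in> deg_le ((d + D) * t)"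
    proof
      fix l assume "l \<in> words (Suc m) t"
      then obtain i k where l: "l = i # k" "i \<le> t" "k \<in> words m t" unfolding words_Suc by auto
      have "v' l \<in> deg_le (d * i + D * t)"
        unfolding l(1) v'_def list.sel by (rule deg_le_mult[OF deg_le_power[OF d] Dv[OF l(3)]])
      moreover have "d * i + D * t \<le> (d + D) * t" using l(2) by (simp add: add_mult_distrib)
      ultimately show "v' l \<in> deg_le ((d + D) * t)" using deg_le_mono by blast
    qed
    fix c assume rel: "(\<Sum>l\<in>words (Suc m) t. mconst (c l) * v' l) \<in> P (r - Suc m)"
    have "(\<Sum>l\<in>words (Suc m) t. mconst (c l) * v' l) =
        (\<Sum>(i, l)\<in>{..t} \<times> words m t. mconst (c (i # l)) * (f ^ i * v l))"
      unfolding words_Suc by (subst sum.reindex) (auto simp: inj_on_def v'_def intro!: sum.cong)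
    with rel have "(\<Sum>(i, l)\<in>{..t} \<times> words m t. mconst (c (i # l)) * (f ^ i * v l)) \<in> P (r - Suc m)"
      by simp
    moreover have "prime_ideal (P (r - Suc m))" "ideal (P (r - m))"
      by (intro prime prime_idealD(1); simp)+
    ultimately have "\<forall>i\<le>t. \<forall>l\<in>words m t. c (i # l) = 0"
      by (intro powers_independent[OF _ _ sub f finite_words ind])
    then show "\<forall>l\<in>words (Suc m) t. c l = 0" unfolding words_Suc by auto
  qed
qed

lemma power_growth_contradiction:
  fixes C d :: nat
  assumes "\<And>t. Suc t ^ Suc d \<le> C * Suc t ^ d"
  shows False
  using assms[of C] by (simp add: mult.commute)

text \<open>A chain of length \<open>r\<close> provides \<open>(t + 1)\<^sup>r\<close> independent polynomials of degree at most \<open>D t\<close>, but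
  the space of all such polynomials has dimension at most \<open>(D t + 1)\<^sup>n\<close>.\<close>

lemma prime_chain_length:
  fixes P :: "nat \<Rightarrow> ('v::finite, 'k::field) mpoly set"
  assumes prime: "\<And>i. i \<le> r \<Longrightarrow> prime_ideal (P i)" and chain: "\<And>i. i < r \<Longrightarrow> P i \<subset> P (Suc i)"
  shows "r \<le> CARD('v)"
proof (rule ccontr)
  let ?n = "CARD('v)"
  assume "\<not> r \<le> ?n"
  have "\<exists>D v. \<forall>t. (\<forall>l\<in>words r t. v l \<in> deg_le (D * t)) \<and>
      (\<forall>c. (\<Sum>l\<in>words r t. mconst (c l) * v l) \<in> P (r - r) \<longrightarrow> (\<forall>l\<in>words r t. c l = 0))"
    by (rule chain_independent) (simp_all only: prime chain order_refl)
  then obtain D v where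
    H: "\<forall>t. (\<forall>l\<in>words r t. v l \<in> deg_le (D * t)) \<and>
      (\<forall>c. (\<Sum>l\<in>words r t. mconst (c l) * v l) \<in> P (r - r) \<longrightarrow> (\<forall>l\<in>words r t. c l = 0))"
    by (elim exE)
  have Dv: "v l \<in> deg_le (D * t)" if "l \<in> words r t" for t l
    using H that by simp
  have ind: "\<forall>l\<in>words r t. c l = 0" if "(\<Sum>l\<in>words r t. mconst (c l) * v l) \<in> P (r - r)" for t c
    using H that by simp
  have "Suc t ^ Suc ?n \<le> (D + 1) ^ ?n * Suc t ^ ?n" for t
  proof -
    let ?M = "{a :: 'v \<Rightarrow>\<^sub>0 nat. tdeg a \<le> D * t}"
    have fin: "finite ?M" by (rule finite_tdeg_le)
    have "card (words r t) \<le> card ((mon :: _ \<Rightarrow> ('v, 'k) mpoly) ` ?M)"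
    proof (rule regular.K.card_le_of_independent_mod)
      show "regular.K.subspace (P 0)"
        by (intro regular.subspace_imp_K prime_idealD(1) prime) simp
      show "v l \<in> regular.K.span (mon ` ?M \<union> P 0)" if "l \<in> words r t" for l
        by (rule deg_le_in_span[OF Dv[OF that]]) (auto intro: regular.K.span_base)
    qed (use ind fin finite_words in auto)
    also have "\<dots> \<le> card ?M" by (rule card_image_le[OF fin])
    also have "\<dots> \<le> Suc (D * t) ^ ?n" by (rule card_tdeg_le)
    also have "\<dots> \<le> ((D + 1) * Suc t) ^ ?n" by (rule power_mono) (simp_all add: algebra_simps)
    also have "\<dots> = (D + 1) ^ ?n * Suc t ^ ?n" by (rule power_mult_distrib)
    finally have "Suc t ^ r \<le> (D + 1) ^ ?n * Suc t ^ ?n" by (simp add: card_words)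
    moreover have "Suc t ^ Suc ?n \<le> Suc t ^ r"
      using \<open>\<not> r \<le> ?n\<close> by (intro power_increasing) auto
    ultimately show ?thesis by (rule order.trans[rotated])
  qed
  then show False by (rule power_growth_contradiction)
qed

lemma krull_dim_quot_cases:
  fixes I :: "('v::finite, 'k::field) mpoly set"
  shows "krull_dim_quot I = -\<infinity> \<or> (\<exists>d\<le>CARD('v). krull_dim_quot I = ereal (real d))"
proof -
  let ?A = "{ereal (real n) | n. \<exists>P. (\<forall>i\<le>n. prime_ideal (P i) \<and> I \<subseteq> P i) \<and> (\<forall>i<n. P i \<subset> P (Suc i))}"
  have bounded: "?A \<subseteq> (\<lambda>n. ereal (real n)) ` {..CARD('v)}"
  proof
    fix x assume "x \<in> ?A"
    then obtain n P where x: "x = ereal (real n)"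
      and P: "\<forall>i\<le>n. prime_ideal (P i) \<and> I \<subseteq> P i" "\<forall>i<n. P i \<subset> P (Suc i)" by auto
    have "n \<le> CARD('v)" using P by (intro prime_chain_length[of n P]) auto
    then show "x \<in> (\<lambda>n. ereal (real n)) ` {..CARD('v)}" using x by blast
  qed
  then have fin: "finite ?A" by (rule finite_subset) simp
  show ?thesis
  proof (cases "?A = {}")
    case True
    then have "krull_dim_quot I = Sup {}" unfolding krull_dim_quot_def by (rule arg_cong)
    then show ?thesis by (simp add: bot_ereal_def)
  next
    case False
    then have "krull_dim_quot I \<in> ?A"
      unfolding krull_dim_quot_def using Max_in[OF fin False] Max_Sup[OF fin False] by simp
    then have "krull_dim_quot I \<in> (\<lambda>n. ereal (real n)) ` {..CARD('v)}"
      by (rule subsetD[OF bounded])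
    then show ?thesis by auto
  qed
qed

lemma krull_dim_quot_antimono: "I \<subseteq> J \<Longrightarrow> krull_dim_quot J \<le> krull_dim_quot I"
  unfolding krull_dim_quot_def
proof (rule Sup_subset_mono, rule subsetI)
  fix x assume IJ: "I \<subseteq> J"
    and "x \<in> {ereal (real n) | n. \<exists>P. (\<forall>i\<le>n. prime_ideal (P i) \<and> J \<subseteq> P i) \<and> (\<forall>i<n. P i \<subset> P (Suc i))}"
  then obtain n P where "x = ereal (real n)"
    and "\<forall>i\<le>n. prime_ideal (P i) \<and> J \<subseteq> P i" and "\<forall>i<n. P i \<subset> P (Suc i)"
    by (elim CollectE exE conjE)
  moreover from this IJ have "\<forall>i\<le>n. prime_ideal (P i) \<and> I \<subseteq> P i" by (meson order.trans)
  ultimately show "x \<in> {ereal (real n) | n. \<exists>P. (\<forall>i\<le>n. prime_ideal (P i) \<and> I \<subseteq> P i) \<and> (\<forall>i<n. P i \<subset> P (Suc i))}"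
    by (intro CollectI exI conjI)
qed

section \<open>Lower bounds for the Krull dimension\<close>

definition vars_ring :: "'v set \<Rightarrow> ('v, 'k::field) mpoly set" where
  "vars_ring F = {f. \<forall>a\<in>supp f. \<forall>v. v \<notin> F \<longrightarrow> expo a v = 0}"

text \<open>The polynomials in the variables of \<open>F\<close> embed into the quotient ring: these variables are
  algebraically independent modulo \<open>I\<close>.\<close>

definition alg_indep :: "'v set \<Rightarrow> ('v, 'k::field) mpoly set \<Rightarrow> bool" where
  "alg_indep F I \<longleftrightarrow> vars_ring F \<inter> I \<subseteq> {0}"

lemma vars_ring_mult: "f \<in> vars_ring F \<Longrightarrow> g \<in> vars_ring F \<Longrightarrow> f * g \<in> vars_ring F"
proof -
  assume fg: "f \<in> vars_ring F" "g \<in> vars_ring F"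
  show "f * g \<in> vars_ring F"
    unfolding vars_ring_def
  proof (intro CollectI ballI allI impI)
    fix c v assume "c \<in> supp (f * g)" "v \<notin> F"
    then obtain a b where "c = a + b" "a \<in> supp f" "b \<in> supp g" using keys_mult[of f g] by blast
    then show "expo c v = 0" using fg \<open>v \<notin> F\<close> by (simp add: vars_ring_def lookup_add)
  qed
qed

lemma supp_mon [simp]: "supp (mon a) = {a}"
  by (simp add: mon_def)

lemma mon_nonzero: "mon a \<noteq> 0"
  by (metis supp_mon keys_zero insert_not_empty)

lemma mon_in_vars_ring: "mon a \<in> vars_ring F \<longleftrightarrow> (\<forall>v. v \<notin> F \<longrightarrow> expo a v = 0)"
  by (simp add: vars_ring_def)

lemma homogeneous_tdeg_int:
  "homogeneous_ideal (\<lambda>a. int (tdeg a)) I \<longleftrightarrow> homogeneous_ideal tdeg I"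
proof -
  have int_part: "part (\<lambda>a. int (tdeg a) = t) f = (if t < 0 then 0 else part (\<lambda>a. tdeg a = nat t) f)"
    for t and f :: "('a, 'b) mpoly"
    by (rule poly_mapping_eqI) (auto simp: lookup_part)
  have nat_part: "part (\<lambda>a. tdeg a = t) f = part (\<lambda>a. int (tdeg a) = int t) f" for t and f :: "('a, 'b) mpoly"
    by simp
  show ?thesis
  proof
    assume "homogeneous_ideal (\<lambda>a. int (tdeg a)) I"
    then show "homogeneous_ideal tdeg I"
      unfolding homogeneous_ideal_def nat_part by blast
  next
    assume "homogeneous_ideal tdeg I"
    then show "homogeneous_ideal (\<lambda>a. int (tdeg a)) I"
      unfolding homogeneous_ideal_def int_part by (simp add: regular.subspace_0)
  qed
qed

definition adjoin :: "('v, 'k::field) mpoly set \<Rightarrow> ('v, 'k) mpoly \<Rightarrow> ('v, 'k) mpoly set" where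
  "adjoin P f = {p + f * h | p h. p \<in> P}"

lemma adjoinI: "p \<in> P \<Longrightarrow> p + f * h \<in> adjoin P f"
  unfolding adjoin_def by blast

lemma adjoin_superset: "P \<subseteq> adjoin P f"
  using adjoinI[of _ P f 0] by auto

lemma adjoin_mem: "ideal P \<Longrightarrow> f \<in> adjoin P f"
  using adjoinI[of 0 P f 1] regular.subspace_0[of P] by simp

lemma part_homogeneous_mult:
  fixes f :: "('v::finite, 'k::field) mpoly"
  assumes "\<forall>a\<in>supp f. tdeg a = s"
  shows "part (\<lambda>a. tdeg a = t) (f * h) = f * part (\<lambda>a. s + tdeg a = t) h"
proof -
  have "f * h = (\<Sum>a\<in>supp f. Poly_Mapping.single a (coef f a) * h)"
    by (subst (1) sum_single_expand[of f]) (rule sum_distrib_right)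
  then have "part (\<lambda>a. tdeg a = t) (f * h) =
      (\<Sum>a\<in>supp f. Poly_Mapping.single a (coef f a) * part (\<lambda>b. tdeg (a + b) = t) h)"
    by (simp only: part_sum part_single_mult)
  also have "\<dots> = (\<Sum>a\<in>supp f. Poly_Mapping.single a (coef f a) * part (\<lambda>b. s + tdeg b = t) h)"
    by (intro sum.cong refl) (use assms in simp)
  also have "\<dots> = f * part (\<lambda>a. s + tdeg a = t) h"
    by (subst (3) sum_single_expand[of f]) (rule sum_distrib_right[symmetric])
  finally show ?thesis .
qed

lemma homogeneous_adjoin:
  fixes P :: "('v::finite, 'k::field) mpoly set"
  assumes P: "homogeneous_ideal tdeg P" and f: "homogeneous tdeg f"
  shows "homogeneous_ideal tdeg (adjoin P f)"
  unfolding homogeneous_ideal_def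
proof (intro conjI ballI allI)
  note idealP = homogeneous_idealD(1)[OF P]
  show "ideal (adjoin P f)"
  proof (rule regular.subspaceI)
    show "0 \<in> adjoin P f" using adjoinI[OF regular.subspace_0[OF idealP], of f 0] by simp
  next
    fix x y assume "x \<in> adjoin P f" "y \<in> adjoin P f"
    then obtain p h q k where "x = p + f * h" "y = q + f * k" "p \<in> P" "q \<in> P"
      unfolding adjoin_def by blast
    then have "p + q \<in> P" "x + y = (p + q) + f * (h + k)"
      by (blast intro: regular.subspace_add[OF idealP], simp add: algebra_simps)
    then show "x + y \<in> adjoin P f" by (simp only: adjoinI)
  next
    fix c x assume "x \<in> adjoin P f"
    then obtain p h where "x = p + f * h" "p \<in> P" unfolding adjoin_def by blast
    then have "c * p \<in> P" "c * x = c * p + f * (c * h)"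
      by (blast intro: ideal_mult[OF idealP], simp only: distrib_left mult.left_commute)
    then show "c * x \<in> adjoin P f" by (simp only: adjoinI)
  qed
  fix x t assume "x \<in> adjoin P f"
  then obtain p h where x: "x = p + f * h" "p \<in> P" unfolding adjoin_def by blast
  obtain s where "\<forall>a\<in>supp f. tdeg a = s" using f unfolding homogeneous_def by blast
  then have "part (\<lambda>a. tdeg a = t) x = part (\<lambda>a. tdeg a = t) p + f * part (\<lambda>a. s + tdeg a = t) h"
    by (simp add: x(1) part_add part_homogeneous_mult)
  then show "part (\<lambda>a. tdeg a = t) x \<in> adjoin P f"
    using adjoinI[OF homogeneous_idealD(2)[OF P x(2)]] by simp
qed

text \<open>A homogeneous ideal that is maximal among those disjoint from the nonzero polynomials in
  \<open>F\<close> is prime: this is the graded form of the usual argument for multiplicative sets.\<close>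

lemma homogeneous_prime_over:
  fixes I :: "('v::finite, 'k::field) mpoly set"
  assumes I: "homogeneous_ideal tdeg I" "alg_indep F I"
  obtains P where "homogeneous_ideal tdeg P" "I \<subseteq> P" "alg_indep F P" "prime_ideal P"
proof -
  define \<A> where "\<A> = {J. homogeneous_ideal tdeg J \<and> I \<subseteq> J \<and> alg_indep F J}"
  have "\<exists>M\<in>\<A>. \<forall>X\<in>\<A>. M \<subseteq> X \<longrightarrow> X = M"
  proof (rule subset_Zorn_nonempty)
    show "\<A> \<noteq> {}" using I by (auto simp: \<A>_def)
    fix \<C> assume ne: "\<C> \<noteq> {}" and ch: "subset.chain \<A> \<C>"
    have mem: "homogeneous_ideal tdeg J" "I \<subseteq> J" "alg_indep F J" if "J \<in> \<C>" for J
      using ch that by (auto simp: subset_chain_def \<A>_def)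
    have total: "J \<subseteq> J' \<or> J' \<subseteq> J" if "J \<in> \<C>" "J' \<in> \<C>" for J J'
      using ch that by (auto simp: subset_chain_def)
    have "homogeneous_ideal tdeg (\<Union>\<C>)"
      unfolding homogeneous_ideal_def
    proof (intro conjI ballI allI)
      show "ideal (\<Union>\<C>)"
      proof (rule regular.subspaceI)
        obtain J where "J \<in> \<C>" using ne by blast
        then show "0 \<in> \<Union>\<C>"
          using regular.subspace_0[OF homogeneous_idealD(1)[OF mem(1)]] by blast
      next
        fix x y assume "x \<in> \<Union>\<C>" "y \<in> \<Union>\<C>"
        then obtain J' J'' where "J' \<in> \<C>" "x \<in> J'" "J'' \<in> \<C>" "y \<in> J''" by blast
        then obtain J where "J \<in> \<C>" "x \<in> J" "y \<in> J" using total[of J' J''] by blast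
        then show "x + y \<in> \<Union>\<C>"
          using regular.subspace_add[OF homogeneous_idealD(1)[OF mem(1)]] by blast
      next
        fix c x assume "x \<in> \<Union>\<C>"
        then show "c * x \<in> \<Union>\<C>" using ideal_mult[OF homogeneous_idealD(1)[OF mem(1)]] by blast
      qed
      fix f t assume "f \<in> \<Union>\<C>"
      then show "part (\<lambda>a. tdeg a = t) f \<in> \<Union>\<C>"
        using homogeneous_idealD(2)[OF mem(1)] by blast
    qed
    moreover have "I \<subseteq> \<Union>\<C>" using ne mem(2) by blast
    moreover have "alg_indep F (\<Union>\<C>)" using mem(3) unfolding alg_indep_def by blast
    ultimately show "\<Union>\<C> \<in> \<A>" by (simp add: \<A>_def)
  qed
  then obtain P where P: "homogeneous_ideal tdeg P" "I \<subseteq> P" "alg_indep F P"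
    and max: "\<And>J. homogeneous_ideal tdeg J \<Longrightarrow> P \<subseteq> J \<Longrightarrow> alg_indep F J \<Longrightarrow> J = P"
    unfolding \<A>_def by auto
  note idealP = homogeneous_idealD(1)[OF P(1)]
  have meets: "\<exists>k p h. k \<in> vars_ring F \<and> k \<noteq> 0 \<and> k = p + f * h \<and> p \<in> P"
    if "homogeneous tdeg f" "f \<notin> P" for f
  proof -
    have "adjoin P f \<noteq> P" using adjoin_mem[OF idealP, of f] that(2) by blast
    then have "\<not> alg_indep F (adjoin P f)"
      using max[OF homogeneous_adjoin[OF P(1) that(1)] adjoin_superset] by blast
    then show ?thesis unfolding alg_indep_def adjoin_def by blast
  qed
  have hom_prime: "f \<in> P \<or> g \<in> P" if fg: "homogeneous tdeg f" "homogeneous tdeg g" "f * g \<in> P" for f g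
  proof (rule ccontr)
    assume "\<not> (f \<in> P \<or> g \<in> P)"
    then obtain k p h k' p' h' where
      k: "k \<in> vars_ring F" "k \<noteq> 0" "k = p + f * h" "p \<in> P" and
      k': "k' \<in> vars_ring F" "k' \<noteq> 0" "k' = p' + g * h'" "p' \<in> P"
      using meets[OF fg(1)] meets[OF fg(2)] by blast
    have "(p + f * h) * (p' + g * h') = (p' + g * h') * p + ((f * h) * p' + (h * h') * (f * g))"
      by (simp add: distrib_left distrib_right mult_ac add_ac)
    then have "k * k' = k' * p + ((f * h) * p' + (h * h') * (f * g))"
      by (simp only: k(3)[symmetric] k'(3)[symmetric])
    also have "\<dots> \<in> P"
      using ideal_mult[OF idealP k(4), of k'] ideal_mult[OF idealP k'(4), of "f * h"]
        ideal_mult[OF idealP fg(3), of "h * h'"] by (simp only: regular.subspace_add[OF idealP])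
    finally have "k * k' = 0"
      using vars_ring_mult[OF k(1) k'(1)] P(3) unfolding alg_indep_def by blast
    then show False using mpoly_no_zero_divisors k(2) k'(2) by blast
  qed
  have "prime_ideal P"
    unfolding prime_ideal_def
  proof (intro conjI allI impI)
    have "mon 0 \<notin> P"
      using P(3) mon_nonzero[of 0] mon_in_vars_ring[of 0 F] unfolding alg_indep_def by auto
    then show "P \<noteq> UNIV" by blast
    fix f g assume "f * g \<in> P"
    show "f \<in> P \<or> g \<in> P"
    proof (rule prime_on_homogeneous[of "\<lambda>a. int (tdeg a)"])
      show "homogeneous_ideal (\<lambda>a. int (tdeg a)) P" using P(1) homogeneous_tdeg_int by blast
      fix f g :: "('v, 'k) mpoly"
      assume "homogeneous (\<lambda>a. int (tdeg a)) f" "homogeneous (\<lambda>a. int (tdeg a)) g" "f * g \<in> P"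
      moreover have "homogeneous tdeg x" if "homogeneous (\<lambda>a. int (tdeg a)) x" for x :: "('v, 'k) mpoly"
        using that unfolding homogeneous_def by (metis nat_int)
      ultimately show "f \<in> P \<or> g \<in> P" using hom_prime by blast
    qed (use \<open>f * g \<in> P\<close> in simp_all)
  qed (rule idealP)
  then show thesis using that P by blast
qed

section \<open>Growth of the standard monomials of an ideal\<close>

definition std_mon :: "('v::finite, 'k::field) mpoly set \<Rightarrow> ('v \<Rightarrow>\<^sub>0 nat) set" where
  "std_mon I = {a. (a, 0) \<in> regular.std I 1 (\<lambda>_. 1) (\<lambda>a _. tdeg a)}"

definition std_count :: "('v::finite, 'k::field) mpoly set \<Rightarrow> nat \<Rightarrow> nat" where
  "std_count I t = card {a \<in> std_mon I. tdeg a \<le> t}"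

lemma finite_std_le: "finite {a \<in> std_mon I. tdeg a \<le> t}"
  by (rule finite_subset[OF _ finite_tdeg_le[of t]]) auto

lemma std_count_mono: "s \<le> t \<Longrightarrow> std_count I s \<le> std_count I t"
  unfolding std_count_def by (rule card_mono[OF finite_std_le]) auto

lemma std_mon_order_ideal: "ideal I \<Longrightarrow> order_ideal (std_mon I)"
  unfolding std_mon_def by (rule regular.std_order_ideal) (auto intro: ideal_mult)

lemma rank_less: "rank (a, e) < rank (b, e) \<longleftrightarrow> wt a < wt b"
  by (simp add: rank_def less_poly_def pos_poly_pCons)

lemma std_mon_iff:
  fixes I :: "('v::finite, 'k::field) mpoly set"
  shows "a \<in> std_mon I \<longleftrightarrow> mon a \<notin> regular.K.span (I \<union> mon ` {b. tdeg b = tdeg a \<and> wt b < wt a})"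
proof -
  have "(\<lambda>(a, e). (mon a :: ('v, 'k) mpoly) * 1) ` {(a', e'). e' < (1::nat) \<and> tdeg a' = tdeg a \<and> rank (a', e') < rank (a, 0)} =
      mon ` {b. tdeg b = tdeg a \<and> wt b < wt a}" (is "?f ` ?X = mon ` ?Y")
  proof -
    have "?X = (\<lambda>b. (b, 0)) ` ?Y" by (auto simp: rank_less)
    then show ?thesis by (simp add: image_image)
  qed
  then show ?thesis
    unfolding std_mon_def regular.std_def by simp
qed

lemma mon_in_std_span:
  fixes I :: "('v::finite, 'k::field) mpoly set"
  assumes "tdeg a \<le> t"
  shows "mon a \<in> regular.K.span (I \<union> mon ` {a \<in> std_mon I. tdeg a \<le> t})"
proof -
  let ?f = "\<lambda>(a, e :: nat). (mon a :: ('v, 'k) mpoly) * 1"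
  let ?X = "{(b, e) \<in> regular.std I 1 (\<lambda>_. 1) (\<lambda>a _. tdeg a). tdeg b = tdeg a}"
  have fin: "finite {(b :: 'v \<Rightarrow>\<^sub>0 nat, e). e < (1::nat) \<and> tdeg b = tdeg a}"
    by (rule finite_subset[of _ "{b. tdeg b \<le> tdeg a} \<times> {0}"]) (auto intro: finite_tdeg_le)
  have span: "mon a * 1 \<in> regular.K.span (I \<union> ?f ` ?X)"
    by (rule regular.std_spanning[OF fin]) simp_all
  have "?f ` ?X \<subseteq> mon ` {a \<in> std_mon I. tdeg a \<le> t}"
  proof
    fix x assume "x \<in> ?f ` ?X"
    then obtain b e where x: "x = mon b" "(b, e) \<in> regular.std I 1 (\<lambda>_. 1) (\<lambda>a _. tdeg a)" "tdeg b = tdeg a"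
      by auto
    then have "e = 0" by (simp add: regular.std_def)
    then show "x \<in> mon ` {a \<in> std_mon I. tdeg a \<le> t}" using x assms by (simp add: std_mon_def)
  qed
  then have "regular.K.span (I \<union> ?f ` ?X) \<subseteq> regular.K.span (I \<union> mon ` {a \<in> std_mon I. tdeg a \<le> t})"
    by (intro regular.K.span_mono Un_mono order_refl)
  with span show ?thesis by (simp only: mult_1_right subsetD)
qed

text \<open>The leading monomial of a homogeneous element of the ideal is not standard.\<close>

lemma nonstandard_of_dependent:
  fixes I :: "('v::finite, 'k::field) mpoly set"
  assumes I: "homogeneous_ideal tdeg I" and dep: "\<not> alg_indep F I"
  shows "\<exists>a. a \<notin> std_mon I \<and> (\<forall>v. v \<notin> F \<longrightarrow> expo a v = 0)"
proof -
  obtain f where f: "f \<in> vars_ring F" "f \<in> I" "f \<noteq> 0"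
    using dep unfolding alg_indep_def by blast
  obtain a0 where a0: "a0 \<in> supp f"
    using f(3) sum_single_expand[of f] by (metis ex_in_conv sum.empty)
  define h where "h = part (\<lambda>a. tdeg a = tdeg a0) f"
  have h: "h \<in> I" "a0 \<in> supp h" "\<And>b. b \<in> supp h \<Longrightarrow> b \<in> supp f \<and> tdeg b = tdeg a0"
    using homogeneous_idealD(2)[OF I f(2)] a0 by (simp_all add: h_def supp_part)
  define m where "m = Max (wt ` supp h)"
  have "m \<in> wt ` supp h" unfolding m_def using h(2) by (intro Max_in) auto
  then obtain a where a: "a \<in> supp h" "wt a = m" by blast
  have smaller: "wt b < wt a" if "b \<in> supp h - {a}" for b
  proof -
    have "wt b \<le> wt a" unfolding a(2) m_def using that by (intro Max_ge) auto
    moreover have "wt b \<noteq> wt a" using that by (simp add: wt_inject)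
    ultimately show ?thesis by simp
  qed
  let ?S = "regular.K.span (I \<union> mon ` {b. tdeg b = tdeg a \<and> wt b < wt a})"
  have "h = mconst (coef h a) * mon a + (\<Sum>b\<in>supp h - {a}. mconst (coef h b) * mon b)"
    by (subst (1) mpoly_expand[of h]) (rule sum.remove[OF _ a(1)], simp)
  then have "mconst (coef h a) * mon a = h - (\<Sum>b\<in>supp h - {a}. mconst (coef h b) * mon b)"
    unfolding eq_diff_eq by (rule sym)
  also have "\<dots> \<in> ?S"
  proof (intro regular.K.span_diff regular.K.span_sum regular.K.span_scale)
    show "h \<in> ?S" using h(1) by (intro regular.K.span_base UnI1)
    fix b assume b: "b \<in> supp h - {a}"
    then have "tdeg b = tdeg a" using h(3)[of b] h(3)[OF a(1)] by simp
    then show "mon b \<in> ?S"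
      using smaller[OF b] by (intro regular.K.span_base UnI2 imageI) simp
  qed
  finally have "mconst (inverse (coef h a)) * (mconst (coef h a) * mon a) \<in> ?S"
    by (rule regular.K.span_scale)
  moreover have "mconst (inverse (coef h a)) * (mconst (coef h a) * mon a) = mon a"
    using a(1) by (simp add: in_keys_iff mult.assoc[symmetric] mconst_hom(4) flip: mconst_hom(2))
  ultimately have "a \<notin> std_mon I" by (simp add: std_mon_iff)
  then show ?thesis using h(3)[OF a(1)] f(1) by (auto simp: vars_ring_def)
qed

text \<open>An element with \<open>d\<close> large exponents would be divisible by one of the missing monomials. So all
  but fewer than \<open>d\<close> exponents are bounded, and the others are at most \<open>t\<close>.\<close>

lemma order_ideal_growth:
  fixes D :: "('v::finite \<Rightarrow>\<^sub>0 nat) set"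
  assumes D: "order_ideal D"
    and miss: "\<And>F. card F = d \<Longrightarrow> \<exists>a. a \<notin> D \<and> (\<forall>v. v \<notin> F \<longrightarrow> expo a v = 0)"
  shows "\<exists>C. \<forall>t. card {a \<in> D. tdeg a \<le> t} * Suc t \<le> C * Suc t ^ d"
proof -
  have "\<forall>F\<in>{F :: 'v set. card F = d}. \<exists>a. a \<notin> D \<and> (\<forall>v. v \<notin> F \<longrightarrow> expo a v = 0)"
    using miss by simp
  from bchoice[OF this] obtain u where
    u: "\<forall>F\<in>{F. card F = d}. u F \<notin> D \<and> (\<forall>v. v \<notin> F \<longrightarrow> expo (u F) v = 0)" ..
  (* no exponent of a missing monomial exceeds B *)
  define B where "B = (\<Sum>F\<in>{F :: 'v set. card F = d}. tdeg (u F))"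
  have B: "expo (u F) v \<le> B" if "card F = d" for F v
  proof -
    have "tdeg (u F) \<le> B" unfolding B_def by (rule member_le_sum) (use that in auto)
    then show ?thesis using expo_le_tdeg[of "u F" v] by simp
  qed
  define large where "large a = {v. B < expo a v}" for a :: "'v \<Rightarrow>\<^sub>0 nat"
  have few: "card (large a) < d" if "a \<in> D" for a
  proof (rule ccontr)
    assume "\<not> card (large a) < d"
    then obtain F where F: "F \<subseteq> large a" "card F = d"
      using obtain_subset_with_card_n[of d "large a"] by (metis not_less)
    have "expo (u F) v \<le> expo a v" for v
    proof (cases "v \<in> F")
      case True
      then have "B < expo a v" using F(1) by (auto simp: large_def)
      then show ?thesis using B[OF F(2), of v] by simp
    next
      case False
      then show ?thesis using u F(2) by simp
    qed
    then have "u F \<in> D" by (rule order_idealD[OF D that])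
    then show False using u F(2) by blast
  qed
  let ?n = "CARD('v)" and ?G = "{G :: 'v set. card G < d}"
  let ?box = "\<lambda>t G. {a :: 'v \<Rightarrow>\<^sub>0 nat. \<forall>v. expo a v \<le> (if v \<in> G then t else B)}"
  have box: "card (?box t G) * Suc t \<le> Suc B ^ ?n * Suc t ^ d" if "card G < d" for t G
  proof -
    have "card (?box t G) \<le> (\<Prod>v\<in>UNIV. Suc (if v \<in> G then t else B))"
      by (rule card_box(2))
    also have "\<dots> \<le> (\<Prod>v\<in>UNIV. Suc B * (if v \<in> G then Suc t else 1))"
      by (rule prod_mono) auto
    also have "\<dots> = Suc B ^ ?n * Suc t ^ card G"
      unfolding prod.distrib by (simp add: prod.If_cases)
    finally have "card (?box t G) * Suc t \<le> Suc B ^ ?n * Suc t ^ card G * Suc t"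
      by (rule mult_right_mono) simp
    also have "\<dots> = Suc B ^ ?n * Suc t ^ Suc (card G)" by (simp only: power_Suc2 mult.assoc)
    also have "\<dots> \<le> Suc B ^ ?n * Suc t ^ d"
      using that by (intro mult_left_mono power_increasing) auto
    finally show ?thesis .
  qed
  have "card {a \<in> D. tdeg a \<le> t} * Suc t \<le> (card ?G * Suc B ^ ?n) * Suc t ^ d" for t
  proof -
    have "{a \<in> D. tdeg a \<le> t} \<subseteq> (\<Union>G\<in>?G. ?box t G)"
    proof
      fix a assume "a \<in> {a \<in> D. tdeg a \<le> t}"
      then have a: "a \<in> D" "tdeg a \<le> t" by simp_all
      have "expo a v \<le> (if v \<in> large a then t else B)" for v
        using expo_le_tdeg[of a v] a(2) by (auto simp: large_def)
      then have "a \<in> ?box t (large a)" by blast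
      then show "a \<in> (\<Union>G\<in>?G. ?box t G)" using few[OF a(1)] by blast
    qed
    then have "card {a \<in> D. tdeg a \<le> t} \<le> card (\<Union>G\<in>?G. ?box t G)"
      by (rule card_mono[rotated]) (intro finite_UN_I card_box(1), simp)
    also have "\<dots> \<le> (\<Sum>G\<in>?G. card (?box t G))" by (rule card_UN_le) simp
    finally have "card {a \<in> D. tdeg a \<le> t} * Suc t \<le> (\<Sum>G\<in>?G. card (?box t G)) * Suc t"
      by (rule mult_right_mono) simp
    also have "\<dots> = (\<Sum>G\<in>?G. card (?box t G) * Suc t)" by (rule sum_distrib_right)
    also have "\<dots> \<le> (\<Sum>G\<in>?G. Suc B ^ ?n * Suc t ^ d)"
      by (rule sum_mono) (use box in blast)
    also have "\<dots> = (card ?G * Suc B ^ ?n) * Suc t ^ d" by simp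
    finally show ?thesis .
  qed
  then show ?thesis by blast
qed

lemma std_growth:
  fixes I :: "('v::finite, 'k::field) mpoly set"
  assumes I: "homogeneous_ideal tdeg I" and dep: "\<And>F. card F = d \<Longrightarrow> \<not> alg_indep F I"
  shows "\<exists>C. \<forall>t. std_count I t * Suc t \<le> C * Suc t ^ d"
  unfolding std_count_def
  by (rule order_ideal_growth[OF std_mon_order_ideal[OF homogeneous_idealD(1)[OF I]]])
    (rule nonstandard_of_dependent[OF I dep])

section \<open>Cutting by a variable lowers the growth by one\<close>

text \<open>Modulo \<open>P\<close>, polynomials of degree \<open>\<le> t\<close> are spanned by the standard monomials of \<open>P + (z)\<close>
  of degree \<open>\<le> t\<close> together with \<open>z\<close> times polynomials of degree \<open>< t\<close>.\<close>

lemma span_via_adjoin: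
  fixes P :: "('v::finite, 'k::field) mpoly set"
  assumes P: "homogeneous_ideal tdeg P"
  shows "\<exists>B. finite B \<and> card B \<le> (\<Sum>s<t. std_count (adjoin P (mvar z)) s) \<and>
    (\<forall>f. (\<forall>a\<in>supp f. tdeg a < t) \<longrightarrow> f \<in> regular.K.span (B \<union> P))"
proof (induct t)
  case 0
  have "f \<in> regular.K.span P" if "\<forall>a\<in>supp f. tdeg a < 0" for f :: "('v, 'k) mpoly"
  proof -
    have "f = 0" using that by (intro poly_mapping_eqI) (auto simp: in_keys_iff)
    then show ?thesis by (simp add: regular.K.span_zero)
  qed
  then show ?case by (intro exI[of _ "{}"]) simp
next
  case (Suc t)
  then obtain B where B: "finite B" "card B \<le> (\<Sum>s<t. std_count (adjoin P (mvar z)) s)"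
    and span: "\<And>f. (\<forall>a\<in>supp f. tdeg a < t) \<Longrightarrow> f \<in> regular.K.span (B \<union> P)" by blast
  note idealP = homogeneous_idealD(1)[OF P]
  let ?I = "adjoin P (mvar z)" and ?z = "Poly_Mapping.single z 1 :: 'v \<Rightarrow>\<^sub>0 nat"
  define M where "M = (mon :: _ \<Rightarrow> ('v, 'k) mpoly) ` {a \<in> std_mon ?I. tdeg a \<le> t}"
  define B' where "B' = M \<union> (\<lambda>b. mvar z * b) ` B"
  have finM: "finite M" unfolding M_def by (intro finite_imageI finite_std_le)
  have homI: "homogeneous_ideal tdeg ?I"
    by (rule homogeneous_adjoin[OF P]) (simp add: homogeneous_def mvar_eq_mon)
  have KI: "regular.K.subspace ?I" by (rule regular.subspace_imp_K[OF homogeneous_idealD(1)[OF homI]])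
  have "f \<in> regular.K.span (B' \<union> P)" if f: "\<forall>a\<in>supp f. tdeg a < Suc t" for f
  proof -
    have "f \<in> regular.K.span (?I \<union> M)"
    proof (rule deg_le_in_span)
      show "f \<in> deg_le t" using f by (auto simp: deg_le_def)
      show "mon a \<in> regular.K.span (?I \<union> M)" if "tdeg a \<le> t" for a
        unfolding M_def by (rule mon_in_std_span[OF that])
    qed
    then obtain q b where qb: "f = q + b" "q \<in> ?I" "b \<in> regular.K.span M"
      using regular.K.span_Un[of ?I M] regular.K.span_eq_iff[THEN iffD2, OF KI] by auto
    obtain p h where q: "q = p + mvar z * h" "p \<in> P" using qb(2) unfolding adjoin_def by blast
    let ?T = "\<lambda>a :: 'v \<Rightarrow>\<^sub>0 nat. tdeg a \<le> t"
    let ?X = "{x :: ('v, 'k) mpoly. part ?T x = x}"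
    have "regular.K.span M \<subseteq> ?X"
    proof (rule regular.K.span_minimal)
      show "M \<subseteq> ?X" unfolding M_def by (auto intro: part_eq_self)
      show "regular.K.subspace ?X"
      proof (rule regular.K.subspaceI)
        fix c :: 'k and x :: "('v, 'k) mpoly" assume "x \<in> ?X"
        then show "mconst c * x \<in> ?X" by (simp add: mconst_def part_single_mult)
      qed (simp_all add: part_add)
    qed
    then have partb: "part ?T b = b" using qb(3) by blast
    have "part ?T f = f" by (rule part_eq_self) (use f in auto)
    then have "f = part ?T p + mvar z * part (\<lambda>a. tdeg (?z + a) \<le> t) h + b"
      using arg_cong[OF qb(1), of "part ?T"]
      by (simp add: q(1) part_add partb mvar_def part_single_mult)
    moreover have "part ?T p \<in> P"
      using homogeneous_ideal_part[OF P q(2), of "{..t}"] by simp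
    then have "part ?T p \<in> regular.K.span (B' \<union> P)" by (intro regular.K.span_base UnI2)
    moreover have "b \<in> regular.K.span (B' \<union> P)"
      using qb(3) regular.K.span_mono[of M "B' \<union> P"] by (auto simp: B'_def)
    moreover have "mvar z * part (\<lambda>a. tdeg (?z + a) \<le> t) h \<in> regular.K.span (B' \<union> P)"
    proof (rule regular.scale_K_span)
      show "part (\<lambda>a. tdeg (?z + a) \<le> t) h \<in> regular.K.span (B \<union> P)"
        by (rule span) (auto simp: supp_part)
      fix x assume "x \<in> B \<union> P"
      then have "mvar z * x \<in> B' \<union> P" using ideal_mult[OF idealP] by (auto simp: B'_def)
      then show "mvar z * x \<in> regular.K.span (B' \<union> P)" by (rule regular.K.span_base)
    qed simp
    ultimately show ?thesis by (metis regular.K.span_add)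
  qed
  moreover have "finite B'" using finM B(1) by (simp add: B'_def)
  moreover have "card B' \<le> (\<Sum>s<Suc t. std_count ?I s)"
  proof -
    have "card B' \<le> card M + card ((\<lambda>b. mvar z * b) ` B)" unfolding B'_def by (rule card_Un_le)
    also have "\<dots> \<le> std_count ?I t + card B"
      unfolding M_def std_count_def by (intro add_mono card_image_le finite_std_le B(1))
    also have "\<dots> \<le> (\<Sum>s<Suc t. std_count ?I s)" using B(2) by simp
    finally show ?thesis .
  qed
  ultimately show ?case by blast
qed

text \<open>The monomials in the variables of \<open>F\<close> with exponents at most \<open>s\<close> are independent modulo \<open>P\<close>.\<close>

lemma alg_indep_growth:
  fixes P :: "('v::finite, 'k::field) mpoly set"
  assumes P: "ideal P" and F: "alg_indep F P" and B: "finite B"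
    and span: "\<And>f. (\<forall>a\<in>supp f. tdeg a < Suc (card F * s)) \<Longrightarrow> f \<in> regular.K.span (B \<union> P)"
  shows "Suc s ^ card F \<le> card B"
proof -
  let ?J = "\<Pi>\<^sub>E v\<in>F. {..s}"
  define a where "a \<phi> = (\<Sum>w\<in>F. Poly_Mapping.single w (\<phi> w :: nat))" for \<phi>
  have expo_a: "expo (a \<phi>) w = (if w \<in> F then \<phi> w else 0)" for \<phi> w
    by (simp add: a_def lookup_sum lookup_single when_def)
  have tdeg_a: "tdeg (a \<phi>) \<le> card F * s" if "\<phi> \<in> ?J" for \<phi>
  proof -
    have "tdeg (a \<phi>) = (\<Sum>w\<in>F. \<phi> w)"
      unfolding tdeg_def expo_a by (simp add: sum.If_cases)
    also have "\<dots> \<le> (\<Sum>w\<in>F. s)" using that by (intro sum_mono) (auto simp: PiE_def Pi_def)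
    finally show ?thesis by simp
  qed
  have inj: "\<phi> = \<psi>" if "\<phi> \<in> ?J" "\<psi> \<in> ?J" "a \<phi> = a \<psi>" for \<phi> \<psi>
  proof (rule PiE_ext[OF that(1,2)])
    fix w assume "w \<in> F"
    then show "\<phi> w = \<psi> w" using expo_a[of \<phi> w] expo_a[of \<psi> w] that(3) by simp
  qed
  have fin: "finite ?J" by (intro finite_PiE) simp_all
  have "card ?J \<le> card B"
  proof (rule regular.K.card_le_of_independent_mod[OF regular.subspace_imp_K[OF P] fin _ B])
    show "mon (a \<phi>) \<in> regular.K.span (B \<union> P)" if "\<phi> \<in> ?J" for \<phi>
      by (rule span) (use tdeg_a[OF that] in simp)
    fix c assume mem: "(\<Sum>\<phi>\<in>?J. mconst (c \<phi>) * mon (a \<phi>)) \<in> P" (is "?f \<in> P")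
    have lookup: "coef ?f (a \<psi>) = c \<psi>" if "\<psi> \<in> ?J" for \<psi>
    proof -
      have "coef ?f (a \<psi>) = (\<Sum>\<phi>\<in>?J. if \<phi> = \<psi> then c \<psi> else 0)"
        unfolding lookup_sum
        by (intro sum.cong refl) (use inj that in \<open>auto simp: mconst_mult_mon lookup_single when_def\<close>)
      then show ?thesis using that fin by simp
    qed
    have "?f \<in> vars_ring F"
      unfolding vars_ring_def
    proof (intro CollectI ballI allI impI)
      fix b v assume b: "b \<in> supp ?f" and v: "v \<notin> F"
      have "\<exists>\<phi>\<in>?J. b = a \<phi>"
      proof (rule ccontr)
        assume "\<not> (\<exists>\<phi>\<in>?J. b = a \<phi>)"
        then have "coef ?f b = 0"
          unfolding lookup_sum by (intro sum.neutral) (auto simp: mconst_mult_mon lookup_single when_def)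
        then show False using b by (simp add: in_keys_iff)
      qed
      then show "expo b v = 0" using v by (auto simp: expo_a)
    qed
    then have "?f = 0" using F mem unfolding alg_indep_def by blast
    then show "\<forall>\<phi>\<in>?J. c \<phi> = 0" using lookup by simp
  qed
  moreover have "card ?J = Suc s ^ card F" by (simp add: card_PiE)
  ultimately show ?thesis by simp
qed

text \<open>Otherwise \<open>span_via_adjoin\<close> bounds the growth of \<open>P\<close> by a multiple of \<open>t\<^sup>d\<close>, which is too small
  for \<open>d + 1\<close> independent variables.\<close>

lemma alg_indep_adjoin_var:
  fixes P :: "('v::finite, 'k::field) mpoly set"
  assumes P: "homogeneous_ideal tdeg P" and F: "alg_indep F P" "card F = Suc d"
  shows "\<exists>F'. card F' = d \<and> alg_indep F' (adjoin P (mvar z))"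
proof (rule ccontr)
  let ?I = "adjoin P (mvar z)"
  assume none: "\<not> (\<exists>F'. card F' = d \<and> alg_indep F' ?I)"
  have homI: "homogeneous_ideal tdeg ?I"
    by (rule homogeneous_adjoin[OF P]) (simp add: homogeneous_def mvar_eq_mon)
  obtain C where C: "\<And>t. std_count ?I t * Suc t \<le> C * Suc t ^ d"
    using std_growth[OF homI, of d] none by blast
  have "Suc s ^ Suc d \<le> (C * (Suc d + 2) ^ d) * Suc s ^ d" for s
  proof -
    define t where "t = Suc (card F * s)"
    obtain B where B: "finite B" "card B \<le> (\<Sum>s<t. std_count ?I s)"
      and span: "\<forall>f. (\<forall>a\<in>supp f. tdeg a < t) \<longrightarrow> f \<in> regular.K.span (B \<union> P)"
      using span_via_adjoin[OF P, of z t] by blast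
    have "Suc s ^ card F \<le> card B"
      by (rule alg_indep_growth[OF homogeneous_idealD(1)[OF P] F(1) B(1)]) (use span in \<open>simp add: t_def\<close>)
    also have "card B \<le> (\<Sum>s<t. std_count ?I s)" by (rule B(2))
    also have "\<dots> \<le> (\<Sum>s<t. std_count ?I t)" by (intro sum_mono std_count_mono) simp
    also have "\<dots> \<le> std_count ?I t * Suc t" by simp
    also have "\<dots> \<le> C * Suc t ^ d" by (rule C)
    (* t + 1 = (d + 1) s + 2 *)
    also have "\<dots> \<le> C * ((Suc d + 2) * Suc s) ^ d"
      by (intro mult_left_mono power_mono) (simp_all add: t_def F(2))
    finally show ?thesis by (simp only: F(2) power_mult_distrib mult.assoc)
  qed
  then show False by (rule power_growth_contradiction)
qed

section \<open>Krull dimension and growth\<close>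

text \<open>Alternately pass to a homogeneous prime and add a variable of the current independent set:
  the variable lies outside the prime, so the chain is strict, and the growth drops by at most one degree.\<close>

lemma prime_chain_of_alg_indep:
  fixes I :: "('v::finite, 'k::field) mpoly set"
  shows "homogeneous_ideal tdeg I \<Longrightarrow> alg_indep F I \<Longrightarrow> card F = d \<Longrightarrow>
    \<exists>P. (\<forall>i\<le>d. prime_ideal (P i) \<and> I \<subseteq> P i) \<and> (\<forall>i<d. P i \<subset> P (Suc i))"
proof (induct d arbitrary: I F)
  case 0
  obtain P where "I \<subseteq> P" "prime_ideal P"
    by (rule homogeneous_prime_over[OF 0(1,2)])
  then show ?case by (intro exI[of _ "\<lambda>_. P"]) simp
next
  case (Suc d)
  obtain P where P: "homogeneous_ideal tdeg P" "I \<subseteq> P" "alg_indep F P" "prime_ideal P"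
    by (rule homogeneous_prime_over[OF Suc.prems(1,2)])
  obtain z where z: "z \<in> F" using Suc.prems(3) by fastforce
  have "mvar z \<notin> P"
    using P(3) z mon_nonzero[of "Poly_Mapping.single z 1"] mon_in_vars_ring[of "Poly_Mapping.single z 1" F]
    unfolding alg_indep_def mvar_eq_mon by (auto simp: lookup_single when_def)
  let ?I = "adjoin P (mvar z)"
  have homI: "homogeneous_ideal tdeg ?I"
    by (rule homogeneous_adjoin[OF P(1)]) (simp add: homogeneous_def mvar_eq_mon)
  obtain F' where F': "card F' = d" "alg_indep F' ?I"
    using alg_indep_adjoin_var[OF P(1,3) Suc.prems(3), of z] by blast
  obtain Q where Q: "\<forall>i\<le>d. prime_ideal (Q i) \<and> ?I \<subseteq> Q i" "\<forall>i<d. Q i \<subset> Q (Suc i)"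
    using Suc.hyps[OF homI F'(2,1)] by blast
  define R where "R i = (case i of 0 \<Rightarrow> P | Suc j \<Rightarrow> Q j)" for i
  have "P \<subset> Q 0"
    using \<open>mvar z \<notin> P\<close> Q(1) adjoin_superset[of P "mvar z"] adjoin_mem[OF homogeneous_idealD(1)[OF P(1)], of "mvar z"]
    by blast
  have "prime_ideal (R i) \<and> I \<subseteq> R i" if "i \<le> Suc d" for i
  proof (cases i)
    case (Suc j)
    then have "prime_ideal (Q j) \<and> ?I \<subseteq> Q j" using Q(1) that by simp
    then show ?thesis using P(2) adjoin_superset[of P "mvar z"] Suc by (auto simp: R_def)
  qed (use P in \<open>simp add: R_def\<close>)
  moreover have "R i \<subset> R (Suc i)" if "i < Suc d" for i
  proof (cases i)
    case (Suc j)
    then show ?thesis using Q(2) that by (simp add: R_def)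
  qed (use \<open>P \<subset> Q 0\<close> in \<open>simp add: R_def\<close>)
  ultimately show ?case by blast
qed

lemma krull_dim_ge_of_alg_indep:
  fixes I :: "('v::finite, 'k::field) mpoly set"
  assumes "homogeneous_ideal tdeg I" "alg_indep F I"
  shows "ereal (real (card F)) \<le> krull_dim_quot I"
  unfolding krull_dim_quot_def
  by (rule Sup_upper) (use prime_chain_of_alg_indep[OF assms refl] in blast)

lemma std_count_growth_krull_dim:
  fixes I :: "('v::finite, 'k::field) mpoly set"
  assumes I: "homogeneous_ideal tdeg I" and dim: "krull_dim_quot I < ereal (real (Suc d))"
  shows "\<exists>C. \<forall>t. std_count I t \<le> C * Suc t ^ d"
proof -
  have "\<not> alg_indep F I" if "card F = Suc d" for F
    using krull_dim_ge_of_alg_indep[OF I, of F] dim that by auto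
  from std_growth[OF I this] obtain C where C: "\<And>t. std_count I t * Suc t \<le> C * Suc t ^ Suc d"
    by blast
  have "std_count I t \<le> C * Suc t ^ d" for t
  proof -
    have "std_count I t * Suc t \<le> (C * Suc t ^ d) * Suc t" using C[of t] by (simp only: power_Suc2 mult.assoc)
    then show ?thesis by (simp only: mult_le_cancel2)
  qed
  then show ?thesis by blast
qed

section \<open>Homogeneous components in a bigraded module\<close>

(* bidegrees are treated as single indices, not as pairs of integers *)
declare split_paired_All [simp del] split_paired_Ex [simp del]

sublocale bigraded_module \<subseteq> mpoly_module scale
  by unfold_locales

lemma qdeg_isl:
  fixes a :: "'x::finite + 'y::finite \<Rightarrow>\<^sub>0 nat"
  shows "qdeg isl a = (\<Sum>i\<in>UNIV. expo a (Inl i))"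
proof -
  have "{v :: 'x + 'y. isl v} = range Inl" by (auto simp: isl_def)
  then show ?thesis by (simp add: qdeg_def sum.reindex)
qed

lemma qdeg_not_isl:
  fixes a :: "'x::finite + 'y::finite \<Rightarrow>\<^sub>0 nat"
  shows "qdeg (\<lambda>v. \<not> isl v) a = (\<Sum>j\<in>UNIV. expo a (Inr j))"
proof -
  have "{v :: 'x + 'y. \<not> isl v} = range Inr"
  proof (rule set_eqI)
    fix v :: "'x + 'y" show "v \<in> {v. \<not> isl v} \<longleftrightarrow> v \<in> range Inr" by (cases v) auto
  qed
  then show ?thesis by (simp add: qdeg_def sum.reindex)
qed

lemma bideg_qdeg:
  "bideg p a = (int (qdeg isl a) + int p * int (qdeg (\<lambda>v. \<not> isl v) a), int (qdeg (\<lambda>v. \<not> isl v) a))"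
  by (simp add: bideg_def qdeg_isl qdeg_not_isl Let_def)

lemma bideg_add: "bideg p (a + b) = bideg p a + bideg p b"
  by (simp add: bideg_qdeg algebra_simps)

lemma tdeg_bideg: "int (tdeg a) = fst (bideg p a) - int p * snd (bideg p a) + snd (bideg p a)"
  by (simp add: bideg_qdeg tdeg_split[of a isl])

lemma finite_bideg: "finite {a. bideg p a = d}"
proof (rule finite_subset[OF _ finite_tdeg_le])
  show "{a. bideg p a = d} \<subseteq> {a. tdeg a \<le> nat (fst d - int p * snd d + snd d)}"
  proof
    fix a assume "a \<in> {a. bideg p a = d}"
    then show "a \<in> {a. tdeg a \<le> nat (fst d - int p * snd d + snd d)}"
      using tdeg_bideg[of a p] by simp
  qed
qed

context bigraded_module
begin

lemma gr_subspace: "K.subspace (gr d)"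
  by (rule component)

lemma gr_0: "0 \<in> gr d"
  by (rule K.subspace_0[OF gr_subspace])

lemma mon_gr: "w \<in> gr d \<Longrightarrow> scale (mon a) w \<in> gr (bideg p a + d)"
proof -
  assume w: "w \<in> gr d"
  have "bihomogeneous p (fst (bideg p a), snd (bideg p a)) (mon a :: ('x + 'y, 'k) mpoly)"
    by (simp add: bihomogeneous_def)
  from graded[OF this, of w "fst d" "snd d"] w
  show ?thesis by (simp add: plus_prod_def)
qed

definition decomposition :: "'m \<Rightarrow> (int \<times> int \<Rightarrow> 'm) \<Rightarrow> bool" where
  "decomposition w u \<longleftrightarrow> (\<forall>d. u d \<in> gr d) \<and> (\<exists>I. finite I \<and> (\<forall>d. d \<notin> I \<longrightarrow> u d = 0) \<and> w = (\<Sum>d\<in>I. u d))"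

text \<open>The projection onto \<open>gr d\<close>; the decomposition that it picks is unique.\<close>

definition comp :: "int \<times> int \<Rightarrow> 'm \<Rightarrow> 'm" where
  "comp d w = (SOME u. decomposition w u) d"

lemma decomposition_exists: "\<exists>u. decomposition w u"
proof -
  have "w \<in> internal_sum gr" using total by simp
  then obtain I u where u: "w = (\<Sum>d\<in>I. u d)" "finite I" "\<forall>d\<in>I. u d \<in> gr d"
    unfolding internal_sum_def by blast
  have "decomposition w (\<lambda>d. if d \<in> I then u d else 0)"
    unfolding decomposition_def
    by (intro conjI exI[of _ I] allI) (use u gr_0 in simp_all)
  then show ?thesis by blast
qed

lemma decomposition_unique:
  assumes "decomposition w u" "decomposition w u'"
  shows "u = u'"
proof
  fix d
  obtain I where I: "finite I" "\<forall>d. d \<notin> I \<longrightarrow> u d = 0" "w = (\<Sum>d\<in>I. u d)"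
    using assms(1) unfolding decomposition_def by blast
  obtain I' where I': "finite I'" "\<forall>d. d \<notin> I' \<longrightarrow> u' d = 0" "w = (\<Sum>d\<in>I'. u' d)"
    using assms(2) unfolding decomposition_def by blast
  let ?U = "insert d (I \<union> I')"
  have "w = (\<Sum>d\<in>?U. u d)"
    unfolding I(3) by (rule sum.mono_neutral_left) (use I I' in auto)
  moreover have "w = (\<Sum>d\<in>?U. u' d)"
    unfolding I'(3) by (rule sum.mono_neutral_left) (use I I' in auto)
  ultimately have "(\<Sum>d\<in>?U. u d - u' d) = 0" by (simp add: sum_subtractf)
  moreover have "\<forall>d\<in>?U. u d - u' d \<in> gr d"
  proof
    fix d
    have "u d \<in> gr d" "u' d \<in> gr d" using assms unfolding decomposition_def by simp_all
    then show "u d - u' d \<in> gr d" by (rule K.subspace_diff[OF gr_subspace])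
  qed
  moreover have "finite ?U" using I(1) I'(1) by simp
  ultimately have "\<forall>d\<in>?U. u d - u' d = 0"
    using spec[OF spec[OF direct[unfolded independent_family_def], of ?U], of "\<lambda>d. u d - u' d"]
    by (elim impE)
  then show "u d = u' d" by simp
qed

lemma decomposition_comp: "decomposition w (\<lambda>d. comp d w)"
  using someI_ex[OF decomposition_exists[of w]] by (simp add: comp_def)

lemma comp_in_gr: "comp d w \<in> gr d"
  using decomposition_comp[of w] by (simp add: decomposition_def)

lemma comp_expand: "\<exists>I. finite I \<and> w = (\<Sum>d\<in>I. comp d w)"
  using decomposition_comp[of w] unfolding decomposition_def by blast

lemma comp_add: "comp d (v + w) = comp d v + comp d w"
proof -
  obtain I where I: "finite I" "\<forall>d. d \<notin> I \<longrightarrow> comp d v = 0" "v = (\<Sum>d\<in>I. comp d v)"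
    using decomposition_comp[of v] unfolding decomposition_def by blast
  obtain I' where I': "finite I'" "\<forall>d. d \<notin> I' \<longrightarrow> comp d w = 0" "w = (\<Sum>d\<in>I'. comp d w)"
    using decomposition_comp[of w] unfolding decomposition_def by blast
  have "v = (\<Sum>d\<in>I \<union> I'. comp d v)"
    by (subst (1) I(3), rule sum.mono_neutral_left) (use I I' in auto)
  moreover have "w = (\<Sum>d\<in>I \<union> I'. comp d w)"
    by (subst (1) I'(3), rule sum.mono_neutral_left) (use I I' in auto)
  ultimately have "v + w = (\<Sum>d\<in>I \<union> I'. comp d v + comp d w)"
    unfolding sum.distrib by (rule arg_cong2)
  moreover have "comp d v + comp d w \<in> gr d" for d
    by (intro K.subspace_add[OF gr_subspace] comp_in_gr)
  ultimately have "decomposition (v + w) (\<lambda>d. comp d v + comp d w)"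
    unfolding decomposition_def using I(1,2) I'(1,2) by (intro conjI exI[of _ "I \<union> I'"]) simp_all
  from fun_cong[OF decomposition_unique[OF decomposition_comp this], of d] show ?thesis .
qed

lemma comp_of_gr: "w \<in> gr d \<Longrightarrow> comp e w = (if e = d then w else 0)"
proof -
  assume "w \<in> gr d"
  then have "decomposition w (\<lambda>e. if e = d then w else 0)"
    unfolding decomposition_def using gr_0 by (intro conjI exI[of _ "{d}"]) auto
  from fun_cong[OF decomposition_unique[OF decomposition_comp this], of e] show ?thesis .
qed

lemma comp_0: "comp d 0 = 0"
  using comp_add[of d 0 0] by simp

lemma comp_sum: "comp d (\<Sum>a\<in>A. f a) = (\<Sum>a\<in>A. comp d (f a))"
  by (induct A rule: infinite_finite_induct) (auto simp: comp_0 comp_add)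

lemma comp_mon: "comp (bideg p a + d) (scale (mon a) w) = scale (mon a) (comp d w)"
proof -
  obtain u where u: "decomposition w u" using decomposition_exists by blast
  have uc: "u = (\<lambda>d. comp d w)" by (rule decomposition_unique[OF u decomposition_comp])
  obtain I where I: "finite I" "\<forall>d. d \<notin> I \<longrightarrow> comp d w = 0" "w = (\<Sum>d\<in>I. comp d w)"
    using u unfolding decomposition_def uc by blast
  have "comp (bideg p a + d) (scale (mon a) w) =
      (\<Sum>e\<in>I. comp (bideg p a + d) (scale (mon a) (comp e w)))"
    by (subst (1) I(3)) (simp only: scale_sum_right comp_sum)
  also have "\<dots> = (\<Sum>e\<in>I. if e = d then scale (mon a) (comp d w) else 0)"
    by (intro sum.cong refl) (auto simp: comp_of_gr[OF mon_gr[OF comp_in_gr]])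
  also have "\<dots> = scale (mon a) (comp d w)"
    using I(1,2) by simp
  finally show ?thesis .
qed

lemma comp_const: "comp d (scale (mconst c) w) = scale (mconst c) (comp d w)"
proof -
  obtain I where I: "finite I" "\<forall>d. d \<notin> I \<longrightarrow> comp d w = 0" "w = (\<Sum>d\<in>I. comp d w)"
    using decomposition_comp[of w] unfolding decomposition_def by blast
  have "scale (mconst c) w = (\<Sum>d\<in>I. scale (mconst c) (comp d w))"
    by (subst (1) I(3)) (rule scale_sum_right)
  then have "decomposition (scale (mconst c) w) (\<lambda>d. scale (mconst c) (comp d w))"
    unfolding decomposition_def using I(1,2) K.subspace_scale[OF gr_subspace comp_in_gr]
    by (intro conjI exI[of _ I]) simp_all
  from fun_cong[OF decomposition_unique[OF decomposition_comp this], of d] show ?thesis .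
qed

lemma comp_in_K_span:
  assumes w: "w \<in> K.span B" and B: "\<And>b. b \<in> B \<Longrightarrow> comp d b \<in> T" and T: "K.subspace T"
  shows "comp d w \<in> T"
proof -
  have "K.span B \<subseteq> {w. comp d w \<in> T}"
  proof (rule K.span_minimal)
    show "K.subspace {w. comp d w \<in> T}"
      by (rule K.subspaceI)
        (simp_all add: comp_0 comp_add comp_const K.subspace_0[OF T] K.subspace_add[OF T] K.subspace_scale[OF T])
  qed (use B in blast)
  then show ?thesis using w by blast
qed

lemma homogeneous_generators:
  assumes "fin_gen scale"
  obtains r g dg where "\<And>e. e < r \<Longrightarrow> g e \<in> gr (dg e)" "span (g ` {..<(r::nat)}) = UNIV"
proof -
  obtain B where B: "finite B" "span B = UNIV" using assms unfolding fin_gen_def by blast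
  have "\<forall>b. \<exists>I. finite I \<and> b = (\<Sum>d\<in>I. comp d b)" using comp_expand by blast
  from choice[OF this] obtain I where I: "\<forall>b. finite (I b) \<and> b = (\<Sum>d\<in>I b. comp d b)" ..
  define G where "G = (\<Union>b\<in>B. (\<lambda>d. comp d b) ` I b)"
  have "finite G" unfolding G_def using B(1) I by simp
  then obtain r :: nat and g where g: "G = g ` {i. i < r}"
    using finite_imp_nat_seg_image_inj_on by blast
  have "\<forall>e. \<exists>d. e < r \<longrightarrow> g e \<in> gr d"
  proof
    fix e
    show "\<exists>d. e < r \<longrightarrow> g e \<in> gr d"
    proof (cases "e < r")
      case True
      then have "g e \<in> G" using g by blast
      then obtain b d where "g e = comp d b" unfolding G_def by blast
      then have "g e \<in> gr d" using comp_in_gr by simp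
      then show ?thesis by blast
    qed simp
  qed
  from choice[OF this] obtain dg where dg: "\<forall>e. e < r \<longrightarrow> g e \<in> gr (dg e)" ..
  have "b \<in> span G" if "b \<in> B" for b
  proof -
    have "(\<Sum>d\<in>I b. comp d b) \<in> span G"
      by (intro span_sum span_base) (use that in \<open>auto simp: G_def\<close>)
    then show ?thesis using I by metis
  qed
  then have "span B \<subseteq> span G" by (intro span_minimal) auto
  then have "UNIV \<subseteq> span (g ` {..<r})" unfolding B(2) g lessThan_def .
  then have "span (g ` {..<r}) = UNIV" by (rule top.extremum_uniqueI)
  then show thesis using that dg by blast
qed

end

section \<open>The Hilbert function of a bigraded module\<close>

locale generated_bigraded_module = bigraded_module scale p gr
  for scale :: "('x::finite + 'y::finite, 'k::field) mpoly \<Rightarrow> 'm::ab_group_add \<Rightarrow> 'm"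
    and p :: nat and gr :: "int \<times> int \<Rightarrow> 'm set" +
  fixes r :: nat and g :: "nat \<Rightarrow> 'm" and dg :: "nat \<Rightarrow> int \<times> int"
  assumes g_gr: "e < r \<Longrightarrow> g e \<in> gr (dg e)" and g_span: "span (g ` {..<r}) = UNIV"
begin

definition term_of :: "('x + 'y \<Rightarrow>\<^sub>0 nat) \<times> nat \<Rightarrow> 'm" where
  "term_of = (\<lambda>(a, e). scale (mon a) (g e))"

definition terms :: "int \<times> int \<Rightarrow> (('x + 'y \<Rightarrow>\<^sub>0 nat) \<times> nat) set" where
  "terms d = {(a, e). e < r \<and> bideg p a + dg e = d}"

lemma termsD: "(a, e) \<in> terms d \<Longrightarrow> e < r" "(a, e) \<in> terms d \<Longrightarrow> bideg p a + dg e = d"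
  by (simp_all add: terms_def)

lemma finite_terms: "finite (terms d)"
proof (rule finite_subset)
  show "terms d \<subseteq> (\<Union>e<r. {a. bideg p a = d - dg e} \<times> {e})"
    by (auto simp: terms_def algebra_simps)
qed (simp add: finite_bideg)

lemma term_gr: "x \<in> terms d \<Longrightarrow> term_of x \<in> gr d"
proof -
  assume "x \<in> terms d"
  then obtain a e where x: "x = (a, e)" "e < r" "bideg p a + dg e = d" by (auto simp: terms_def)
  then show ?thesis using mon_gr[OF g_gr[OF x(2)], of a] by (simp add: term_of_def)
qed

lemma gr_eq_span: "gr d = K.span (term_of ` terms d)"
proof
  show "K.span (term_of ` terms d) \<subseteq> gr d"
    by (rule K.span_minimal[OF _ gr_subspace]) (use term_gr in blast)
  let ?X = "term_of ` {(a, e). e < r}"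
  have "subspace (K.span ?X)"
  proof (rule subspaceI)
    fix f w assume "w \<in> K.span ?X"
    then show "scale f w \<in> K.span ?X"
    proof (rule scale_K_span)
      fix x assume "x \<in> ?X"
      then obtain a e where x: "x = scale (mon a) (g e)" "e < r" by (auto simp: term_of_def)
      show "scale f x \<in> K.span ?X"
      proof (rule scale_in_K_span)
        fix b
        have "scale (mon b) x = term_of (b + a, e)" by (simp add: x(1) term_of_def mon_mult)
        then show "scale (mon b) x \<in> K.span ?X" using x(2) by (intro K.span_base) auto
      qed
    qed simp
  qed (simp_all add: K.span_zero K.span_add)
  moreover have "g ` {..<r} \<subseteq> K.span ?X"
  proof (rule image_subsetI)
    fix e assume "e \<in> {..<r}"
    then have "term_of (0, e) \<in> ?X" by blast
    then show "g e \<in> K.span ?X" using K.span_base[of "term_of (0, e)" ?X] by (simp add: term_of_def mon_0)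
  qed
  ultimately have all: "w \<in> K.span ?X" for w
    using span_minimal[of "g ` {..<r}" "K.span ?X"] g_span by blast
  show "gr d \<subseteq> K.span (term_of ` terms d)"
  proof
    fix w assume w: "w \<in> gr d"
    have "comp d w \<in> K.span (term_of ` terms d)"
    proof (rule comp_in_K_span[OF all])
      fix x assume "x \<in> ?X"
      then obtain a e where x: "x = term_of (a, e)" "e < r" by auto
      then have mem: "(a, e) \<in> terms (bideg p a + dg e)" by (simp add: terms_def)
      show "comp d x \<in> K.span (term_of ` terms d)"
      proof (cases "d = bideg p a + dg e")
        case True
        then show ?thesis using mem by (simp add: x(1) comp_of_gr[OF term_gr[OF mem]] K.span_base)
      next
        case False
        then show ?thesis by (simp add: x(1) comp_of_gr[OF term_gr[OF mem]] K.span_zero)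
      qed
    qed simp
    then show "w \<in> K.span (term_of ` terms d)" by (simp add: comp_of_gr[OF w])
  qed
qed

text \<open>The Hilbert function in the grading by \<open>(i - p k, k)\<close>, for which all variables have degree
  \<open>(1, 0)\<close> or \<open>(0, 1)\<close>; the generator \<open>g e\<close> then has degree \<open>(gu e, gk e)\<close>.\<close>

definition hf :: "int \<Rightarrow> int \<Rightarrow> nat" where
  "hf u k = K.dim (gr (u + int p * k, k))"

definition gu :: "nat \<Rightarrow> int" where
  "gu e = fst (dg e) - int p * snd (dg e)"

definition gk :: "nat \<Rightarrow> int" where
  "gk e = snd (dg e)"

lemma terms_shifted:
  "(a, e) \<in> terms (u + int p * k, k) \<longleftrightarrow>
    e < r \<and> int (qdeg isl a) = u - gu e \<and> int (qdeg (\<lambda>v. \<not> isl v) a) = k - gk e"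
proof -
  have "bideg p a + dg e = (u + int p * k, k) \<longleftrightarrow>
      int (qdeg isl a) + int p * int (qdeg (\<lambda>v. \<not> isl v) a) + fst (dg e) = u + int p * k \<and>
      int (qdeg (\<lambda>v. \<not> isl v) a) + snd (dg e) = k"
    by (cases "dg e") (simp add: bideg_qdeg)
  also have "\<dots> \<longleftrightarrow> int (qdeg isl a) = u - gu e \<and> int (qdeg (\<lambda>v. \<not> isl v) a) = k - gk e"
    by (auto simp: gu_def gk_def algebra_simps)
  finally show ?thesis by (simp add: terms_def)
qed

text \<open>In each bidegree the standard monomials form a basis, so \<open>hf\<close> counts the elements of one order
  ideal for each generator.\<close>

lemma bisep_hf: "bisep (\<lambda>u k. of_nat (hf u k))"
proof -
  let ?std = "std {} r g (\<lambda>a e. bideg p a + dg e)"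
  define D where "D e = {a. (a, e) \<in> ?std}" for e
  have D: "order_ideal (D e)" for e
    unfolding D_def
  proof (rule std_order_ideal)
    fix a a' c :: "'x + 'y \<Rightarrow>\<^sub>0 nat" and e e' :: nat
    assume "bideg p a + dg e = bideg p a' + dg e'"
    then have "(bideg p a + dg e) + bideg p c = (bideg p a' + dg e') + bideg p c" by simp
    then show "bideg p (a + c) + dg e = bideg p (a' + c) + dg e'"
      by (simp only: bideg_add add_ac)
  qed simp
  have "hf u k = (\<Sum>e<r. mcount isl (D e) (u - gu e) (k - gk e))" for u k
  proof -
    let ?d = "(u + int p * k, k)"
    let ?L = "\<lambda>e. {a \<in> D e. int (qdeg isl a) = u - gu e \<and> int (qdeg (\<lambda>v. \<not> isl v) a) = k - gk e}"
    have "hf u k = card {(a, e) \<in> ?std. bideg p a + dg e = ?d}"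
      unfolding hf_def gr_eq_span term_of_def terms_def
      by (rule std_dim) (use finite_terms[of ?d] in \<open>simp add: terms_def\<close>)
    also have "{(a, e) \<in> ?std. bideg p a + dg e = ?d} = (\<Union>e<r. (\<lambda>a. (a, e)) ` ?L e)"
    proof (rule set_eqI)
      fix x :: "('x + 'y \<Rightarrow>\<^sub>0 nat) \<times> nat"
      obtain a e where x: "x = (a, e)" by (cases x)
      have "e < r" if "(a, e) \<in> ?std" using that by (simp add: std_def)
      then have "x \<in> {(a, e) \<in> ?std. bideg p a + dg e = ?d} \<longleftrightarrow> (a, e) \<in> ?std \<and> (a, e) \<in> terms ?d"
        by (auto simp: x terms_def)
      also have "\<dots> \<longleftrightarrow> e < r \<and> a \<in> ?L e" unfolding terms_shifted by (auto simp: D_def)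
      also have "\<dots> \<longleftrightarrow> x \<in> (\<Union>e<r. (\<lambda>a. (a, e)) ` ?L e)" by (auto simp: x)
      finally show "x \<in> {(a, e) \<in> ?std. bideg p a + dg e = ?d} \<longleftrightarrow> x \<in> (\<Union>e<r. (\<lambda>a. (a, e)) ` ?L e)" .
    qed
    also have "card \<dots> = (\<Sum>e<r. card ((\<lambda>a. (a, e)) ` ?L e))"
      by (rule card_UN_disjoint) (auto simp: finite_mcount)
    also have "\<dots> = (\<Sum>e<r. mcount isl (D e) (u - gu e) (k - gk e))"
      by (intro sum.cong refl) (simp add: card_image inj_on_def mcount_def)
    finally show ?thesis .
  qed
  then have eq: "(\<lambda>u k. of_nat (hf u k)) = (\<lambda>u k. \<Sum>e<r. rat_of_nat (mcount isl (D e) (u - gu e) (k - gk e)))"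
    by (intro ext) simp
  show ?thesis
    unfolding eq by (rule bisep_sum) (rule bisep_shift[OF bisep_mcount[OF D]])
qed

end

section \<open>Restriction of scalars to \<open>S\<close>\<close>

lemma push_keys_superset:
  assumes "finite S" "supp f \<subseteq> S"
  shows "push_keys h f = (\<Sum>a\<in>S. Poly_Mapping.single (h a) (Poly_Mapping.lookup f a))"
  unfolding push_keys_def using assms by (intro sum.mono_neutral_left) (auto simp: in_keys_iff)

lemma push_keys_add: "push_keys h (f + g) = push_keys h f + push_keys h g"
proof -
  have fin: "finite (supp f \<union> supp g)" by simp
  have "push_keys h (f + g) =
      (\<Sum>a\<in>supp f \<union> supp g. Poly_Mapping.single (h a) (Poly_Mapping.lookup f a + Poly_Mapping.lookup g a))"
    using push_keys_superset[OF fin, of "f + g" h] Poly_Mapping.keys_add[of f g] by (simp add: lookup_add)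
  also have "\<dots> = push_keys h f + push_keys h g"
    using push_keys_superset[OF fin, of f h] push_keys_superset[OF fin, of g h]
    by (simp add: single_add sum.distrib)
  finally show ?thesis .
qed

lemma push_keys_single: "push_keys h (Poly_Mapping.single a c) = Poly_Mapping.single (h a) c"
  by (simp add: push_keys_def)

lemma push_keys_0: "push_keys h 0 = 0"
  by (simp add: push_keys_def)

lemma push_keys_sum: "push_keys h (\<Sum>a\<in>A. f a) = (\<Sum>a\<in>A. push_keys h (f a))"
  by (induct A rule: infinite_finite_induct) (simp_all add: push_keys_0 push_keys_add)

lemma lookup_push_keys:
  "Poly_Mapping.lookup (push_keys h f) k = (\<Sum>a\<in>supp f. if h a = k then Poly_Mapping.lookup f a else 0)"
  by (simp add: push_keys_def lookup_sum lookup_single when_def)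

lemma lookup_push_keys_inj:
  assumes "inj h"
  shows "Poly_Mapping.lookup (push_keys h f) (h a) = Poly_Mapping.lookup f a"
proof -
  have "Poly_Mapping.lookup (push_keys h f) (h a) = (\<Sum>b\<in>supp f. if b = a then Poly_Mapping.lookup f a else 0)"
    unfolding lookup_push_keys by (intro sum.cong refl) (use assms in \<open>auto simp: inj_eq\<close>)
  then show ?thesis by (simp add: in_keys_iff)
qed

lemma lookup_push_keys_outside: "k \<notin> range h \<Longrightarrow> Poly_Mapping.lookup (push_keys h f) k = 0"
  unfolding lookup_push_keys by (intro sum.neutral) auto

definition inl :: "('x \<Rightarrow>\<^sub>0 nat) \<Rightarrow> ('x + 'y \<Rightarrow>\<^sub>0 nat)" where
  "inl = push_keys Inl"

definition inr :: "('y \<Rightarrow>\<^sub>0 nat) \<Rightarrow> ('x + 'y \<Rightarrow>\<^sub>0 nat)" where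
  "inr = push_keys Inr"

lemma expo_inl [simp]: "expo (inl a) (Inl i) = expo a i" "expo (inl a) (Inr j) = 0"
proof -
  show "expo (inl a) (Inl i) = expo a i" unfolding inl_def by (rule lookup_push_keys_inj) simp
  show "expo (inl a) (Inr j) = 0" unfolding inl_def by (rule lookup_push_keys_outside) auto
qed

lemma expo_inr [simp]: "expo (inr b) (Inl i) = 0" "expo (inr b) (Inr j) = expo b j"
proof -
  show "expo (inr b) (Inr j) = expo b j" unfolding inr_def by (rule lookup_push_keys_inj) simp
  show "expo (inr b) (Inl i) = 0" unfolding inr_def by (rule lookup_push_keys_outside) auto
qed

lemma qdeg_inl:
  fixes a :: "'x::finite \<Rightarrow>\<^sub>0 nat"
  shows "qdeg isl (inl a :: 'x + 'y::finite \<Rightarrow>\<^sub>0 nat) = tdeg a"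
    "qdeg (\<lambda>v. \<not> isl v) (inl a :: 'x + 'y \<Rightarrow>\<^sub>0 nat) = 0"
  by (simp_all add: qdeg_isl qdeg_not_isl tdeg_def)

lemma qdeg_inr:
  fixes b :: "'y::finite \<Rightarrow>\<^sub>0 nat"
  shows "qdeg isl (inr b :: 'x::finite + 'y \<Rightarrow>\<^sub>0 nat) = 0"
    "qdeg (\<lambda>v. \<not> isl v) (inr b :: 'x + 'y \<Rightarrow>\<^sub>0 nat) = tdeg b"
  by (simp_all add: qdeg_isl qdeg_not_isl tdeg_def)

lemma tdeg_inl [simp]: "tdeg (inl a :: 'x::finite + 'y::finite \<Rightarrow>\<^sub>0 nat) = tdeg a"
  by (simp add: tdeg_split[of "inl a :: 'x + 'y \<Rightarrow>\<^sub>0 nat" isl] qdeg_inl)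

lemma split_monomial:
  fixes c :: "'x::finite + 'y::finite \<Rightarrow>\<^sub>0 nat"
  shows "\<exists>a b. c = inl a + inr b"
proof (intro exI)
  let ?a = "\<Sum>i\<in>UNIV. Poly_Mapping.single i (expo c (Inl i))"
  let ?b = "\<Sum>j\<in>UNIV. Poly_Mapping.single j (expo c (Inr j))"
  show "c = inl ?a + inr ?b"
  proof (rule poly_mapping_eqI)
    fix v :: "'x + 'y"
    show "expo c v = expo (inl ?a + inr ?b) v"
      by (cases v) (simp_all add: lookup_add lookup_sum lookup_single when_def)
  qed
qed

lemma incl_eq: "incl = push_keys inl"
  by (simp add: incl_def inl_def)

lemma incl_add: "incl (f + g) = incl f + incl g"
  by (simp add: incl_eq push_keys_add)

lemma incl_sum: "incl (\<Sum>a\<in>A. f a) = (\<Sum>a\<in>A. incl (f a))"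
  by (simp add: incl_eq push_keys_sum)

lemma incl_single: "incl (Poly_Mapping.single a c) = Poly_Mapping.single (inl a) c"
  by (simp add: incl_eq push_keys_single)

lemma incl_mon: "incl (mon a) = mon (inl a)"
  by (simp add: mon_def incl_single)

lemma incl_mconst: "incl (mconst c) = mconst c"
  by (simp add: mconst_def incl_single inl_def push_keys_0)

lemma incl_mult: "incl (f * g) = incl f * incl g"
proof -
  let ?S = "\<lambda>f a. Poly_Mapping.single a (coef f a)"
  have "f * g = (\<Sum>a\<in>supp f. ?S f a) * (\<Sum>b\<in>supp g. ?S g b)"
    by (simp only: sum_single_expand[symmetric])
  also have "\<dots> = (\<Sum>a\<in>supp f. \<Sum>b\<in>supp g. Poly_Mapping.single (a + b) (coef f a * coef g b))"
    by (simp only: sum_product mult_single)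
  finally have "incl (f * g) =
      (\<Sum>a\<in>supp f. \<Sum>b\<in>supp g. Poly_Mapping.single (inl a + inl b) (coef f a * coef g b))"
    by (simp only: incl_sum incl_single inl_def push_keys_add)
  also have "\<dots> = (\<Sum>a\<in>supp f. incl (?S f a)) * (\<Sum>b\<in>supp g. incl (?S g b))"
    by (simp only: sum_product mult_single incl_single)
  also have "\<dots> = incl f * incl g"
    by (simp only: incl_sum[symmetric] sum_single_expand[symmetric])
  finally show ?thesis .
qed

lemma incl_part:
  fixes f :: "('x::finite, 'k::field) mpoly"
  shows "part (\<lambda>a. tdeg a = t) (incl f :: ('x + 'y::finite, 'k) mpoly) = incl (part (\<lambda>a. tdeg a = t) f)"
proof -
  have "(incl f :: ('x + 'y, 'k) mpoly) = (\<Sum>a\<in>supp f. Poly_Mapping.single (inl a) (coef f a))"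
    by (simp add: incl_eq push_keys_def)
  then have "part (\<lambda>a. tdeg a = t) (incl f :: ('x + 'y, 'k) mpoly) =
      (\<Sum>a\<in>supp f. if tdeg a = t then Poly_Mapping.single (inl a) (coef f a) else 0)"
    by (simp only: part_sum part_single tdeg_inl)
  also have "\<dots> = (\<Sum>a\<in>supp f. incl (if tdeg a = t then Poly_Mapping.single a (coef f a) else 0))"
    by (intro sum.cong refl) (simp add: incl_single, simp add: incl_eq push_keys_0)
  finally show ?thesis by (simp only: part_expand incl_sum)
qed

sublocale bigraded_module \<subseteq> S: mpoly_module "restrict_S scale"
  by unfold_locales
    (simp_all add: restrict_S_def scale_right_distrib incl_add scale_left_distrib incl_mult
      incl_mconst mconst_hom flip: mconst_hom(4))

context bigraded_module
begin

lemma restrict_S_mconst: "restrict_S scale (mconst c) = scale (mconst c)"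
  by (simp add: restrict_S_def incl_mconst)

section \<open>Annihilators are homogeneous\<close>

text \<open>For homogeneous \<open>w\<close>, a homogeneous part of \<open>f\<close> acts on \<open>w\<close> as a sum of components of \<open>f w\<close>,
  because the bidegree of a monomial determines its total degree.\<close>

lemma scale_part_as_components:
  assumes w: "w \<in> gr d"
  shows "\<exists>E. finite E \<and> scale (part (\<lambda>a. tdeg a = t) f) w = (\<Sum>e\<in>E. comp e (scale f w))"
proof -
  define E where "E = (\<lambda>a. bideg p a + d) ` {a \<in> supp f. tdeg a = t}"
  define m where "m a = scale (mconst (coef f a)) (scale (mon a) w)" for a
  have m_gr: "m a \<in> gr (bideg p a + d)" for a
    unfolding m_def by (rule K.subspace_scale[OF gr_subspace mon_gr[OF w]])
  have in_E: "bideg p a + d \<in> E \<longleftrightarrow> tdeg a = t" if "a \<in> supp f" for a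
  proof
    assume "bideg p a + d \<in> E"
    then obtain b :: "'x + 'y \<Rightarrow>\<^sub>0 nat" where "bideg p a = bideg p b" "tdeg b = t"
      unfolding E_def by auto
    then show "tdeg a = t" using tdeg_bideg[of a p] tdeg_bideg[of b p] by simp
  qed (use that in \<open>auto simp: E_def\<close>)
  have "comp e (scale f w) = (\<Sum>a\<in>supp f. if e = bideg p a + d then m a else 0)" for e
    by (subst scale_expand) (simp only: m_def[symmetric] comp_sum comp_of_gr[OF m_gr])
  then have "(\<Sum>e\<in>E. comp e (scale f w)) = (\<Sum>a\<in>supp f. \<Sum>e\<in>E. if e = bideg p a + d then m a else 0)"
    by (simp only: sum.swap[of _ E])
  also have "\<dots> = (\<Sum>a\<in>supp f. if tdeg a = t then m a else 0)"
    by (intro sum.cong refl) (simp add: in_E E_def[THEN arg_cong[where f = finite]])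
  also have "\<dots> = scale (part (\<lambda>a. tdeg a = t) f) w"
  proof -
    have "scale (part (\<lambda>a. tdeg a = t) f) w =
        (\<Sum>a\<in>supp f. scale (if tdeg a = t then Poly_Mapping.single a (coef f a) else 0) w)"
      unfolding part_expand by (rule scale_sum_left)
    also have "\<dots> = (\<Sum>a\<in>supp f. if tdeg a = t then m a else 0)"
      by (intro sum.cong refl) (simp add: m_def mconst_mult_mon)
    finally show ?thesis by simp
  qed
  finally show ?thesis by (intro exI[of _ E]) (simp add: E_def)
qed

lemma scale_part_mem:
  assumes N: "\<And>e v. v \<in> N \<Longrightarrow> comp e v \<in> N" "0 \<in> N" "\<And>v v'. v \<in> N \<Longrightarrow> v' \<in> N \<Longrightarrow> v + v' \<in> N"
    and w: "w \<in> gr d" and f: "scale f w \<in> N"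
  shows "scale (part (\<lambda>a. tdeg a = t) f) w \<in> N"
proof -
  obtain E where E: "finite E" "scale (part (\<lambda>a. tdeg a = t) f) w = (\<Sum>e\<in>E. comp e (scale f w))"
    using scale_part_as_components[OF w] by blast
  have "(\<Sum>e\<in>E. comp e (scale f w)) \<in> N"
    using E(1) by induct (simp_all add: N(1)[OF f] N(2,3))
  then show ?thesis by (simp only: E(2))
qed

section \<open>The fibre \<open>M/\<mm>M\<close>\<close>

abbreviation xvar :: "'x \<Rightarrow> ('x + 'y, 'k) mpoly" where
  "xvar i \<equiv> mon (Poly_Mapping.single (Inl i) 1)"

text \<open>Elements of \<open>\<mm>M\<close> are written as combinations of the \<open>x\<^sub>i\<close>, which makes it easy to take homogeneous
  components.\<close>

definition mM :: "'m set" where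
  "mM = {\<Sum>i\<in>UNIV. scale (xvar i) (v i) | v. True}"

lemma mM_I: "(\<Sum>i\<in>UNIV. scale (xvar i) (v i)) \<in> mM"
  unfolding mM_def by blast

lemma mM_E:
  assumes "w \<in> mM"
  obtains v where "w = (\<Sum>i\<in>UNIV. scale (xvar i) (v i))"
  using assms unfolding mM_def by blast

lemma mM_xvar: "scale (xvar i) w \<in> mM"
proof -
  have "(\<Sum>j\<in>UNIV. scale (xvar j) (if j = i then w else 0)) = (\<Sum>j\<in>UNIV. if j = i then scale (xvar i) w else 0)"
    by (intro sum.cong refl) simp
  then show ?thesis using mM_I[of "\<lambda>j. if j = i then w else 0"] by simp
qed

lemma mM_subspace: "subspace mM"
proof (rule subspaceI)
  show "0 \<in> mM" using mM_I[of "\<lambda>_. 0"] by simp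
next
  fix x y assume "x \<in> mM" "y \<in> mM"
  obtain v where v: "x = (\<Sum>i\<in>UNIV. scale (xvar i) (v i))" by (rule mM_E[OF \<open>x \<in> mM\<close>])
  obtain v' where v': "y = (\<Sum>i\<in>UNIV. scale (xvar i) (v' i))" by (rule mM_E[OF \<open>y \<in> mM\<close>])
  show "x + y \<in> mM"
    using mM_I[of "\<lambda>i. v i + v' i"] by (simp only: v v' scale_right_distrib sum.distrib)
next
  fix f x assume "x \<in> mM"
  obtain v where v: "x = (\<Sum>i\<in>UNIV. scale (xvar i) (v i))" by (rule mM_E[OF \<open>x \<in> mM\<close>])
  have "scale f x = (\<Sum>i\<in>UNIV. scale (xvar i) (scale f (v i)))"
    unfolding v scale_sum_right by (intro sum.cong refl scale_left_commute)
  then show "scale f x \<in> mM" using mM_I[of "\<lambda>i. scale f (v i)"] by simp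
qed

lemma bideg_xvar: "bideg p (Poly_Mapping.single (Inl i) 1 :: 'x + 'y \<Rightarrow>\<^sub>0 nat) = (1, 0)"
  by (simp add: bideg_qdeg)

lemma comp_xvar: "comp d (scale (xvar i) w) = scale (xvar i) (comp (d - (1, 0)) w)"
  using comp_mon[of "Poly_Mapping.single (Inl i) 1" "d - (1, 0)" w] unfolding bideg_xvar by simp

lemma comp_mM: "comp d (\<Sum>i\<in>UNIV. scale (xvar i) (v i)) = (\<Sum>i\<in>UNIV. scale (xvar i) (comp (d - (1, 0)) (v i)))"
  by (simp only: comp_sum comp_xvar)

lemma ideal_times_irrelevant: "ideal_times (restrict_S scale) irrelevant_ideal UNIV = mM"
proof
  let ?X = "{restrict_S scale a w | a w. a \<in> irrelevant_ideal \<and> w \<in> UNIV}"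
  have restrict_mvar: "restrict_S scale (mvar i) = scale (xvar i)" for i
    by (simp add: restrict_S_def mvar_eq_mon incl_mon inl_def push_keys_single)
  have "irrelevant_ideal \<subseteq> {a. \<forall>w. restrict_S scale a w \<in> mM}"
    unfolding irrelevant_ideal_def
  proof (rule regular.span_minimal)
    show "range mvar \<subseteq> {a. \<forall>w. restrict_S scale a w \<in> mM}"
      using mM_xvar by (auto simp: restrict_mvar)
    show "ideal {a. \<forall>w. restrict_S scale a w \<in> mM}"
    proof (rule regular.subspaceI)
      fix c x assume x: "x \<in> {a. \<forall>w. restrict_S scale a w \<in> mM}"
      have "restrict_S scale (c * x) w = scale (incl c) (restrict_S scale x w)" for w
        by (simp add: restrict_S_def incl_mult)
      then show "c * x \<in> {a. \<forall>w. restrict_S scale a w \<in> mM}"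
        using x subspace_scale[OF mM_subspace] by simp
    qed (simp_all add: S.scale_left_distrib subspace_add[OF mM_subspace] subspace_0[OF mM_subspace])
  qed
  then have "?X \<subseteq> mM" by blast
  moreover have "S.subspace mM"
    by (rule S.subspaceI)
      (simp_all add: restrict_S_def subspace_0[OF mM_subspace] subspace_add[OF mM_subspace]
        subspace_scale[OF mM_subspace])
  ultimately show "ideal_times (restrict_S scale) irrelevant_ideal UNIV \<subseteq> mM"
    unfolding ideal_times_def by (rule S.span_minimal)
  show "mM \<subseteq> ideal_times (restrict_S scale) irrelevant_ideal UNIV"
  proof
    fix w assume "w \<in> mM"
    obtain v where v: "w = (\<Sum>i\<in>UNIV. scale (xvar i) (v i))" by (rule mM_E[OF \<open>w \<in> mM\<close>])
    have "restrict_S scale (mvar i) (v i) \<in> ?X" for i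
      unfolding irrelevant_ideal_def using regular.span_base[of "mvar i" "range mvar"] by blast
    then show "w \<in> ideal_times (restrict_S scale) irrelevant_ideal UNIV"
      unfolding ideal_times_def v restrict_mvar by (intro S.span_sum S.span_base)
  qed
qed

text \<open>The annihilator of \<open>M/\<mm>M\<close>.\<close>

definition fibre_ideal :: "('x + 'y, 'k) mpoly set" where
  "fibre_ideal = {a. \<forall>w. scale a w \<in> mM}"

lemma fibre_dim_eq: "fibre_dim scale = krull_dim_quot fibre_ideal"
  by (simp add: fibre_dim_def krull_dim_def annihilator_def ideal_times_irrelevant fibre_ideal_def)

lemma homogeneous_fibre_ideal: "homogeneous_ideal tdeg fibre_ideal"
  unfolding homogeneous_ideal_def
proof (intro conjI ballI allI)
  show "ideal fibre_ideal"
  proof (rule regular.subspaceI)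
    fix c x assume "x \<in> fibre_ideal"
    then show "c * x \<in> fibre_ideal"
      using subspace_scale[OF mM_subspace] by (simp add: fibre_ideal_def flip: scale_scale)
  qed (simp_all add: fibre_ideal_def scale_left_distrib subspace_add[OF mM_subspace] subspace_0[OF mM_subspace])
  fix f t assume f: "f \<in> fibre_ideal"
  have N: "comp e v \<in> mM" if v: "v \<in> mM" for e v
  proof -
    obtain u where "v = (\<Sum>i\<in>UNIV. scale (xvar i) (u i))" by (rule mM_E[OF v])
    then show ?thesis using mM_I[of "\<lambda>i. comp (e - (1, 0)) (u i)"] by (simp only: comp_mM)
  qed
  have "scale (part (\<lambda>a. tdeg a = t) f) w \<in> mM" for w
  proof -
    obtain I where I: "w = (\<Sum>d\<in>I. comp d w)" using comp_expand by blast
    have "scale (part (\<lambda>a. tdeg a = t) f) (comp d w) \<in> mM" for d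
    proof (rule scale_part_mem[OF N _ _ comp_in_gr])
      show "scale f (comp d w) \<in> mM" using f by (simp add: fibre_ideal_def)
    qed (simp_all add: subspace_add[OF mM_subspace] subspace_0[OF mM_subspace])
    then have "(\<Sum>d\<in>I. scale (part (\<lambda>a. tdeg a = t) f) (comp d w)) \<in> mM"
      by (intro subspace_sum[OF mM_subspace])
    then show ?thesis by (subst I) (simp only: scale_sum_right)
  qed
  then show "part (\<lambda>a. tdeg a = t) f \<in> fibre_ideal" by (simp add: fibre_ideal_def)
qed

section \<open>Dimensions of finitely many components\<close>

text \<open>Bases of different components are disjoint, and their union is independent.\<close>

lemma sum_dim_le_card:
  assumes D: "finite D" and Z: "finite Z" and sub: "\<And>d. d \<in> D \<Longrightarrow> gr d \<subseteq> K.span Z"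
  shows "(\<Sum>d\<in>D. K.dim (gr d)) \<le> card Z"
proof -
  have "\<forall>d. \<exists>B. B \<subseteq> gr d \<and> K.independent B \<and> gr d \<subseteq> K.span B \<and> card B = K.dim (gr d)"
    using K.basis_exists by (metis (no_types, lifting))
  from choice[OF this] obtain B where
    B: "\<forall>d. B d \<subseteq> gr d \<and> K.independent (B d) \<and> gr d \<subseteq> K.span (B d) \<and> card (B d) = K.dim (gr d)" ..
  have finB: "finite (B d)" if "d \<in> D" for d
    using K.independent_span_bound[OF Z, of "B d"] B sub[OF that] by blast
  have comp_B: "comp e b = (if e = d then b else 0)" if "b \<in> B d" for e d b
    by (rule comp_of_gr) (use B that in blast)
  have nonzero: "b \<noteq> 0" if "b \<in> B d" for b d
    using B that K.dependent_zero by blast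
  have disj: "B d \<inter> B e = {}" if "d \<noteq> e" for d e
  proof (rule ccontr)
    assume "B d \<inter> B e \<noteq> {}"
    then obtain b where b: "b \<in> B d" "b \<in> B e" by blast
    have "b = 0" using comp_B[OF b(1), of d] comp_B[OF b(2), of d] that by simp
    then show False using nonzero[OF b(1)] by simp
  qed
  let ?U = "\<Union>d\<in>D. B d"
  have finU: "finite ?U" using D finB by simp
  have "\<forall>b\<in>?U. c b = 0" if zero: "(\<Sum>b\<in>?U. scale (mconst (c b)) b) = 0" for c
  proof
    fix b assume "b \<in> ?U"
    then obtain d where d: "d \<in> D" "b \<in> B d" by blast
    have "0 = comp d (\<Sum>b\<in>?U. scale (mconst (c b)) b)" by (simp add: zero comp_0)
    also have "\<dots> = (\<Sum>b\<in>?U. if b \<in> B d then scale (mconst (c b)) b else 0)"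
      unfolding comp_sum comp_const
    proof (intro sum.cong refl)
      fix b' assume "b' \<in> ?U"
      then obtain d' where d': "b' \<in> B d'" by blast
      show "scale (mconst (c b')) (comp d b') = (if b' \<in> B d then scale (mconst (c b')) b' else 0)"
        using comp_B[OF d', of d] disj[of d d'] d' by (cases "d = d'") auto
    qed
    also have "\<dots> = (\<Sum>b\<in>B d. scale (mconst (c b)) b)"
      by (rule sum.mono_neutral_cong_right[OF finU]) (use d in auto)
    finally have "(\<Sum>b\<in>B d. scale (mconst (c b)) b) = 0" by simp
    moreover have "K.independent (B d)" using B by blast
    ultimately show "c b = 0" using K.independentD[of "B d" "B d" c b] finB[OF d(1)] d(2) by simp
  qed
  from K.independent_family[OF finU, of "\<lambda>b. b", OF this] have "K.independent ?U" by simp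
  moreover have "?U \<subseteq> K.span Z" using B sub by blast
  ultimately have "card ?U \<le> card Z" using K.independent_span_bound[OF Z] by blast
  also have "card ?U = (\<Sum>d\<in>D. card (B d))"
    by (rule card_UN_disjoint) (use D finB disj in auto)
  finally show ?thesis using B by simp
qed

end

section \<open>Growth in a fixed \<open>x\<close>-degree\<close>

context generated_bigraded_module
begin

text \<open>A lower bound for the \<open>x\<close>-degrees of the generators, and so of all nonzero components.\<close>

definition u_min :: int where
  "u_min = - (\<Sum>e<r. \<bar>gu e\<bar>)"

lemma u_min_le: "e < r \<Longrightarrow> u_min \<le> gu e"
proof -
  assume "e < r"
  then have "\<bar>gu e\<bar> \<le> (\<Sum>e<r. \<bar>gu e\<bar>)" by (intro member_le_sum) auto
  then show ?thesis unfolding u_min_def by linarith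
qed

lemma terms_below:
  assumes "u < u_min"
  shows "terms (u + int p * k, k) = {}"
proof (rule ccontr)
  assume "terms (u + int p * k, k) \<noteq> {}"
  then obtain a e where "(a, e) \<in> terms (u + int p * k, k)" by (metis ex_in_conv surj_pair)
  then have "e < r" "int (qdeg isl a) = u - gu e" unfolding terms_shifted by simp_all
  then show False using u_min_le[of e] assms by linarith
qed

text \<open>Components of bounded \<open>x\<close>-degree grow in \<open>k\<close> no faster than the fibre: modulo \<open>\<mm>M\<close> they are
  spanned by the standard monomials of the annihilator of the fibre, and \<open>\<mm>M\<close> is reached from
  \<open>x\<close>-degree one less.\<close>

lemma fibre_growth_step:
  assumes C: "\<And>t. std_count fibre_ideal t \<le> C * Suc t ^ l"
    and IH: "\<And>t. \<exists>Z. finite Z \<and> card Z \<le> C' * Suc t ^ l \<and> (\<forall>k\<le>int t. gr (u - 1 + int p * k, k) \<subseteq> K.span Z)"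
  shows "\<exists>C. \<forall>t. \<exists>Z. finite Z \<and> card Z \<le> C * Suc t ^ l \<and> (\<forall>k\<le>int t. gr (u + int p * k, k) \<subseteq> K.span Z)"
proof -
  (* monomials that occur in components with k \<le> t have total degree at most t + b *)
  define b where "b = (\<Sum>e<r. nat (\<bar>u - gu e\<bar> + \<bar>gk e\<bar>))"
  have b: "int (tdeg a) \<le> int (t + b)" if "(a, e) \<in> terms (u + int p * k, k)" "k \<le> int t" for a e k t
  proof -
    have e: "e < r" and deg: "int (tdeg a) = (u - gu e) + (k - gk e)"
      using that(1) unfolding terms_shifted by (simp_all add: tdeg_split[of a isl])
    have "nat (\<bar>u - gu e\<bar> + \<bar>gk e\<bar>) \<le> b"
      unfolding b_def by (rule member_le_sum) (use e in auto)
    then show ?thesis using deg that(2) by linarith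
  qed
  let ?n = "CARD('x)"
  have "\<exists>Z. finite Z \<and> card Z \<le> (C * Suc b ^ l * r + ?n * C') * Suc t ^ l \<and>
      (\<forall>k\<le>int t. gr (u + int p * k, k) \<subseteq> K.span Z)" for t
  proof -
    obtain Z' where Z': "finite Z'" "card Z' \<le> C' * Suc t ^ l"
      "\<forall>k\<le>int t. gr (u - 1 + int p * k, k) \<subseteq> K.span Z'"
      using IH by blast
    define T where "T = {a \<in> std_mon fibre_ideal. tdeg a \<le> t + b}"
    define Z where "Z = term_of ` (T \<times> {..<r}) \<union> (\<lambda>(i, z). scale (xvar i) z) ` (UNIV \<times> Z')"
    have finT: "finite T" unfolding T_def by (rule finite_std_le)
    have "finite Z" unfolding Z_def using finT Z'(1) by simp
    moreover have "card Z \<le> (C * Suc b ^ l * r + ?n * C') * Suc t ^ l"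
    proof -
      have "card T \<le> C * Suc (t + b) ^ l"
        using C[of "t + b"] by (simp add: T_def std_count_def)
      also have "\<dots> \<le> C * (Suc b * Suc t) ^ l"
        by (intro mult_left_mono power_mono) simp_all
      finally have T: "card T \<le> C * Suc b ^ l * Suc t ^ l"
        by (simp only: power_mult_distrib mult.assoc)
      have "card Z \<le> card (term_of ` (T \<times> {..<r})) + card ((\<lambda>(i, z). scale (xvar i) z) ` (UNIV \<times> Z'))"
        unfolding Z_def by (rule card_Un_le)
      also have "\<dots> \<le> card (T \<times> {..<r}) + card ((UNIV :: 'x set) \<times> Z')"
        using finT Z'(1) by (intro add_mono card_image_le) simp_all
      also have "\<dots> = card T * r + ?n * card Z'" by (simp add: card_cartesian_product)
      also have "\<dots> \<le> (C * Suc b ^ l * Suc t ^ l) * r + ?n * (C' * Suc t ^ l)"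
        by (intro add_mono mult_right_mono mult_left_mono T Z'(2)) simp_all
      also have "\<dots> = (C * Suc b ^ l * r + ?n * C') * Suc t ^ l"
        by (simp only: distrib_right distrib_left mult_ac)
      finally show ?thesis .
    qed
    moreover have "gr (u + int p * k, k) \<subseteq> K.span Z" if k: "k \<le> int t" for k
    proof -
      let ?d = "(u + int p * k, k)"
      have "term_of x \<in> K.span Z" if x: "x \<in> terms ?d" for x
      proof -
        obtain a e where ae: "x = (a, e)" by (cases x)
        have ter: "(a, e) \<in> terms ?d" using x ae by simp
        have e: "e < r" by (rule termsD(1)[OF ter])
        have "tdeg a \<le> t + b" using b[OF ter k] by simp
        then have a: "mon a \<in> regular.K.span (fibre_ideal \<union> mon ` T)"
          unfolding T_def by (rule mon_in_std_span)
        have "regular.K.span (fibre_ideal \<union> mon ` T) \<subseteq> {y. comp ?d (scale y (g e)) \<in> K.span Z}"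
        proof (rule regular.K.span_minimal)
          show "regular.K.subspace {y. comp ?d (scale y (g e)) \<in> K.span Z}"
          proof (rule regular.K.subspaceI)
            fix c y assume "y \<in> {y. comp ?d (scale y (g e)) \<in> K.span Z}"
            then have "scale (mconst c) (comp ?d (scale y (g e))) \<in> K.span Z"
              using K.span_scale by blast
            then show "mconst c * y \<in> {y. comp ?d (scale y (g e)) \<in> K.span Z}"
              by (simp only: comp_const[symmetric] scale_scale mem_Collect_eq)
          qed (simp_all add: comp_0 K.span_zero scale_left_distrib comp_add K.span_add)
          show "fibre_ideal \<union> mon ` T \<subseteq> {y. comp ?d (scale y (g e)) \<in> K.span Z}"
          proof
            fix y assume "y \<in> fibre_ideal \<union> mon ` T"
            then show "y \<in> {y. comp ?d (scale y (g e)) \<in> K.span Z}"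
            proof
              assume "y \<in> fibre_ideal"
              then have "scale y (g e) \<in> mM" by (simp add: fibre_ideal_def)
              then obtain v where v: "scale y (g e) = (\<Sum>i\<in>UNIV. scale (xvar i) (v i))" by (rule mM_E)
              have "scale (xvar i) (comp (?d - (1, 0)) (v i)) \<in> K.span Z" for i
              proof (rule scale_K_span)
                have "comp (?d - (1, 0)) (v i) \<in> gr (u - 1 + int p * k, k)"
                  using comp_in_gr[of "?d - (1, 0)" "v i"] by (simp add: algebra_simps)
                then show "comp (?d - (1, 0)) (v i) \<in> K.span Z'" using Z'(3) k by blast
                fix z assume "z \<in> Z'"
                then have "scale (xvar i) z \<in> Z" unfolding Z_def by force
                then show "scale (xvar i) z \<in> K.span Z" by (rule K.span_base)
              qed simp
              then show ?thesis unfolding mem_Collect_eq v comp_mM by (intro K.span_sum)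
            next
              assume "y \<in> mon ` T"
              then obtain a' where a': "y = mon a'" "a' \<in> T" by blast
              have ter': "(a', e) \<in> terms (bideg p a' + dg e)" using e by (simp add: terms_def)
              have "term_of (a', e) \<in> Z" using a'(2) e by (simp add: Z_def)
              then have "comp ?d (term_of (a', e)) \<in> K.span Z"
                using comp_of_gr[OF term_gr[OF ter'], of ?d] by (simp add: K.span_zero K.span_base)
              then show ?thesis by (simp add: a'(1) term_of_def)
            qed
          qed
        qed
        then have "comp ?d (term_of x) \<in> K.span Z" using a by (auto simp: ae term_of_def)
        then show ?thesis by (simp add: comp_of_gr[OF term_gr[OF x]])
      qed
      then show ?thesis unfolding gr_eq_span by (intro K.span_minimal) auto
    qed
    ultimately show ?thesis by blast
  qed
  then show ?thesis by blast
qed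

text \<open>Components of very negative \<open>x\<close>-degree vanish, which starts the induction on \<open>u\<close>.\<close>

lemma fibre_growth:
  assumes "krull_dim_quot fibre_ideal < ereal (real (Suc l))"
  shows "\<exists>C. \<forall>t. \<exists>Z. finite Z \<and> card Z \<le> C * Suc t ^ l \<and> (\<forall>k\<le>int t. gr (u + int p * k, k) \<subseteq> K.span Z)"
proof -
  obtain C where C: "\<And>t. std_count fibre_ideal t \<le> C * Suc t ^ l"
    using std_count_growth_krull_dim[OF homogeneous_fibre_ideal assms] by blast
  have empty: "\<exists>C. \<forall>t. \<exists>Z. finite Z \<and> card Z \<le> C * Suc t ^ l \<and> (\<forall>k\<le>int t. gr (u + int p * k, k) \<subseteq> K.span Z)"
    if "u < u_min" for u
    by (intro exI[of _ 0] allI exI[of _ "{}"]) (use that in \<open>simp add: gr_eq_span terms_below\<close>)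
  have "\<exists>C. \<forall>t. \<exists>Z. finite Z \<and> card Z \<le> C * Suc t ^ l \<and> (\<forall>k\<le>int t. gr (u + int p * k, k) \<subseteq> K.span Z)"
    if "u \<ge> u_min - 1" for u
    using that
  proof (induct u rule: int_ge_induct)
    case base
    show ?case by (rule empty) simp
  next
    case (step i)
    then obtain C' where C': "\<And>t. \<exists>Z. finite Z \<and> card Z \<le> C' * Suc t ^ l \<and>
        (\<forall>k\<le>int t. gr (i + int p * k, k) \<subseteq> K.span Z)" by blast
    show ?case
      by (rule fibre_growth_step[OF C]) (use C' in simp)
  qed
  then show ?thesis using empty by (cases "u < u_min") simp_all
qed

lemma sum_hf_le:
  assumes "krull_dim_quot fibre_ideal < ereal (real (Suc l))"
  shows "\<exists>C. \<forall>t::nat. (\<Sum>k\<in>{lo..int t}. hf u k) \<le> C * Suc t ^ l"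
proof -
  obtain C where C: "\<And>t. \<exists>Z. finite Z \<and> card Z \<le> C * Suc t ^ l \<and> (\<forall>k\<le>int t. gr (u + int p * k, k) \<subseteq> K.span Z)"
    using fibre_growth[OF assms, of u] by blast
  have "(\<Sum>k\<in>{lo..int t}. hf u k) \<le> C * Suc t ^ l" for t
  proof -
    obtain Z where Z: "finite Z" "card Z \<le> C * Suc t ^ l" "\<forall>k\<le>int t. gr (u + int p * k, k) \<subseteq> K.span Z"
      using C by blast
    have "(\<Sum>k\<in>{lo..int t}. hf u k) = (\<Sum>d\<in>(\<lambda>k. (u + int p * k, k)) ` {lo..int t}. K.dim (gr d))"
      by (subst sum.reindex) (auto simp: inj_on_def hf_def)
    also have "\<dots> \<le> card Z"
      by (rule sum_dim_le_card[OF _ Z(1)]) (use Z(3) in auto)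
    finally show ?thesis using Z(2) by simp
  qed
  then show ?thesis by blast
qed

section \<open>The modules \<open>M\<^sub>k\<close>\<close>

text \<open>The annihilator of \<open>M\<^sub>k\<close> over \<open>S\<close>, tested on homogeneous elements.\<close>

definition row_ideal :: "int \<Rightarrow> ('x, 'k) mpoly set" where
  "row_ideal k = {f. \<forall>i. \<forall>w\<in>gr (i, k). scale (incl f) w = 0}"

lemma annihilator_row: "annihilator (restrict_S scale) (internal_sum (row gr k)) {0} = row_ideal k"
proof (rule set_eqI)
  fix f :: "('x, 'k) mpoly"
  show "f \<in> annihilator (restrict_S scale) (internal_sum (row gr k)) {0} \<longleftrightarrow> f \<in> row_ideal k"
  proof
    assume f: "f \<in> annihilator (restrict_S scale) (internal_sum (row gr k)) {0}"
    have "scale (incl f) w = 0" if "w \<in> gr (i, k)" for i w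
    proof -
      have "w = (\<Sum>i'\<in>{i}. w) \<and> finite {i} \<and> (\<forall>i'\<in>{i}. w \<in> row gr k i')"
        using that by (simp add: row_def)
      then have "w \<in> internal_sum (row gr k)" unfolding internal_sum_def by blast
      then show ?thesis using f by (simp add: annihilator_def restrict_S_def)
    qed
    then show "f \<in> row_ideal k" by (simp add: row_ideal_def)
  next
    assume f: "f \<in> row_ideal k"
    have "restrict_S scale f w = 0" if w: "w \<in> internal_sum (row gr k)" for w
    proof -
      obtain I u where u: "w = (\<Sum>i\<in>I. u i)" "\<forall>i\<in>I. u i \<in> row gr k i"
        using w unfolding internal_sum_def by blast
      have "restrict_S scale f w = (\<Sum>i\<in>I. scale (incl f) (u i))"
        by (simp only: u(1) restrict_S_def scale_sum_right)
      also have "\<dots> = 0"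
      proof (intro sum.neutral ballI)
        fix i assume "i \<in> I"
        then have "u i \<in> gr (i, k)" using u(2) by (simp add: row_def)
        then show "scale (incl f) (u i) = 0" using f unfolding row_ideal_def by blast
      qed
      finally show ?thesis .
    qed
    then show "f \<in> annihilator (restrict_S scale) (internal_sum (row gr k)) {0}"
      by (simp add: annihilator_def)
  qed
qed

lemma krull_dim_row:
  "krull_dim (restrict_S scale) (internal_sum (row gr k)) {0} = krull_dim_quot (row_ideal k)"
  by (simp add: krull_dim_def annihilator_row)

lemma row_dim_eq: "row_dim scale gr k = krull_dim_quot (row_ideal k)"
  by (simp add: row_dim_def krull_dim_row)

lemma homogeneous_row_ideal: "homogeneous_ideal tdeg (row_ideal k)"
  unfolding homogeneous_ideal_def
proof (intro conjI ballI allI)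
  show "ideal (row_ideal k)"
    by (rule regular.subspaceI)
      (simp_all add: row_ideal_def incl_eq push_keys_0 push_keys_add scale_left_distrib
        incl_mult[unfolded incl_eq] flip: scale_scale)
  fix f t assume f: "f \<in> row_ideal k"
  have "scale (incl (part (\<lambda>a. tdeg a = t) f)) w = 0" if w: "w \<in> gr (i, k)" for i w
  proof -
    have "scale (part (\<lambda>a. tdeg a = t) (incl f)) w \<in> {0}"
      by (rule scale_part_mem[OF _ _ _ w]) (use f w in \<open>auto simp: comp_0 row_ideal_def\<close>)
    then show ?thesis by (simp add: incl_part)
  qed
  then show "part (\<lambda>a. tdeg a = t) f \<in> row_ideal k" by (simp add: row_ideal_def)
qed

lemma terms_row:
  "(a, e) \<in> terms (i, k) \<longleftrightarrow>
    e < r \<and> int (qdeg isl a) = i - int p * k - gu e \<and> int (qdeg (\<lambda>v. \<not> isl v) a) = k - gk e"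
  using terms_shifted[of a e "i - int p * k" k] by simp

lemma dim_gr: "K.dim (gr (i, k)) = hf (i - int p * k) k"
  by (simp add: hf_def)

lemma hf_below: "u < u_min \<Longrightarrow> hf u k = 0"
  using K.dim_le_card[of "{0}" "{}"] by (simp add: hf_def gr_eq_span terms_below)

text \<open>\<open>M\<^sub>k\<close> is generated over \<open>S\<close> by the finitely many products of generators with monomials in
  the \<open>y\<close>-variables, so its growth is bounded by that of \<open>S\<close> modulo the annihilator of \<open>M\<^sub>k\<close>.\<close>

lemma row_growth:
  assumes "krull_dim_quot (row_ideal k) < ereal (real (Suc d))"
  shows "\<exists>C. \<forall>x. (\<Sum>i\<in>{u_min + int p * k..x}. K.dim (gr (i, k))) \<le> C * Suc (nat (x - (u_min + int p * k))) ^ d"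
proof -
  obtain C where C: "\<And>t. std_count (row_ideal k) t \<le> C * Suc t ^ d"
    using std_count_growth_krull_dim[OF homogeneous_row_ideal assms] by blast
  define Y where "Y = (\<Union>e<r. (\<lambda>b. scale (mon (inr b)) (g e)) ` {b :: 'y \<Rightarrow>\<^sub>0 nat. int (tdeg b) = k - gk e})"
  have finY: "finite Y"
  proof -
    have "finite {b :: 'y \<Rightarrow>\<^sub>0 nat. int (tdeg b) = k - gk e}" for e
      by (rule finite_subset[OF _ finite_tdeg_le[of "nat (k - gk e)"]]) auto
    then show ?thesis unfolding Y_def by simp
  qed
  have "(\<Sum>i\<in>{u_min + int p * k..x}. K.dim (gr (i, k))) \<le>
      (C * card Y) * Suc (nat (x - (u_min + int p * k))) ^ d" for x
  proof -
    define t where "t = nat (x - (u_min + int p * k))"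
    define T where "T = {a \<in> std_mon (row_ideal k). tdeg a \<le> t}"
    define Z where "Z = (\<lambda>(a, y). restrict_S scale (mon a) y) ` (T \<times> Y)"
    have finT: "finite T" unfolding T_def by (rule finite_std_le)
    have finZ: "finite Z" unfolding Z_def using finT finY by simp
    have sub: "gr (i, k) \<subseteq> K.span Z" if i: "i \<le> x" for i
    proof -
      have "term_of z \<in> K.span Z" if z: "z \<in> terms (i, k)" for z
      proof -
        obtain a e where ae: "z = (a, e)" by (cases z)
        obtain a1 :: "'x \<Rightarrow>\<^sub>0 nat" and b1 :: "'y \<Rightarrow>\<^sub>0 nat" where a: "a = inl a1 + inr b1"
          using split_monomial[of a] by blast
        have e: "e < r" and a1: "int (tdeg a1) = i - int p * k - gu e" and b1: "int (tdeg b1) = k - gk e"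
          using z unfolding ae terms_row by (simp_all add: a qdeg_inl qdeg_inr)
        define \<beta> :: "'x + 'y \<Rightarrow>\<^sub>0 nat" where "\<beta> = inr b1"
        define y where "y = scale (mon \<beta>) (g e)"
        have "y \<in> Y" using e b1 by (auto simp: Y_def y_def \<beta>_def)
        have "y \<in> gr (bideg p \<beta> + dg e)" unfolding y_def by (rule mon_gr[OF g_gr[OF e]])
        moreover have "snd (bideg p \<beta> + dg e) = k"
          using b1 by (simp add: \<beta>_def bideg_qdeg qdeg_inr gk_def)
        ultimately have y_gr: "y \<in> gr (fst (bideg p \<beta> + dg e), k)"
          by (metis prod.collapse)
        have "tdeg a1 \<le> t" using a1 i u_min_le[OF e] by (simp add: t_def)
        then have mem: "mon a1 \<in> regular.K.span (row_ideal k \<union> mon ` T)"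
          unfolding T_def by (rule mon_in_std_span)
        have "regular.K.span (row_ideal k \<union> mon ` T) \<subseteq> {f. restrict_S scale f y \<in> K.span Z}"
        proof (rule regular.K.span_minimal)
          show "regular.K.subspace {f. restrict_S scale f y \<in> K.span Z}"
          proof (rule regular.K.subspaceI)
            fix c f assume "f \<in> {f. restrict_S scale f y \<in> K.span Z}"
            then have "scale (mconst c) (restrict_S scale f y) \<in> K.span Z" using K.span_scale by blast
            then show "mconst c * f \<in> {f. restrict_S scale f y \<in> K.span Z}"
              by (simp add: restrict_S_def incl_mult incl_mconst)
          qed (simp_all add: K.span_zero S.scale_left_distrib K.span_add)
          show "row_ideal k \<union> mon ` T \<subseteq> {f. restrict_S scale f y \<in> K.span Z}"
          proof
            fix f assume "f \<in> row_ideal k \<union> mon ` T"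
            then show "f \<in> {f. restrict_S scale f y \<in> K.span Z}"
            proof
              assume "f \<in> row_ideal k"
              then have "restrict_S scale f y = 0" using y_gr by (simp add: row_ideal_def restrict_S_def)
              then show ?thesis by (simp add: K.span_zero)
            next
              assume "f \<in> mon ` T"
              then have "restrict_S scale f y \<in> Z" using \<open>y \<in> Y\<close> by (auto simp: Z_def)
              then show ?thesis by (simp add: K.span_base)
            qed
          qed
        qed
        then have "restrict_S scale (mon a1) y \<in> K.span Z" using mem by blast
        moreover have "restrict_S scale (mon a1) y = term_of z"
          by (simp add: restrict_S_def incl_mon y_def \<beta>_def mon_mult ae a term_of_def)
        ultimately show ?thesis by simp
      qed
      then show ?thesis unfolding gr_eq_span by (intro K.span_minimal) auto
    qed
    have "(\<Sum>i\<in>{u_min + int p * k..x}. K.dim (gr (i, k))) =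
        (\<Sum>d\<in>(\<lambda>i. (i, k)) ` {u_min + int p * k..x}. K.dim (gr d))"
      by (subst sum.reindex) (auto simp: inj_on_def)
    also have "\<dots> \<le> card Z"
    proof (rule sum_dim_le_card[OF _ finZ])
      fix d assume "d \<in> (\<lambda>i. (i, k)) ` {u_min + int p * k..x}"
      then obtain i where "d = (i, k)" "i \<le> x" by auto
      then show "gr d \<subseteq> K.span Z" using sub by simp
    qed simp
    also have "\<dots> \<le> card (T \<times> Y)" unfolding Z_def by (rule card_image_le) (use finT finY in simp)
    also have "\<dots> = card T * card Y" by (rule card_cartesian_product)
    also have "\<dots> \<le> (C * Suc t ^ d) * card Y"
      using C[of t] by (intro mult_right_mono) (simp_all add: T_def std_count_def)
    finally show ?thesis by (simp only: t_def mult_ac)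
  qed
  then show ?thesis by blast
qed

text \<open>For large \<open>k\<close> the module \<open>M\<^bsub>k+1\<^esub>\<close> is generated by the \<open>y\<^sub>j M\<^sub>k\<close>, so annihilators increase
  and dimensions decrease; as these take finitely many values, they become constant.\<close>

lemma row_ideal_mono:
  assumes "(\<Sum>e<r. \<bar>gk e\<bar>) \<le> k"
  shows "row_ideal k \<subseteq> row_ideal (k + 1)"
proof
  fix f assume f: "f \<in> row_ideal k"
  have "scale (incl f) w = 0" if w: "w \<in> gr (i, k + 1)" for i w
  proof -
    have "w \<in> K.span (term_of ` terms (i, k + 1))" using w by (simp only: gr_eq_span)
    then have "scale (incl f) w \<in> {0}"
    proof (rule scale_K_span)
      fix x assume "x \<in> term_of ` terms (i, k + 1)"
      then obtain a e where x: "x = term_of (a, e)" "(a, e) \<in> terms (i, k + 1)" by auto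
      have e: "e < r" and deg: "int (qdeg (\<lambda>v. \<not> isl v) a) = k + 1 - gk e"
        using x(2) unfolding terms_row by simp_all
      have "\<bar>gk e\<bar> \<le> (\<Sum>e<r. \<bar>gk e\<bar>)" by (rule member_le_sum) (use e in auto)
      then have "qdeg (\<lambda>v. \<not> isl v) a \<noteq> 0" using deg assms by linarith
      then obtain j where j: "expo a (Inr j) \<noteq> 0" unfolding qdeg_not_isl by (metis sum.neutral)
      define s :: "'x + 'y \<Rightarrow>\<^sub>0 nat" where "s = Poly_Mapping.single (Inr j) 1"
      define a' where "a' = a - s"
      have a: "a = s + a'"
        by (rule poly_mapping_eqI)
          (use j in \<open>auto simp: a'_def s_def lookup_add lookup_minus lookup_single when_def\<close>)
      have "(a', e) \<in> terms (bideg p a' + dg e)" using e by (simp add: terms_def)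
      then have "term_of (a', e) \<in> gr (bideg p a' + dg e)" by (rule term_gr)
      moreover have "snd (bideg p a' + dg e) = k"
        using deg by (simp add: a s_def bideg_qdeg gk_def)
      ultimately have "term_of (a', e) \<in> gr (fst (bideg p a' + dg e), k)" by (metis prod.collapse)
      then have "scale (incl f) (term_of (a', e)) = 0" using f by (simp add: row_ideal_def)
      moreover have "x = scale (mon s) (term_of (a', e))"
        by (simp add: x(1) a term_of_def mon_mult)
      ultimately have "scale (incl f) x = 0"
        using scale_left_commute[of "incl f" "mon s" "term_of (a', e)"] by simp
      then show "scale (incl f) x \<in> {0}" by simp
    qed simp
    then show ?thesis by simp
  qed
  then show "f \<in> row_ideal (k + 1)" by (simp add: row_ideal_def)
qed

lemma row_dim_eventually_ldim: "\<exists>k0. \<forall>k\<ge>k0. krull_dim_quot (row_ideal k) = ldim scale gr"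
proof -
  define kk where "kk = (\<Sum>e<r. \<bar>gk e\<bar>)"
  have "row_ideal k \<subseteq> row_ideal k'" if k: "kk \<le> k" and "k \<le> k'" for k k'
    using that(2)
  proof (induct k' rule: int_ge_induct)
    case (step i)
    then show ?case using row_ideal_mono[of i] k unfolding kk_def by fastforce
  qed simp
  then have anti: "krull_dim_quot (row_ideal k') \<le> krull_dim_quot (row_ideal k)" if "kk \<le> k" "k \<le> k'" for k k'
    using krull_dim_quot_antimono that by blast
  define V where "V = (\<lambda>k. krull_dim_quot (row_ideal k)) ` {kk..}"
  have "V \<subseteq> insert (-\<infinity>) ((\<lambda>d. ereal (real d)) ` {..CARD('x)})"
    unfolding V_def using krull_dim_quot_cases by blast
  then have finV: "finite V" by (rule finite_subset) simp
  have "V \<noteq> {}" by (simp add: V_def)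
  then have "Min V \<in> V" by (rule Min_in[OF finV])
  then obtain k0 where k0: "kk \<le> k0" "Min V = krull_dim_quot (row_ideal k0)" unfolding V_def by auto
  have const: "krull_dim_quot (row_ideal k) = krull_dim_quot (row_ideal k0)" if "k \<ge> k0" for k
  proof (rule antisym)
    show "krull_dim_quot (row_ideal k) \<le> krull_dim_quot (row_ideal k0)" by (rule anti[OF k0(1) that])
    have "krull_dim_quot (row_ideal k) \<in> V" unfolding V_def using that k0(1) by (intro imageI) simp
    then show "krull_dim_quot (row_ideal k0) \<le> krull_dim_quot (row_ideal k)"
      unfolding k0(2)[symmetric] by (rule Min_le[OF finV])
  qed
  have "eventually (\<lambda>k. row_dim scale gr k = krull_dim_quot (row_ideal k0)) at_top"
    unfolding eventually_at_top_linorder row_dim_eq using const by blast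
  then have "(row_dim scale gr \<longlongrightarrow> krull_dim_quot (row_ideal k0)) at_top"
    by (rule tendsto_eventually)
  then have ldim: "ldim scale gr = krull_dim_quot (row_ideal k0)"
    unfolding ldim_def by (rule tendsto_Lim[rotated]) simp
  show ?thesis
    unfolding ldim by (intro exI[of _ k0] allI impI const)
qed

text \<open>The components are spanned by finitely many terms, so those of dimension \<open>0\<close> vanish, and the
  annihilator is the unit ideal.\<close>

lemma row_ideal_of_hf_0:
  assumes "\<And>u. hf u k = 0"
  shows "krull_dim_quot (row_ideal k) = -\<infinity>"
proof -
  have "gr (i, k) \<subseteq> {0}" for i
  proof -
    obtain B where B: "B \<subseteq> gr (i, k)" "K.independent B" "gr (i, k) \<subseteq> K.span B" "card B = K.dim (gr (i, k))"
      by (rule K.basis_exists)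
    have "finite B"
      using K.independent_span_bound[OF finite_imageI[OF finite_terms] B(2), of term_of "(i, k)"] B(1)
      unfolding gr_eq_span by blast
    then have "B = {}" using B(4) assms by (simp add: dim_gr)
    then show ?thesis using B(3) by simp
  qed
  then have zero: "w = 0" if "w \<in> gr (i, k)" for i w using that by blast
  have "f \<in> row_ideal k" for f
    unfolding row_ideal_def
  proof (intro CollectI allI ballI)
    fix i w assume "w \<in> gr (i, k)"
    then have "w = 0" by (rule zero)
    then show "scale (incl f) w = 0" by simp
  qed
  then have "row_ideal k = UNIV" by blast
  moreover have "\<not> prime_ideal P" if "UNIV \<subseteq> P" for P :: "('x, 'k) mpoly set"
    using that by (auto simp: prime_ideal_def)
  then have "{ereal (real n) | n. \<exists>P. (\<forall>i\<le>n. prime_ideal (P i) \<and> (UNIV :: ('x, 'k) mpoly set) \<subseteq> P i) \<and>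
      (\<forall>i<n. P i \<subset> P (Suc i))} = {}"
    by blast
  then have "krull_dim_quot (UNIV :: ('x, 'k) mpoly set) = -\<infinity>"
    unfolding krull_dim_quot_def by (simp only: Sup_empty bot_ereal_def)
  ultimately show ?thesis by simp
qed

end

section \<open>Reading off Hilbert coefficients\<close>

lemma of_nat_csum: "of_nat (csum f x) = csum (\<lambda>x. of_nat (f x) :: rat) x"
  by (simp add: csum_def)

lemma of_nat_iter_hilbert:
  "of_nat (iter_hilbert scale G i x) =
    (csum ^^ i) (\<lambda>x. rat_of_nat (vector_space.dim (\<lambda>c. scale (mconst c)) (G x))) x"
proof (induct i arbitrary: x)
  case (Suc i)
  have "iter_hilbert scale G (Suc i) x = csum (iter_hilbert scale G i) x"
    by (simp add: csum_def)
  then have "rat_of_nat (iter_hilbert scale G (Suc i) x) = csum (\<lambda>x. of_nat (iter_hilbert scale G i x)) x"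
    by (simp only: of_nat_csum)
  also have "(\<lambda>x. rat_of_nat (iter_hilbert scale G i x)) =
      (csum ^^ i) (\<lambda>x. rat_of_nat (vector_space.dim (\<lambda>c. scale (mconst c)) (G x)))"
    by (rule ext) (rule Suc)
  finally show ?case by simp
qed simp

lemma hilbert_poly_eqI:
  assumes "eventually (\<lambda>x. of_nat (iter_hilbert scale G i x) = poly P (of_int x)) at_top"
  shows "hilbert_poly scale G i = P"
  unfolding hilbert_poly_def
proof (rule the_equality)
  show "eventually (\<lambda>x. of_nat (iter_hilbert scale G i x) = poly P (of_int x)) at_top" by (rule assms)
  fix Q :: "rat poly" assume "eventually (\<lambda>x. of_nat (iter_hilbert scale G i x) = poly Q (of_int x)) at_top"
  with assms have "eventually (\<lambda>x::int. poly Q (of_int x) = poly P (of_int x)) at_top"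
    by eventually_elim simp
  then show "Q = P" by (rule poly_eq_of_eventually)
qed

lemma hilbert_coeff_zero:
  assumes "krull_dim scale (internal_sum G) {0} = -\<infinity>"
  shows "hilbert_coeff scale G i = (\<lambda>_. 0)"
  unfolding hilbert_coeff_def
proof (rule the_equality)
  show "is_hilbert_coeffs scale G i (\<lambda>_. 0)"
    unfolding is_hilbert_coeffs_def using assms by simp
  fix e assume "is_hilbert_coeffs scale G i e"
  then show "e = (\<lambda>_. 0)"
    unfolding is_hilbert_coeffs_def using assms by (simp add: fun_eq_iff)
qed

text \<open>Newton's expansion provides the coefficients and shows that they are unique; they are integers
  because the Hilbert polynomial is integer-valued at large integers.\<close>

lemma hilbert_coeff_newton:
  assumes dim: "krull_dim scale (internal_sum G) {0} = ereal (real d)"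
    and P: "eventually (\<lambda>x. of_nat (iter_hilbert scale G i x) = poly P (of_int x)) at_top"
    and zero: "(nabla ^^ (d + i)) P = 0"
  shows "j < d + i \<Longrightarrow> rat_of_int (hilbert_coeff scale G i j) = (-1) ^ j * poly ((nabla ^^ (d + i - 1 - j)) P) (-1)"
    and "j \<ge> d + i \<Longrightarrow> hilbert_coeff scale G i j = 0"
proof -
  let ?D = "d + i"
  define c where "c j = (-1) ^ j * poly ((nabla ^^ (?D - 1 - j)) P) (-1)" for j
  have "eventually (\<lambda>x::int. poly P (of_int x) \<in> \<int>) at_top"
    using P
  proof eventually_elim
    case (elim x)
    then show ?case by (metis Ints_of_nat)
  qed
  then have "poly P (of_int x) \<in> \<int>" for x
    by (rule integer_valued_everywhere[OF zero])
  then have "poly ((nabla ^^ s) P) (-1) \<in> \<int>" for s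
    using nabla_pow_in_Ints[of P s "-1"] by simp
  then have int: "c j \<in> \<int>" for j
    unfolding c_def by (intro Ints_mult Ints_power) simp_all
  (* rounding only changes the type, as c j is an integer *)
  define e where "e j = (if j < ?D then \<lfloor>c j\<rfloor> else 0)" for j
  have e: "rat_of_int (e j) = c j" if "j < ?D" for j
    using that int[of j] by (simp add: e_def)
  have hsum: "(\<Sum>j<?D. (- 1) ^ j * rat_of_int (e' j) * ((x + of_nat (?D - j - 1)) gchoose (?D - j - 1))) =
      poly (\<Sum>j<?D. smult ((- 1) ^ j * rat_of_int (e' j)) (binp (?D - 1 - j))) x" for e' x
    unfolding poly_sum poly_smult poly_binp by (intro sum.cong refl) (simp add: diff_commute)
  have expand: "P = (\<Sum>j<?D. smult ((- 1) ^ j * rat_of_int (e j)) (binp (?D - 1 - j)))"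
  proof -
    have "P = (\<Sum>s<?D. smult (poly ((nabla ^^ s) P) (-1)) (binp s))"
      by (rule newton_expansion[OF zero])
    also have "\<dots> = (\<Sum>j<?D. smult (poly ((nabla ^^ (?D - Suc j)) P) (-1)) (binp (?D - Suc j)))"
      by (rule sum.nat_diff_reindex[symmetric])
    also have "\<dots> = (\<Sum>j<?D. smult ((- 1) ^ j * rat_of_int (e j)) (binp (?D - 1 - j)))"
    proof (intro sum.cong refl)
      fix j assume "j \<in> {..<?D}"
      moreover have "((-1) ^ j * (-1) ^ j :: rat) = 1" by (simp flip: power_mult_distrib)
      ultimately show "smult (poly ((nabla ^^ (?D - Suc j)) P) (-1)) (binp (?D - Suc j)) =
          smult ((- 1) ^ j * rat_of_int (e j)) (binp (?D - 1 - j))"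
        by (simp add: e c_def mult.assoc[symmetric])
    qed
    finally show ?thesis .
  qed
  have "hilbert_coeff scale G i = e"
    unfolding hilbert_coeff_def
  proof (rule the_equality)
    show "is_hilbert_coeffs scale G i e"
      unfolding is_hilbert_coeffs_def hilbert_poly_eqI[OF P] dim
    proof (intro conjI impI allI)
      fix d' j assume "ereal (real d) = ereal (real d')" "d' + i \<le> j"
      then show "e j = 0" by (simp add: e_def)
    next
      fix d' x assume "ereal (real d) = ereal (real d')"
      then have d': "d' = d" by simp
      show "poly P x = (\<Sum>j<d' + i. (- 1) ^ j * rat_of_int (e j) *
          ((x + of_nat (d' + i - j - 1)) gchoose (d' + i - j - 1)))"
        unfolding d' hsum expand[symmetric] ..
    qed simp
    fix e' assume e': "is_hilbert_coeffs scale G i e'"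
    have "(\<forall>j\<ge>?D. e' j = 0) \<and> (\<forall>x. poly P x = (\<Sum>j<?D. (- 1) ^ j * rat_of_int (e' j) *
        ((x + of_nat (?D - j - 1)) gchoose (?D - j - 1))))"
      using conjunct2[OF e'[unfolded is_hilbert_coeffs_def hilbert_poly_eqI[OF P] dim]]
      by (elim allE[of _ d]) (erule mp, rule refl)
    then have zero': "\<forall>j\<ge>?D. e' j = 0" and
      "\<forall>x. poly P x = poly (\<Sum>j<?D. smult ((- 1) ^ j * rat_of_int (e' j)) (binp (?D - 1 - j))) x"
      unfolding hsum by blast+
    then have P': "P = (\<Sum>j<?D. smult ((- 1) ^ j * rat_of_int (e' j)) (binp (?D - 1 - j)))"
      by (intro poly_eq_poly_eq_iff[THEN iffD1] ext) simp
    show "e' = e"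
    proof
      fix j
      show "e' j = e j"
      proof (cases "j < ?D")
        case True
        have "(- 1) ^ j * rat_of_int (e' j) = (- 1) ^ j * rat_of_int (e j)"
          using binp_coordinates_unique[OF P' True] binp_coordinates_unique[OF expand True] by simp
        then show ?thesis by simp
      next
        case False
        then show ?thesis using zero' by (simp add: e_def)
      qed
    qed
  qed
  then show "j < ?D \<Longrightarrow> rat_of_int (hilbert_coeff scale G i j) = (-1) ^ j * poly ((nabla ^^ (?D - 1 - j)) P) (-1)"
    and "j \<ge> ?D \<Longrightarrow> hilbert_coeff scale G i j = 0"
    by (simp_all add: e c_def, simp add: e_def)
qed

section \<open>The Hilbert function for large \<open>k\<close>\<close>

context generated_bigraded_module
begin

text \<open>For each fixed \<open>u\<close> the function \<open>k \<mapsto> hf u k\<close> is a polynomial of degree below the fibre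
  dimension, from a bound on that does not depend on \<open>u\<close>. So in the expansion in powers of \<open>k\<close> the
  coefficients of all higher powers vanish identically.\<close>

lemma hf_polynomial_in_k:
  assumes l: "krull_dim_quot fibre_ideal < ereal (real (Suc l))"
  shows "\<exists>k1 \<Phi>. (\<forall>r. ev_poly (\<Phi> r)) \<and> (\<forall>k\<ge>k1. \<forall>u. rat_of_nat (hf u k) = (\<Sum>r<l. \<Phi> r u * of_int k ^ r))"
proof -
  obtain k1 m \<Phi> where \<Phi>: "\<forall>r. ev_poly (\<Phi> r)"
    and hf: "\<forall>k\<ge>k1. \<forall>u. rat_of_nat (hf u k) = (\<Sum>r<(m::nat). \<Phi> r u * of_int k ^ r)"
    using bisep_polynomial_in_second[OF bisep_hf] by (elim exE conjE)
  have high: "\<Phi> r u = 0" if r: "l \<le> r" "r < m" for r u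
  proof -
    define P where "P = (\<Sum>r<m. monom (\<Phi> r u) r)"
    have poly_P: "poly P x = (\<Sum>r<m. \<Phi> r u * x ^ r)" for x
      by (simp add: P_def poly_sum poly_monom)
    define f where "f k = (if k < k1 then 0 else rat_of_nat (hf u k))" for k
    have "\<forall>k\<ge>k1. f k = poly P (of_int k)" using hf by (simp add: f_def poly_P)
    then have P: "eventually (\<lambda>k. f k = poly P (of_int k)) at_top"
      unfolding eventually_at_top_linorder by blast
    obtain C where C: "\<forall>t::nat. (\<Sum>k\<in>{k1..int t}. hf u k) \<le> C * Suc t ^ l"
      using sum_hf_le[OF l] by blast
    have "csum f x \<le> of_nat C * (of_int x + 1) ^ l" if x: "x \<ge> 0" for x
    proof -
      have "csum f x = (\<Sum>k\<in>{k1..x}. f k)" by (rule csum_eq_interval) (simp add: f_def)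
      also have "\<dots> = rat_of_nat (\<Sum>k\<in>{k1..x}. hf u k)" by (simp add: f_def)
      also have "\<dots> \<le> rat_of_nat (C * Suc (nat x) ^ l)"
        using spec[OF C, of "nat x"] x by (simp only: of_nat_le_iff int_nat_eq if_True)
      also have "\<dots> = of_nat C * (of_int x + 1) ^ l"
        using x by (simp add: add.commute)
      finally show ?thesis .
    qed
    then have bound: "eventually (\<lambda>x. csum f x \<le> of_nat C * (of_int x + 1) ^ l) at_top"
      unfolding eventually_at_top_linorder by blast
    have zero: "(nabla ^^ l) P = 0"
      by (rule nabla_zero_of_bounded_csum[of k1 f, OF _ _ P bound]) (simp_all add: f_def)
    have "coeff P r = 0"
    proof (cases l)
      case 0
      then show ?thesis using zero by simp
    next
      case (Suc l')
      then have "degree P \<le> l'" using zero degree_le_of_nabla by blast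
      then show ?thesis using r(1) Suc by (intro coeff_eq_0) simp
    qed
    then show ?thesis using r(2) by (simp add: P_def coeff_sum)
  qed
  define \<Psi> where "\<Psi> r = (\<lambda>u. (if r < m then 1 else 0) * \<Phi> r u)" for r
  have "ev_poly (\<Psi> r)" for r
    unfolding \<Psi>_def by (rule ev_poly_cmult) (use \<Phi> in blast)
  moreover have "rat_of_nat (hf u k) = (\<Sum>r<l. \<Psi> r u * of_int k ^ r)" if "k \<ge> k1" for k u
  proof -
    have "rat_of_nat (hf u k) = (\<Sum>r<m. \<Phi> r u * of_int k ^ r)" using hf that by blast
    also have "\<dots> = (\<Sum>r<max l m. \<Psi> r u * of_int k ^ r)"
      by (rule sum.mono_neutral_cong_left) (auto simp: \<Psi>_def)
    also have "\<dots> = (\<Sum>r<l. \<Psi> r u * of_int k ^ r)"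
      by (rule sum.mono_neutral_right) (auto simp: \<Psi>_def high)
    finally show ?thesis .
  qed
  ultimately show ?thesis by blast
qed

lemma row_dims: "vector_space.dim (\<lambda>c. restrict_S scale (mconst c)) (row gr k x) = hf (x - int p * k) k"
  by (simp only: restrict_S_mconst row_def dim_gr)

text \<open>The growth bound controls the sums of the Hilbert function, i.e. the case \<open>i = 1\<close>; the other
  Hilbert polynomials are its difference and its iterated sums.\<close>

lemma row_hilbert_poly_degree:
  assumes d: "krull_dim_quot (row_ideal k) = ereal (real d)"
    and P: "\<And>i. eventually (\<lambda>x. (csum ^^ i) (\<lambda>x. rat_of_nat (hf (x - int p * k) k)) x = poly (P i) (of_int x)) at_top"
  shows "(nabla ^^ (d + i)) (P i) = 0"
proof (induct i)
  case 0
  let ?f = "\<lambda>x. rat_of_nat (hf (x - int p * k) k)" and ?lo = "u_min + int p * k"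
  obtain C where C: "\<forall>x. (\<Sum>i\<in>{?lo..x}. K.dim (gr (i, k))) \<le> C * Suc (nat (x - ?lo)) ^ d"
    using row_growth[of k d] d by auto
  have below: "?f x = 0" if "x < ?lo" for x
    using hf_below[of "x - int p * k" k] that by simp
  have "csum ?f x \<le> of_nat C * (of_int x + (1 - of_int ?lo)) ^ d" if x: "x \<ge> ?lo" for x
  proof -
    have "csum ?f x = (\<Sum>i\<in>{?lo..x}. ?f i)" by (rule csum_eq_interval) (rule below)
    also have "\<dots> = rat_of_nat (\<Sum>i\<in>{?lo..x}. K.dim (gr (i, k)))" by (simp add: dim_gr)
    also have "\<dots> \<le> rat_of_nat (C * Suc (nat (x - ?lo)) ^ d)"
      using C by (simp only: of_nat_le_iff)
    also have "\<dots> = of_nat C * (of_int (int (Suc (nat (x - ?lo))))) ^ d" by simp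
    also have "int (Suc (nat (x - ?lo))) = x + (1 - ?lo)" using x by simp
    finally show ?thesis by simp
  qed
  then have "eventually (\<lambda>x. csum ?f x \<le> of_nat C * (of_int x + (1 - of_int ?lo)) ^ d) at_top"
    unfolding eventually_at_top_linorder by blast
  then show ?case
    using nabla_zero_of_bounded_csum[of ?lo ?f "P 0"] below P[of 0] by simp
next
  case (Suc i)
  let ?f = "\<lambda>x. rat_of_nat (hf (x - int p * k) k)" and ?lo = "u_min + int p * k"
  have below: "(csum ^^ i) ?f x = 0" if "x < ?lo" for x
    using that
  proof (induct i arbitrary: x)
    case 0
    then show ?case using hf_below[of "x - int p * k" k] by simp
  next
    case (Suc i)
    have "csum ((csum ^^ i) ?f) x = 0" by (rule csum_eq_0[OF Suc.hyps Suc.prems])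
    then show ?case by simp
  qed
  have "nabla (P (Suc i)) = P i"
    by (rule nabla_of_csum[OF below]) (use P[of "Suc i"] P[of i] in simp_all)
  then show ?case using Suc by (simp add: funpow_swap1)
qed

text \<open>The coefficient \<open>e\<^sub>j\<close> is, up to sign, the value at \<open>-1\<close> of the \<open>(D-1-j)\<close>-th difference of
  the Hilbert polynomial \<open>\<Sum>\<^sub>r k\<^sup>r G\<^sub>r(x - p k)\<close>. Differences commute with the shift, so this is
  \<open>\<Sum>\<^sub>r k\<^sup>r (\<nabla>\<^bsup>D-1-j\<^esup> G\<^sub>r)(-1 - p k)\<close>, where the differences of \<open>G\<^sub>r\<close> have degree at most \<open>j\<close>.\<close>

lemma row_coeff_polynomial:
  assumes l: "krull_dim_quot fibre_ideal < ereal (real (Suc l))"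
    and d: "\<forall>k\<ge>k0. krull_dim_quot (row_ideal k) = ereal (real d)"
  shows "\<exists>Q k1. (\<forall>j<d + i. Q j = 0 \<or> degree (Q j) + 1 \<le> l + j) \<and>
    (\<forall>k\<ge>k1. (\<forall>j<d + i. rat_of_int (row_coeff scale gr i j k) = poly (Q j) (of_int k)) \<and>
      (\<forall>j\<ge>d + i. row_coeff scale gr i j k = 0))"
proof -
  let ?D = "d + i"
  obtain k' \<Phi> where \<Phi>: "\<forall>r. ev_poly (\<Phi> r)"
    and hf: "\<forall>k\<ge>k'. \<forall>u. rat_of_nat (hf u k) = (\<Sum>r<l. \<Phi> r u * of_int k ^ r)"
    using hf_polynomial_in_k[OF l] by (elim exE conjE)
  define k1 where "k1 = max k0 k'"
  have "\<forall>ri. \<exists>P. eventually (\<lambda>x. (csum ^^ snd ri) (\<Phi> (fst ri)) x = poly P (of_int x)) at_top"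
    using ev_poly_csum_pow \<Phi> unfolding ev_poly_def by blast
  from choice[OF this] obtain G' where
    G': "\<forall>ri. eventually (\<lambda>x. (csum ^^ snd ri) (\<Phi> (fst ri)) x = poly (G' ri) (of_int x)) at_top" ..
  define G where "G i r = G' (r, i)" for i r
  have G: "eventually (\<lambda>x. (csum ^^ i) (\<Phi> r) x = poly (G i r) (of_int x)) at_top" for i r
    using spec[OF G', of "(r, i)"] by (simp add: G_def)
  define P where "P k i = (\<Sum>r<l. smult (of_int k ^ r) (pcompose (G i r) [:- of_int (int p * k), 1:]))" for k i
  have P: "eventually (\<lambda>x. (csum ^^ i) (\<lambda>x. rat_of_nat (hf (x - int p * k) k)) x = poly (P k i) (of_int x)) at_top"
    if k: "k \<ge> k1" for k i
  proof -
    have "(\<lambda>x. rat_of_nat (hf (x - int p * k) k)) = (\<lambda>x. \<Sum>r<l. of_int k ^ r * \<Phi> r (x - int p * k))"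
      using hf k by (intro ext) (simp add: k1_def mult.commute)
    then have sums: "(csum ^^ i) (\<lambda>x. rat_of_nat (hf (x - int p * k) k)) =
        (\<lambda>x. \<Sum>r<l. of_int k ^ r * (csum ^^ i) (\<Phi> r) (x - int p * k))"
      using csum_pow_combination[where f = \<Phi> and i = i and l = l] \<Phi> by simp
    have "eventually (\<lambda>x. \<forall>r\<in>{..<l}. (csum ^^ i) (\<Phi> r) x = poly (G i r) (of_int x)) at_top"
      by (rule eventually_ball_finite) (simp_all add: G)
    then obtain x0 where x0: "\<forall>x\<ge>x0. \<forall>r\<in>{..<l}. (csum ^^ i) (\<Phi> r) x = poly (G i r) (of_int x)"
      unfolding eventually_at_top_linorder by blast
    have "(csum ^^ i) (\<lambda>x. rat_of_nat (hf (x - int p * k) k)) x = poly (P k i) (of_int x)"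
      if x: "x \<ge> x0 + int p * k" for x
    proof -
      have "(csum ^^ i) (\<Phi> r) (x - int p * k) = poly (G i r) (of_int (x - int p * k))" if "r \<in> {..<l}" for r
        using x0 x that by simp
      then have "(\<Sum>r<l. of_int k ^ r * (csum ^^ i) (\<Phi> r) (x - int p * k)) =
          (\<Sum>r<l. of_int k ^ r * poly (G i r) (of_int (x - int p * k)))"
        by (intro sum.cong refl) simp
      then show ?thesis
        unfolding sums P_def by (simp add: poly_sum poly_pcompose)
    qed
    then show ?thesis unfolding eventually_at_top_linorder by blast
  qed
  have zero: "(nabla ^^ ?D) (P k i) = 0" if k: "k \<ge> k1" for k
  proof (rule row_hilbert_poly_degree)
    show "krull_dim_quot (row_ideal k) = ereal (real d)" using spec[OF d, of k] k by (simp add: k1_def)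
  qed (rule P[OF k])
  have nabla_P: "poly ((nabla ^^ s) (P k i)) x =
      (\<Sum>r<l. of_int k ^ r * poly ((nabla ^^ s) (G i r)) (x - of_int (int p * k)))" for s k x
    unfolding P_def
    by (simp add: nabla_pow_sum nabla_pow_linear nabla_pow_shift poly_sum poly_pcompose)
  have G_zero: "(nabla ^^ ?D) (G i r) = 0" if r: "r < l" for r
  proof -
    have "poly ((nabla ^^ ?D) (G i r)) u = 0" for u
    proof -
      define R where "R = (\<Sum>r<l. monom (poly ((nabla ^^ ?D) (G i r)) u) r)"
      have "poly R (of_int k) = poly 0 (of_int k)" if "k \<ge> k1" for k
        using nabla_P[of ?D k "u + of_int (int p * k)"] zero[OF that]
        by (simp add: R_def poly_sum poly_monom mult.commute)
      then have "R = 0"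
        by (intro poly_eq_of_eventually) (auto simp: eventually_at_top_linorder)
      then have "coeff R r = 0" by simp
      then show ?thesis using r by (simp add: R_def coeff_sum)
    qed
    then show ?thesis by (intro poly_eq_poly_eq_iff[THEN iffD1]) auto
  qed
  define Q where "Q j = smult ((-1) ^ j)
      (\<Sum>r<l. monom 1 r * pcompose ((nabla ^^ (?D - 1 - j)) (G i r)) [:-1, - of_nat p:])" for j
  have "Q j = 0 \<or> degree (Q j) + 1 \<le> l + j" if j: "j < ?D" for j
  proof (cases l)
    case 0
    then show ?thesis by (simp add: Q_def)
  next
    case (Suc l')
    have "degree (Q j) \<le> l' + j"
      unfolding Q_def
    proof (intro order.trans[OF degree_smult_le] degree_sum_le)
      fix r assume r: "r \<in> {..<l}"
      let ?H = "(nabla ^^ (?D - 1 - j)) (G i r)"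
      have "(nabla ^^ Suc j) ?H = (nabla ^^ (Suc j + (?D - 1 - j))) (G i r)"
        by (simp only: funpow_add comp_apply)
      also have "Suc j + (?D - 1 - j) = ?D" using j by simp
      finally have "(nabla ^^ Suc j) ?H = 0" using G_zero r by simp
      then have H: "degree ?H \<le> j" by (rule degree_le_of_nabla)
      have "degree (pcompose ?H [:-1, - of_nat p:]) \<le> degree ?H * degree [:-1, - rat_of_nat p:]"
        by (rule degree_pcompose_le)
      also have "\<dots> \<le> j * 1" using H by (intro mult_mono) simp_all
      finally have "degree (monom 1 r * pcompose ?H [:-1, - of_nat p:]) \<le> r + j"
        by (intro order.trans[OF degree_mult_le] add_mono) (simp_all add: degree_monom_eq)
      then show "degree (monom 1 r * pcompose ?H [:-1, - of_nat p:]) \<le> l' + j"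
        using r Suc by simp
    qed simp
    then show ?thesis using Suc by simp
  qed
  moreover have "(\<forall>j<?D. rat_of_int (row_coeff scale gr i j k) = poly (Q j) (of_int k)) \<and>
      (\<forall>j\<ge>?D. row_coeff scale gr i j k = 0)" if k: "k \<ge> k1" for k
  proof -
    have dim: "krull_dim (restrict_S scale) (internal_sum (row gr k)) {0} = ereal (real d)"
      using spec[OF d, of k] k by (simp add: krull_dim_row k1_def)
    have Pi: "eventually (\<lambda>x. of_nat (iter_hilbert (restrict_S scale) (row gr k) i x) = poly (P k i) (of_int x)) at_top"
      using P[OF k, of i] by (simp only: of_nat_iter_hilbert row_dims)
    note coeffs = hilbert_coeff_newton[OF dim Pi zero[OF k]]
    have "poly (Q j) (of_int k) = (-1) ^ j * poly ((nabla ^^ (?D - 1 - j)) (P k i)) (-1)" for j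
      unfolding nabla_P by (simp add: Q_def poly_sum poly_monom poly_pcompose mult.commute)
    then show ?thesis using coeffs by (simp add: row_coeff_def)
  qed
  ultimately show ?thesis by blast
qed

end

theorem theorem2p5:
  fixes scale :: "('x::finite + 'y::finite, 'k::field) mpoly \<Rightarrow> 'm::ab_group_add \<Rightarrow> 'm"
    and p :: nat and gr :: "int \<times> int \<Rightarrow> 'm set"
  assumes "bigraded_module scale p gr"
    and "fin_gen scale"
  shows "\<forall>i::nat. \<exists>Q :: nat \<Rightarrow> rat poly.
    (\<forall>j::nat. ereal (real j) \<le> ldim scale gr + ereal (real i) - 1 \<longrightarrow>
       deg (Q j) \<le> fibre_dim scale + ereal (real j) - 1) \<and>
    (\<forall>\<^sub>F k::int in at_top. \<forall>j::nat.
       (ereal (real j) \<le> ldim scale gr + ereal (real i) - 1 \<longrightarrow>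
          of_int (row_coeff scale gr i j k) = poly (Q j) (of_int k)) \<and>
       (ereal (real j) > ldim scale gr + ereal (real i) - 1 \<longrightarrow>
          row_coeff scale gr i j k = 0))"
proof
  fix i :: nat
  interpret bigraded_module scale p gr by (rule assms(1))
  obtain r g dg where g: "\<And>e. e < r \<Longrightarrow> g e \<in> gr (dg e)" "span (g ` {..<(r::nat)}) = UNIV"
    by (rule homogeneous_generators[OF assms(2)]) (rule that)
  interpret generated_bigraded_module scale p gr r g dg
    by unfold_locales (use g in auto)
  obtain k0 where k0: "\<forall>k\<ge>k0. krull_dim_quot (row_ideal k) = ldim scale gr"
    using row_dim_eventually_ldim by blast
  have ldim_cases: "ldim scale gr = -\<infinity> \<or> (\<exists>d::nat. ldim scale gr = ereal (real d))"
    using krull_dim_quot_cases[of "row_ideal k0"] k0 by auto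
  show "\<exists>Q :: nat \<Rightarrow> rat poly.
    (\<forall>j::nat. ereal (real j) \<le> ldim scale gr + ereal (real i) - 1 \<longrightarrow>
       deg (Q j) \<le> fibre_dim scale + ereal (real j) - 1) \<and>
    (\<forall>\<^sub>F k::int in at_top. \<forall>j::nat.
       (ereal (real j) \<le> ldim scale gr + ereal (real i) - 1 \<longrightarrow>
          of_int (row_coeff scale gr i j k) = poly (Q j) (of_int k)) \<and>
       (ereal (real j) > ldim scale gr + ereal (real i) - 1 \<longrightarrow>
          row_coeff scale gr i j k = 0))"
  proof (cases "ldim scale gr = -\<infinity>")
    case True
    have "row_coeff scale gr i j k = 0" if "k \<ge> k0" for j k
      unfolding row_coeff_def
      by (subst hilbert_coeff_zero) (use k0 that True in \<open>simp_all add: krull_dim_row\<close>)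
    then have "\<forall>\<^sub>F k::int in at_top. \<forall>j::nat. row_coeff scale gr i j k = 0"
      unfolding eventually_at_top_linorder by blast
    moreover have "ldim scale gr + ereal (real i) - 1 = -\<infinity>"
      by (simp add: True one_ereal_def)
    ultimately show ?thesis
      by (intro exI[of _ "\<lambda>_. 0"]) simp
  next
    case False
    then obtain d where d: "ldim scale gr = ereal (real d)" using ldim_cases by blast
    have in_range: "ereal (real j) \<le> ldim scale gr + ereal (real i) - 1 \<longleftrightarrow> j < d + i" for j
    proof -
      have "ldim scale gr + ereal (real i) - 1 = ereal (real d + real i - 1)"
        by (simp add: d one_ereal_def)
      then show ?thesis by (simp, linarith)
    qed
    have dim: "\<forall>k\<ge>k0. krull_dim_quot (row_ideal k) = ereal (real d)" using k0 d by simp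
    \<comment> \<open>if the fibre vanished, then so would \<open>hf\<close> for large \<open>k\<close>, and with it \<open>M\<^sub>k\<close>\<close>
    have "fibre_dim scale \<noteq> -\<infinity>"
    proof
      assume "fibre_dim scale = -\<infinity>"
      then have "krull_dim_quot fibre_ideal < ereal (real (Suc 0))" by (simp add: fibre_dim_eq)
      then obtain k1 where k1: "\<forall>k\<ge>k1. \<forall>u. rat_of_nat (hf u k) = 0"
        using hf_polynomial_in_k[of 0] by auto
      have "krull_dim_quot (row_ideal (max k0 k1)) = -\<infinity>"
        by (rule row_ideal_of_hf_0) (use k1 in simp)
      then show False using dim by simp
    qed
    then obtain l :: nat where l: "fibre_dim scale = ereal (real l)"
      using krull_dim_quot_cases[of fibre_ideal] by (auto simp: fibre_dim_eq)
    obtain Q k1 where Q: "\<forall>j<d + i. Q j = 0 \<or> degree (Q j) + 1 \<le> l + j"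
      and coeffs: "\<forall>k\<ge>k1. (\<forall>j<d + i. rat_of_int (row_coeff scale gr i j k) = poly (Q j) (of_int k)) \<and>
        (\<forall>j\<ge>d + i. row_coeff scale gr i j k = 0)"
      using row_coeff_polynomial[OF _ dim, of l i] l by (auto simp: fibre_dim_eq)
    have "deg (Q j) \<le> fibre_dim scale + ereal (real j) - 1" if "j < d + i" for j
    proof -
      have "fibre_dim scale + ereal (real j) - 1 = ereal (real l + real j - 1)"
        by (simp add: l one_ereal_def)
      moreover have "deg (Q j) \<le> ereal (real l + real j - 1)"
      proof (cases "Q j = 0")
        case True
        then show ?thesis by (simp add: deg_def one_ereal_def)
      next
        case nonzero: False
        then have "degree (Q j) + 1 \<le> l + j" using Q that by blast
        then show ?thesis using nonzero by (simp add: deg_def)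
      qed
      ultimately show ?thesis by simp
    qed
    moreover have "\<forall>\<^sub>F k::int in at_top. \<forall>j::nat.
       (j < d + i \<longrightarrow> of_int (row_coeff scale gr i j k) = poly (Q j) (of_int k)) \<and>
       (\<not> j < d + i \<longrightarrow> row_coeff scale gr i j k = 0)"
      unfolding eventually_at_top_linorder by (rule exI[of _ k1]) (use coeffs in \<open>simp add: not_less\<close>)
    ultimately show ?thesis
      unfolding not_le[symmetric] in_range by (intro exI[of _ Q]) blast
  qed
qed

end
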